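(* Let $x > 1$ and $h \in \mathbb{R}$ be real numbers. Then $$\frac{1}{M} \sum_{1 \le n < M} \eta_{\log x,\,h}(n) = -\frac{\Lambda(x)}{\log x}\, x^{-\left(\frac{1}{2}+ih\right)} + O\!\left(\frac{\log M}{M}\right)$$ as $M \to \infty$ through the positive integers, where $x$ and $h$ are fixed (so the implied constant may depend on $x$ and $h$).
   Context: Let $Z = \{\rho \in \mathbb{C} : \zeta(\rho) = 0,\ 0 < \Re(\rho) < 1\}$ be the set of non-trivial zeros of the Riemann zeta function, and let $S = \{-i(\rho - \tfrac{1}{2}) : \rho \in Z\}$, where each element is counted with the multiplicity of the corresponding zero $\rho$. The Riemann hypothesis (equivalent to $S \subseteq \mathbb{R}$) is not assumed. For real $a > 0$, $h \in \mathbb{R}$ and an integer $n \ge 1$, define $$\eta_{a,h}(n) = \frac{1}{a}\log\frac{n}{a} + \sum_{\substack{t + h \in S \\ \lfloor a\,\Re(t)/(2\pi) \rfloor = n}} \left(e^{iat} - 1\right),$$ where the sum runs over all complex $t$ with $t+h \in S$ (with multiplicity) satisfying the indicated condition; it is a finite sum. $\Lambda$ is the von Mangoldt function extended to real arguments $x > 1$: $\Lambda(x) = \log p$ if $x = p^k$ for some prime $p$ and integer $k \ge 1$, and $\Lambda(x) = 0$ otherwise. For real $x>0$ and complex $s$, $x^{s} = e^{s \log x}$. *)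

theory Defs
  imports
    "HOL-Complex_Analysis.Complex_Analysis"
    "HOL-Number_Theory.Prime_Powers"
    "HOL-Library.Landau_Symbols"
begin

(* The Riemann zeta function is the holomorphic function on the complex plane minus 1 that
   agrees with its Dirichlet series on the half plane Re s > 1. The value at the pole is
   irrelevant; it is set to 0 to make the function unique. *)
definition is_zeta :: "(complex \<Rightarrow> complex) \<Rightarrow> bool" where
  "is_zeta f \<longleftrightarrow>
     f holomorphic_on (- {1}) \<and>
     (\<forall>s. Re s > 1 \<longrightarrow> (\<lambda>n. 1 / of_nat (Suc n) powr s) sums f s) \<and>
     f 1 = 0"

definition zeta :: "complex \<Rightarrow> complex" where
  "zeta = (THE f. is_zeta f)"

lemma is_zeta_unique:
  assumes f: "is_zeta f" and g: "is_zeta g"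
  shows "f = g"
proof
  fix s
  show "f s = g s"
  proof (cases "s = 1")
    case True
    then show ?thesis using f g by (simp add: is_zeta_def)
  next
    case False
    have "connected (- {1 :: complex})"
      by (rule connected_punctured_universe) simp
    moreover have "(2 :: complex) islimpt {s. Re s > 1}"
      by (rule interior_limit_point) (simp add: interior_open open_halfspace_Re_gt)
    moreover have "(\<lambda>z. f z - g z) holomorphic_on (- {1})"
      using f g by (auto simp: is_zeta_def intro: holomorphic_on_diff)
    moreover have "f z - g z = 0" if "z \<in> {s. Re s > 1}" for z
      using f g that sums_unique2[of _ "f z" "g z"] by (auto simp: is_zeta_def)
    ultimately have "f s - g s = 0"
      using False
      by (intro analytic_continuation[of "\<lambda>z. f z - g z" "- {1}" "{s. Re s > 1}" 2 s]) auto
    then show ?thesis by simp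
  qed
qed

lemma zeta_eqI: "is_zeta f \<Longrightarrow> zeta = f"
  unfolding zeta_def by (rule the_equality) (auto intro: is_zeta_unique)

definition nontrivial_zeros :: "complex set" where
  "nontrivial_zeros = {\<rho>. zeta \<rho> = 0 \<and> 0 < Re \<rho> \<and> Re \<rho> < 1}"

(* The underlying set of the multiset S; multiplicities are given by S_mult. *)
definition S_set :: "complex set" where
  "S_set = (\<lambda>\<rho>. - \<i> * (\<rho> - 1 / 2)) ` nontrivial_zeros"

(* 1 / 2 + i s is the zero rho with s = - i (rho - 1 / 2). *)
definition S_mult :: "complex \<Rightarrow> nat" where
  "S_mult s = nat (zorder zeta (1 / 2 + \<i> * s))"

definition eta :: "real \<Rightarrow> real \<Rightarrow> nat \<Rightarrow> complex" where
  "eta a h n =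
     of_real (1 / a * ln (real n / a)) +
     (\<Sum>t | t + of_real h \<in> S_set \<and> \<lfloor>a * Re t / (2 * pi)\<rfloor> = int n.
        of_nat (S_mult (t + of_real h)) * (exp (\<i> * of_real a * t) - 1))"

definition von_mangoldt :: "real \<Rightarrow> real" where
  "von_mangoldt x = (if x \<in> \<nat> then mangoldt (nat \<lfloor>x\<rfloor>) else 0)"

lemma von_mangoldt_prime_power:
  "prime p \<Longrightarrow> k \<ge> 1 \<Longrightarrow> von_mangoldt (real p ^ k) = ln (real p)"
  by (simp add: von_mangoldt_def flip: of_nat_power)

lemma von_mangoldt_eq_0:
  assumes "\<nexists>p k. prime p \<and> k \<ge> 1 \<and> x = real p ^ k"
  shows "von_mangoldt x = 0"
proof -
  have False if "x = real n" "primepow n" for n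
  proof -
    obtain p k where "prime p" "k > 0" "n = p ^ k"
      using \<open>primepow n\<close> by (auto simp: primepow_def)
    then have "prime p \<and> k \<ge> 1 \<and> x = real p ^ k" using that by simp
    with assms show False by blast
  qed
  then have "mangoldt (nat \<lfloor>x\<rfloor>) = (0 :: real)" if "x \<in> \<nat>"
    using that by (auto simp: mangoldt_def elim!: Nats_cases)
  then show ?thesis by (simp add: von_mangoldt_def)
qed

end

theory Submission
  imports Defs "HOL-Real_Asymp.Real_Asymp"
begin

text \<open>
  Put \<open>a = ln x\<close> and write a zero as \<open>\<rho> = 1/2 + i s\<close> with \<open>s = t + h\<close>. Then \<open>exp (i a t) = x\<close> to the power
  \<open>\<rho> - (1/2 + i h)\<close>, and the sum over \<open>n < M\<close> runs over all zeros with imaginary part between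
  \<open>h + 2 pi / a\<close> and \<open>h + 2 pi M / a\<close>. The argument principle turns it into the integral of
  \<open>exp (\<kappa> s) * zeta' s / zeta s\<close> (for \<open>\<kappa> = a\<close> and \<open>\<kappa> = 0\<close>) around a rectangle with vertical sides
  \<open>Re s = 5/4\<close> and \<open>Re s = -1/4\<close>. On the right side the Dirichlet series of \<open>zeta' / zeta\<close> is integrated
  termwise: only \<open>n = exp \<kappa>\<close> does not oscillate, and it produces the von Mangoldt term. On the left side
  the functional equation replaces \<open>zeta' / zeta\<close> by its value at \<open>1 - s\<close> and a logarithm; for \<open>\<kappa> = 0\<close>
  this gives the main term \<open>T/(2 pi) (ln (T/(2 pi)) - 1)\<close> of the zero count, which cancels against the sum of the
  \<open>(1/a) ln (n/a)\<close>. On the horizontal sides \<open>zeta' / zeta\<close> is a sum of \<open>1/(s - \<rho>)\<close> over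
  \<open>O(ln T)\<close> nearby zeros plus \<open>O(ln T)\<close>, and each of these terms contributes \<open>O(1)\<close> to the
  integral, however close the zero is.

  The functional equation comes from evaluating \<open>1/t - 1/(exp t - 1)\<close> as the integral over \<open>y > 0\<close> of
  \<open>k t y - k t \<lceil>y\<rceil>\<close> for both \<open>k t y = exp (- t y)\<close> and \<open>k t y = 2 t / (t^2 + 4 pi^2 y^2)\<close>, and
  comparing Mellin transforms in \<open>t\<close>.
\<close>

section \<open>Euler-Maclaurin continuation\<close>

text \<open>\<open>zeta\<close> is a definite description, so nothing is known about it until a
  function on the whole punctured plane has been exhibited. A single Euler-Maclaurin correction
  reaches only Re s > -1, and the functional equation supplies the rest. That half plane already
  contains the contour, including its left side. The argument principle sees every zero inside the
  rectangle, whereas \<open>nontrivial_zeros\<close> asks for 0 < Re \<rho> < 1. Hence the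
  non-vanishing on Re s = 1 and, by reflection, on Re s = 0 is needed to identify the two. The
  window ends h + 2 pi M / a may be ordinates of zeros. Each such height is raised by at most 1 to a
  zero-free height T'. This brings in O(ln T) further zeros of bounded weight and changes the main
  terms by O(ln T), the latter by the mean value theorem for u (ln u - 1), whose derivative is ln
  u.\<close>

text \<open>The trapezoidal rule for \<open>(s - 1) * y powr (-s)\<close> on the interval from \<open>Suc n\<close> to \<open>Suc (Suc n)\<close>, minus the integral.\<close>
definition em_term :: "complex \<Rightarrow> nat \<Rightarrow> complex" where
  "em_term s n = (s - 1) * (of_nat (Suc n) powr (-s) + of_nat (Suc (Suc n)) powr (-s)) / 2
     + of_nat (Suc (Suc n)) powr (1 - s) - of_nat (Suc n) powr (1 - s)"

text \<open>Two mean value estimates in a row. With the right end of the interval moved to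
  \<open>P + v\<close>, the error \<open>f v\<close> vanishes at v = 0 and has derivative (s - 1) /
  2 times \<open>q v\<close>. The function \<open>q\<close> also vanishes at 0, and its derivative
  carries the factor (P + v) powr (-s-2). Since Re s \<ge> -2, the modulus of this power is largest
  at the left end p.\<close>

lemma norm_trapezoid_powr_le:
  fixes s :: complex and p :: real
  assumes p: "p > 0" and s: "Re s \<ge> -2"
  shows "norm ((s - 1) * (of_real p powr (-s) + of_real (p + 1) powr (-s)) / 2
           + of_real (p + 1) powr (1 - s) - of_real p powr (1 - s))
         \<le> norm (s - 1) * norm s * norm (s + 1) * p powr (- Re s - 2)"
proof -
  let ?S = "closed_segment (0::complex) 1"
  define P where "P = complex_of_real p"
  define K where "K = norm s * norm (s + 1) * p powr (- Re s - 2)"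
  have seg: "\<exists>u. v = of_real u \<and> 0 \<le> u \<and> u \<le> 1" if "v \<in> ?S" for v
    using that by (auto simp: in_segment scaleR_conv_of_real)
  have Pv: "P + v \<notin> \<real>\<^sub>\<le>\<^sub>0" "P + v \<noteq> 0" if v: "v \<in> ?S" for v
  proof -
    obtain u where "v = of_real u" "0 \<le> u" using seg[OF v] by auto
    then have "Re (P + v) > 0" using p by (simp add: P_def)
    then show "P + v \<notin> \<real>\<^sub>\<le>\<^sub>0" "P + v \<noteq> 0"
      by (auto simp: complex_nonpos_Reals_iff simp del: plus_complex.sel)
  qed
  define q where "q v = P powr (-s) - (P + v) powr (-s) - s * v * (P + v) powr (-s-1)" for v
  have dq: "(q has_field_derivative s * (s + 1) * v * (P + v) powr (-s-2)) (at v within ?S)" if v: "v \<in> ?S" for v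
  proof -
    have e: "(P + v) powr (-s-1) = (P + v) powr (-s-2) * (P + v)"
      using Pv[OF v] powr_add[of "P+v" "-s-2" 1] by (simp add: minus_diff_commute)
    have e2: "-s-1-1 = -s-2" by simp
    show ?thesis unfolding q_def
      by (rule derivative_eq_intros refl Pv v | simp add: Pv[OF v])+ (simp add: algebra_simps e e2 minus_diff_commute)
  qed
  have bq: "norm (q v) \<le> K" if v: "v \<in> ?S" for v
  proof -
    have "norm (q v - q 0) \<le> K * norm (v - 0)"
    proof (rule field_differentiable_bound[of ?S, OF _ dq])
      fix z assume z: "z \<in> ?S"
      then obtain u where u: "z = of_real u" "0 \<le> u" "u \<le> 1" using seg by auto
      have "norm (s * (s+1) * z * (P + z) powr (-s-2)) = norm s * norm (s+1) * u * norm ((P + z) powr (-s-2))"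
        using u by (simp add: norm_mult)
      also have "norm ((P + z) powr (-s-2)) = (p + u) powr (- Re s - 2)"
        using u p by (simp add: P_def norm_powr_real_powr flip: of_real_add)
      also have "norm s * norm (s+1) * u * \<dots> \<le> norm s * norm (s+1) * 1 * p powr (- Re s - 2)"
        using u p s by (intro mult_mono powr_mono2') auto
      finally show "norm (s * (s+1) * z * (P + z) powr (-s-2)) \<le> K" by (simp add: K_def)
    qed (use v in auto)
    moreover have "norm v \<le> 1" using seg[OF v] by auto
    moreover have "K \<ge> 0" by (simp add: K_def)
    ultimately show ?thesis using mult_left_mono[of "norm v" 1 K] by (simp add: q_def)
  qed
  define f where "f v = (s - 1) * v * (P powr (-s) + (P + v) powr (-s)) / 2 + (P + v) powr (1 - s) - P powr (1 - s)" for v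
  have df: "(f has_field_derivative (s - 1) / 2 * q v) (at v within ?S)" if v: "v \<in> ?S" for v
  proof -
    have e2: "1-s-1 = -s" by simp
    show ?thesis unfolding f_def q_def
      by (rule derivative_eq_intros refl Pv v | simp add: Pv[OF v])+ (simp add: field_simps e2)
  qed
  have "norm (f 1 - f 0) \<le> (norm (s - 1) * K) * norm (1 - 0 :: complex)"
  proof (rule field_differentiable_bound[of ?S, OF _ df])
    fix z assume z: "z \<in> ?S"
    have "norm ((s - 1) / 2 * q z) = norm (s - 1) / 2 * norm (q z)" by (simp add: norm_mult norm_divide)
    also have "\<dots> \<le> norm (s - 1) * K" using bq[OF z] by (intro mult_mono) auto
    finally show "norm ((s - 1) / 2 * q z) \<le> norm (s - 1) * K" .
  qed auto
  then show ?thesis by (simp add: f_def P_def K_def mult.assoc)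
qed

lemma norm_em_term_le:
  assumes "Re s \<ge> -2"
  shows "norm (em_term s n) \<le> norm (s - 1) * norm s * norm (s + 1) * real (Suc n) powr (- Re s - 2)"
  using norm_trapezoid_powr_le[of "real (Suc n)" s] assms by (simp add: em_term_def add_ac)

lemma summable_Suc_powr: "a < -1 \<Longrightarrow> summable (\<lambda>n. real (Suc n) powr a)"
  by (subst summable_Suc_iff) (simp add: summable_real_powr_iff)

text \<open>This is \<open>(s - 1) * zeta s\<close>, regular at 1.\<close>
definition zeta_num :: "complex \<Rightarrow> complex" where
  "zeta_num s = 1 + (s - 1) / 2 + (\<Sum>n. em_term s n)"

lemma summable_norm_em_term: "Re s > -1 \<Longrightarrow> summable (\<lambda>n. norm (em_term s n))"
  by (rule summable_comparison_test'[OF summable_mult[OF summable_Suc_powr[of "- Re s - 2"]]])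
     (use norm_em_term_le[of s] in auto)

lemma summable_em_term: "Re s > -1 \<Longrightarrow> summable (em_term s)"
  using summable_norm_em_term summable_norm_cancel by blast

text \<open>Locally uniform convergence: on a ball whose radius d is half the distance to the line
  Re s = -1, the exponents - Re s - 2 stay below - 1 - d / 2, so one convergent majorant serves for
  the whole ball.\<close>

lemma zeta_num_holomorphic: "zeta_num holomorphic_on {s. Re s > -1}"
proof -
  have "(\<lambda>s. \<Sum>n. em_term s n) holomorphic_on {s. Re s > -1}"
  proof (rule holomorphic_uniform_sequence[where f = "\<lambda>N s. \<Sum>n<N. em_term s n"])
    show "open {s. Re s > -1}" by (simp add: open_halfspace_Re_gt)
    show "(\<lambda>s. \<Sum>n<N. em_term s n) holomorphic_on {s. Re s > -1}" for N
      unfolding em_term_def by (intro holomorphic_intros) (auto simp del: of_nat_Suc)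
    fix s0 assume s0: "s0 \<in> {s. Re s > -1}"
    define d where "d = (Re s0 + 1) / 2"
    have d: "d > 0" using s0 by (simp add: d_def)
    have re: "Re s > -1 + d / 2" if "s \<in> cball s0 d" for s
    proof -
      have "\<bar>Re (s0 - s)\<bar> \<le> d" using that abs_Re_le_cmod[of "s0 - s"] by (auto simp: dist_norm)
      then show ?thesis using s0 unfolding d_def by (simp add: abs_if field_simps split: if_splits)
    qed
    define B where "B = (norm s0 + d + 1) * (norm s0 + d + 1) * (norm s0 + d + 1)"
    have "uniform_limit (cball s0 d) (\<lambda>N s. \<Sum>n<N. em_term s n) (\<lambda>s. \<Sum>n. em_term s n) sequentially"
    proof (rule Weierstrass_m_test[where M = "\<lambda>n. B * real (Suc n) powr (- 1 - d / 2)"])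
      show "summable (\<lambda>n. B * real (Suc n) powr (- 1 - d / 2))"
        using d by (intro summable_mult summable_Suc_powr) auto
      fix n s assume s: "s \<in> cball s0 d"
      have n0: "norm s \<le> norm s0 + d"
        using s norm_triangle_ineq2[of s s0] by (auto simp: dist_norm norm_minus_commute)
      have "norm (em_term s n) \<le> norm (s - 1) * norm s * norm (s + 1) * real (Suc n) powr (- Re s - 2)"
        using re[OF s] d by (intro norm_em_term_le) auto
      also have "\<dots> \<le> B * real (Suc n) powr (- 1 - d / 2)"
        unfolding B_def
        using re[OF s] d n0 norm_triangle_ineq4[of s 1] norm_triangle_ineq[of s 1]
        by (intro mult_mono powr_mono) auto
      finally show "norm (em_term s n) \<le> B * real (Suc n) powr (- 1 - d / 2)" .
    qed
    moreover have "cball s0 d \<subseteq> {s. Re s > -1}" using re d by force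
    ultimately show "\<exists>d>0. cball s0 d \<subseteq> {s. Re s > -1} \<and>
        uniform_limit (cball s0 d) (\<lambda>N s. \<Sum>n<N. em_term s n) (\<lambda>s. \<Sum>n. em_term s n) sequentially"
      using d by blast
  qed
  then show ?thesis unfolding zeta_num_def by (intro holomorphic_intros) auto
qed

text \<open>Polynomial growth is what the later count of zeros by Jensen's inequality requires. For
  Re s \<ge> -1/2 the exponent - Re s - 2 is at most -3/2, so the same numerical series bounds the
  tail for every s.\<close>

lemma norm_zeta_num_le:
  assumes s: "Re s \<ge> -1/2"
  shows "norm (zeta_num s) \<le> 1 + norm (s - 1) * (1 + (\<Sum>n. real (Suc n) powr (-3/2)) * norm s * norm (s + 1))"
proof -
  let ?S = "\<Sum>n. real (Suc n) powr (-3/2)"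
  have sm: "summable (\<lambda>n. norm (s - 1) * norm s * norm (s + 1) * real (Suc n) powr (-3/2))"
    by (intro summable_mult summable_Suc_powr) auto
  have "norm (\<Sum>n. em_term s n) \<le> (\<Sum>n. norm (em_term s n))"
    using s by (intro summable_norm summable_norm_em_term) auto
  also have "\<dots> \<le> (\<Sum>n. norm (s - 1) * norm s * norm (s + 1) * real (Suc n) powr (-3/2))"
  proof (intro suminf_le sm)
    fix n
    have "norm (em_term s n) \<le> norm (s - 1) * norm s * norm (s + 1) * real (Suc n) powr (- Re s - 2)"
      using s by (intro norm_em_term_le) auto
    also have "\<dots> \<le> norm (s - 1) * norm s * norm (s + 1) * real (Suc n) powr (-3/2)"
    proof -
      have "- Re s - 2 \<le> -3/2" using s by (simp add: field_simps)
      then show ?thesis by (intro mult_left_mono powr_mono) auto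
    qed
    finally show "norm (em_term s n) \<le> norm (s - 1) * norm s * norm (s + 1) * real (Suc n) powr (-3/2)" .
    show "summable (\<lambda>n. norm (em_term s n))" using s by (intro summable_norm_em_term) auto
  qed
  also have "\<dots> = norm (s - 1) * norm s * norm (s + 1) * ?S"
    by (intro suminf_mult summable_Suc_powr) auto
  finally have *: "norm (\<Sum>n. em_term s n) \<le> norm (s - 1) * norm s * norm (s + 1) * ?S" .
  have "norm (zeta_num s) \<le> norm (1 :: complex) + norm ((s - 1) / 2) + norm (\<Sum>n. em_term s n)"
    unfolding zeta_num_def by (meson norm_triangle_ineq norm_triangle_mono order_refl)
  also have "\<dots> \<le> 1 + norm (s - 1) + norm (s - 1) * norm s * norm (s + 1) * ?S"
    using * norm_ge_zero[of "s - 1"] unfolding norm_divide norm_one norm_numeral by linarith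
  finally show ?thesis by (simp add: algebra_simps)
qed

text \<open>Each interior node belongs to two neighbouring trapezoids and so gets full weight; only
  the two end nodes keep weight 1/2. The antiderivative terms telescope.\<close>

lemma sum_em_term:
  "(\<Sum>n<N. em_term s n) = (s - 1) * ((\<Sum>n<N. of_nat (Suc n) powr (-s)) - 1 / 2 + of_nat (Suc N) powr (-s) / 2)
     + of_nat (Suc N) powr (1 - s) - 1"
proof (induction N)
  case (Suc N)
  show ?case unfolding sum.lessThan_Suc Suc.IH unfolding em_term_def by (simp add: field_simps del: of_nat_Suc)
qed simp

lemma tendsto_of_nat_powr_0:
  fixes s :: complex
  assumes "Re s < 0"
  shows "(\<lambda>N. of_nat (Suc N) powr s) \<longlonglongrightarrow> 0"
proof (rule tendsto_norm_zero_cancel)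
  have "(\<lambda>N. real (Suc N) powr Re s) \<longlonglongrightarrow> 0" using assms by real_asymp
  then show "(\<lambda>N. norm (of_nat (Suc N) powr s)) \<longlonglongrightarrow> 0"
    by (simp add: norm_powr_real_powr del: of_nat_Suc)
qed

text \<open>For Re s > 0 the half weight of the last node tends to 0 and drops out. If Re s > 1, the
  remaining power of \<open>Suc N\<close> vanishes in the limit too and the Dirichlet series
  appears. For real s between 0 and 1 the power stays and regularises the divergent sum; this is the
  form from which the functional equation starts.\<close>

lemma zeta_num_LIMSEQ:
  assumes "Re s > 0"
  shows "(\<lambda>N. (s - 1) * (\<Sum>n<N. of_nat (Suc n) powr (-s)) + of_nat (Suc N) powr (1 - s)) \<longlonglongrightarrow> zeta_num s"
proof -
  have "(\<lambda>N. \<Sum>n<N. em_term s n) \<longlonglongrightarrow> (\<Sum>n. em_term s n)"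
    using assms by (intro summable_LIMSEQ summable_em_term) auto
  then have "(\<lambda>N. (\<Sum>n<N. em_term s n) + (1 + (s - 1) / 2) - (s - 1) / 2 * of_nat (Suc N) powr (-s))
      \<longlonglongrightarrow> (\<Sum>n. em_term s n) + (1 + (s - 1) / 2) - (s - 1) / 2 * 0"
    using assms by (intro tendsto_intros tendsto_of_nat_powr_0) auto
  then show ?thesis
    unfolding sum_em_term zeta_num_def by (simp add: algebra_simps add_divide_distrib diff_divide_distrib del: of_nat_Suc)
qed

lemma zeta_num_1: "zeta_num 1 = 1"
  by (simp add: zeta_num_def em_term_def del: of_nat_Suc)

lemma zeta_num_sums:
  assumes "Re s > 1"
  shows "(\<lambda>n. 1 / of_nat (Suc n) powr s) sums (zeta_num s / (s - 1))"
proof -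
  have "(\<lambda>N. (s - 1) * (\<Sum>n<N. of_nat (Suc n) powr (-s)) + of_nat (Suc N) powr (1 - s)
           - of_nat (Suc N) powr (1 - s)) \<longlonglongrightarrow> zeta_num s - 0"
    using assms by (intro tendsto_diff zeta_num_LIMSEQ tendsto_of_nat_powr_0) auto
  then have "(\<lambda>N. (s - 1) * (\<Sum>n<N. of_nat (Suc n) powr (-s)) / (s - 1)) \<longlonglongrightarrow> zeta_num s / (s - 1)"
    using assms by (intro tendsto_intros) auto
  moreover have "s \<noteq> 1" using assms by auto
  ultimately show ?thesis by (simp add: sums_def powr_minus_divide del: of_nat_Suc)
qed

section \<open>The functional equation\<close>

text \<open>The ceiling is constant on each interval from n (excluded) to n + 1, so the integral is
  the sum of the nonnegative differences \<open>a n\<close> between the integral of \<phi> and its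
  right Riemann sum, and their partial sums converge to L. The result is stated in
  \<open>ennreal\<close> so that Tonelli's theorem can act on it later. The primitive only has to be
  continuous at 0, because \<phi> may blow up there like y powr (-s).\<close>

lemma nn_integral_diff_ceiling:
  fixes \<phi> \<Psi> :: "real \<Rightarrow> real"
  assumes anti: "\<And>x y. 0 < x \<Longrightarrow> x \<le> y \<Longrightarrow> \<phi> y \<le> \<phi> x"
    and der: "\<And>x. x > 0 \<Longrightarrow> (\<Psi> has_real_derivative \<phi> x) (at x)"
    and cont: "continuous_on {0..} \<Psi>" and "\<Psi> 0 = 0"
    and lim: "(\<lambda>N. \<Psi> (real N) - (\<Sum>n<N. \<phi> (real (Suc n)))) \<longlonglongrightarrow> L"
    and [measurable]: "\<phi> \<in> borel_measurable borel"
  shows "(\<integral>\<^sup>+y\<in>{0<..}. ennreal (\<phi> y - \<phi> (of_int \<lceil>y\<rceil>)) \<partial>lborel) = ennreal L"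
    and "L \<ge> 0"
proof -
  define a where "a n = \<Psi> (real (Suc n)) - \<Psi> (real n) - \<phi> (real (Suc n))" for n
  have ceil: "\<lceil>y\<rceil> = int (Suc n)" if "y \<in> {real n<..real (Suc n)}" for y n
    using that by (intro ceiling_unique) auto
  have hi: "((\<lambda>y. \<phi> y - \<phi> (of_int \<lceil>y\<rceil>)) has_integral a n) {real n<..real (Suc n)}" for n
  proof -
    have "(\<phi> has_integral (\<Psi> (real (Suc n)) - \<Psi> (real n))) {real n..real (Suc n)}"
    proof (rule fundamental_theorem_of_calculus_interior)
      show "continuous_on {real n..real (Suc n)} \<Psi>" by (rule continuous_on_subset[OF cont]) auto
      show "(\<Psi> has_vector_derivative \<phi> x) (at x)" if "x \<in> {real n<..<real (Suc n)}" for x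
        using der[of x] that by (simp add: has_real_derivative_iff_has_vector_derivative)
    qed simp
    then have "((\<lambda>y. \<phi> y - \<phi> (real (Suc n))) has_integral a n) {real n..real (Suc n)}"
      using has_integral_diff[OF _ has_integral_const_real[of "\<phi> (real (Suc n))" "real n" "real (Suc n)"]]
      by (simp add: a_def)
    then have "((\<lambda>y. \<phi> y - \<phi> (real (Suc n))) has_integral a n) {real n<..real (Suc n)}"
    proof (rule has_integral_spike_set_eq[THEN iffD1, rotated -1])
      show "negligible {x \<in> {real n..real (Suc n)} - {real n<..real (Suc n)}. \<phi> x - \<phi> (real (Suc n)) \<noteq> 0}"
        by (rule negligible_subset[of "{real n}"]) auto
      show "negligible {x \<in> {real n<..real (Suc n)} - {real n..real (Suc n)}. \<phi> x - \<phi> (real (Suc n)) \<noteq> 0}"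
        by (rule negligible_subset[of "{real n}"]) auto
    qed
    then show ?thesis
    proof (rule has_integral_eq[rotated])
      fix y assume "y \<in> {real n<..real (Suc n)}"
      from ceil[OF this] show "\<phi> y - \<phi> (real (Suc n)) = \<phi> y - \<phi> (of_int \<lceil>y\<rceil>)" by simp
    qed
  qed
  have nn: "\<phi> y - \<phi> (of_int \<lceil>y\<rceil>) \<ge> 0" if "y > 0" for y
    using anti[of y "of_int \<lceil>y\<rceil>"] that by auto
  have nn': "\<phi> y - \<phi> (of_int \<lceil>y\<rceil>) \<ge> 0" if "y \<in> {real n<..real (Suc n)}" for y n
    using that by (intro nn) auto
  have a0: "a n \<ge> 0" for n
    by (rule has_integral_nonneg[OF hi[of n] nn'])
  have "a sums L"
  proof -
    have "(\<Sum>n<N. a n) = \<Psi> (real N) - (\<Sum>n<N. \<phi> (real (Suc n)))" for N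
      by (induction N) (auto simp: a_def \<open>\<Psi> 0 = 0\<close>)
    then show ?thesis using lim by (simp add: sums_def)
  qed
  have un: "(\<Union>n. {real n<..real (Suc n)}) = {0<..}"
  proof (intro equalityI subsetI)
    fix y :: real assume "y \<in> {0<..}"
    then have "\<lceil>y\<rceil> \<ge> 1" by simp
    then obtain n where n: "\<lceil>y\<rceil> = int (Suc n)"
      using that[of "nat (\<lceil>y\<rceil> - 1)"] by simp
    then have "y \<in> {real n<..real (Suc n)}" by (simp add: ceiling_eq_iff)
    then show "y \<in> (\<Union>n. {real n<..real (Suc n)})" by blast
  qed auto
  have "(\<integral>\<^sup>+y\<in>{0<..}. ennreal (\<phi> y - \<phi> (of_int \<lceil>y\<rceil>)) \<partial>lborel)
      = (\<Sum>n. \<integral>\<^sup>+y\<in>{real n<..real (Suc n)}. ennreal (\<phi> y - \<phi> (of_int \<lceil>y\<rceil>)) \<partial>lborel)"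
    unfolding un[symmetric]
  proof (rule nn_integral_disjoint_family)
    show "disjoint_family (\<lambda>n. {real n<..real (Suc n)})"
      unfolding disjoint_family_on_def
    proof (intro ballI impI)
      fix m n :: nat assume "m \<noteq> n"
      have False if "y \<in> {real m<..real (Suc m)}" "y \<in> {real n<..real (Suc n)}" for y
        using ceil[OF that(1)] ceil[OF that(2)] \<open>m \<noteq> n\<close> by simp
      then show "{real m<..real (Suc m)} \<inter> {real n<..real (Suc n)} = {}" by blast
    qed
  qed auto
  also have "\<dots> = (\<Sum>n. ennreal (a n))"
    by (intro suminf_cong nn_integral_has_integral_lebesgue' hi nn')
  also have "\<dots> = ennreal L" by (intro suminf_ennreal_eq a0 \<open>a sums L\<close>)
  finally show "(\<integral>\<^sup>+y\<in>{0<..}. ennreal (\<phi> y - \<phi> (of_int \<lceil>y\<rceil>)) \<partial>lborel) = ennreal L" .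
  show "L \<ge> 0" using sums_le[OF a0 sums_zero \<open>a sums L\<close>] .
qed

text \<open>The logarithmic derivative of the product expansion of sinh (x / 2) / (x / 2), which is
  Euler's sine product at an imaginary argument. The hyperbolic cotangent that results is rewritten
  as 1 / (exp t - 1) + 1 / 2, which explains the extra 1 / 2.\<close>

lemma sums_partial_fraction_exp:
  fixes t :: real
  assumes t: "t > 0"
  shows "(\<lambda>n. 2 * t / (t\<^sup>2 + 4 * pi\<^sup>2 * (real (Suc n))\<^sup>2)) sums (1 / (exp t - 1) - 1 / t + 1 / 2)"
proof -
  define c where "c n = 4 * pi\<^sup>2 * (real (Suc n))\<^sup>2" for n
  have c: "c n > 0" for n by (simp add: c_def)
  have smc: "summable (\<lambda>n. inverse (c n))"
    unfolding c_def using inverse_squares_sums[THEN sums_summable, THEN summable_mult, of "inverse (4 * pi\<^sup>2)"]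
    by (simp add: field_simps)
  define F where "F x = ln (sinh (x / 2) / (x / 2))" for x :: real
  have Fs: "(\<lambda>n. ln (1 + x\<^sup>2 / c n)) sums F x" if x: "x > 0" for x
  proof -
    \<comment> \<open>At \<i> x / (2 pi) every factor of the sine product is real and greater than
      1, and the factor in front is purely imaginary. So the imaginary part contains all the
      information.\<close>
    have "(\<lambda>n. of_real pi * (\<i> * of_real (x / (2 * pi))) * (\<Prod>k=1..n. 1 - (\<i> * of_real (x / (2 * pi)))^2 / of_nat k^2))
       \<longlonglongrightarrow> sin (of_real pi * (\<i> * of_real (x / (2 * pi))))"
      by (rule sin_product_formula_complex)
    then have "(\<lambda>n. Im (of_real pi * (\<i> * of_real (x / (2 * pi))) * (\<Prod>k=1..n. 1 - (\<i> * of_real (x / (2 * pi)))^2 / of_nat k^2)))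
       \<longlonglongrightarrow> Im (sin (of_real pi * (\<i> * of_real (x / (2 * pi)))))"
      by (rule tendsto_Im)
    also have "(\<lambda>n. Im (of_real pi * (\<i> * of_real (x / (2 * pi))) * (\<Prod>k=1..n. 1 - (\<i> * of_real (x / (2 * pi)))^2 / of_nat k^2)))
       = (\<lambda>n. x / 2 * (\<Prod>k<n. 1 + x\<^sup>2 / c k))"
    proof
      fix n
      have "(\<Prod>k=1..n. 1 - (\<i> * of_real (x / (2 * pi)))^2 / of_nat k^2) = (\<Prod>k=1..n. of_real (1 + x\<^sup>2 / (4 * pi\<^sup>2 * (real k)\<^sup>2)) :: complex)"
        by (intro prod.cong refl) (simp add: power_mult_distrib field_simps)
      also have "\<dots> = of_real (\<Prod>k=1..n. 1 + x\<^sup>2 / (4 * pi\<^sup>2 * (real k)\<^sup>2))" by simp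
      also have "(\<Prod>k=1..n. 1 + x\<^sup>2 / (4 * pi\<^sup>2 * (real k)\<^sup>2)) = (\<Prod>k<n. 1 + x\<^sup>2 / c k)"
        unfolding c_def by (simp add: prod.atLeast1_atMost_eq del: of_nat_Suc)
      finally show "Im (of_real pi * (\<i> * of_real (x / (2 * pi))) * (\<Prod>k=1..n. 1 - (\<i> * of_real (x / (2 * pi)))^2 / of_nat k^2))
        = x / 2 * (\<Prod>k<n. 1 + x\<^sup>2 / c k)"
        by (simp add: field_simps del: of_real_prod)
    qed
    also have "Im (sin (of_real pi * (\<i> * of_real (x / (2 * pi))))) = sinh (x / 2)"
      by (simp add: Im_sin sinh_field_def)
    finally have "(\<lambda>n. x / 2 * (\<Prod>k<n. 1 + x\<^sup>2 / c k) / (x / 2)) \<longlonglongrightarrow> sinh (x / 2) / (x / 2)"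
      using x by (intro tendsto_divide tendsto_const) auto
    then have "(\<lambda>n. ln (\<Prod>k<n. 1 + x\<^sup>2 / c k)) \<longlonglongrightarrow> F x"
      unfolding F_def using x by (intro tendsto_ln) auto
    also have "(\<lambda>n. ln (\<Prod>k<n. 1 + x\<^sup>2 / c k)) = (\<lambda>n. \<Sum>k<n. ln (1 + x\<^sup>2 / c k))"
    proof (intro ext ln_prod)
      fix n i
      have "0 < 1 + x\<^sup>2 / c i" using c[of i] by (intro add_pos_nonneg) auto
      then show "1 + x\<^sup>2 / c i \<noteq> 0" by auto
    qed auto
    finally show ?thesis by (simp add: sums_def)
  qed
  \<comment> \<open>An open interval around t that is bounded, so that 2 x / (x^2 + c n) is
    dominated by the summable 2 (t + 1) / c n and the series may be differentiated term by
    term.\<close>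
  define S where "S = {0<..<t+1}"
  have d1: "((\<lambda>x. ln (1 + x\<^sup>2 / c n)) has_field_derivative 2 * x / (x\<^sup>2 + c n)) (at x within S)" if "x \<in> S" for x n
    using that c[of n] unfolding S_def
    by (auto intro!: derivative_eq_intros add_pos_nonneg simp: field_simps add_nonneg_eq_0_iff)
  have uc: "uniform_limit S (\<lambda>n x. \<Sum>i<n. 2 * x / (x\<^sup>2 + c i)) (\<lambda>x. \<Sum>i. 2 * x / (x\<^sup>2 + c i)) sequentially"
  proof (rule Weierstrass_m_test[where M = "\<lambda>n. 2 * (t + 1) * inverse (c n)"])
    fix n x assume x: "x \<in> S"
    have "norm (2 * x / (x\<^sup>2 + c n)) = 2 * x / (x\<^sup>2 + c n)" using x c[of n] by (auto simp: S_def)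
    also have "\<dots> \<le> 2 * (t + 1) / c n" using x c[of n] t by (intro frac_le) (auto simp: S_def)
    finally show "norm (2 * x / (x\<^sup>2 + c n)) \<le> 2 * (t + 1) * inverse (c n)" by (simp add: field_simps)
  qed (intro summable_mult smc)
  have tS: "t \<in> S" using t by (simp add: S_def)
  obtain g where g: "\<And>x. x \<in> S \<Longrightarrow> (\<lambda>n. ln (1 + x\<^sup>2 / c n)) sums g x \<and>
      (g has_field_derivative (\<Sum>n. 2 * x / (x\<^sup>2 + c n))) (at x within S)"
    using has_field_derivative_series[OF _ d1 uc tS sums_summable[OF Fs[OF t]]]
    unfolding S_def by (blast intro: convex_real_interval)
  have gF: "g x = F x" if "x \<in> S" for x
    using g[OF that] Fs[of x] that sums_unique2 by (auto simp: S_def)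
  have oS: "open S" by (simp add: S_def)
  have "(g has_field_derivative (\<Sum>n. 2 * t / (t\<^sup>2 + c n))) (at t)"
    using g[OF tS] at_within_open[OF tS oS] by auto
  then have "(F has_field_derivative (\<Sum>n. 2 * t / (t\<^sup>2 + c n))) (at t)"
    by (rule has_field_derivative_transform_within_open[OF _ oS tS]) (rule gF)
  moreover have "(F has_field_derivative (cosh (t/2) / sinh (t/2) / 2 - 1 / t)) (at t)"
    unfolding F_def using t sinh_real_pos_iff[of "t/2"]
    by (auto intro!: derivative_eq_intros simp: field_simps)
  ultimately have e: "(\<Sum>n. 2 * t / (t\<^sup>2 + c n)) = cosh (t/2) / sinh (t/2) / 2 - 1 / t"
    by (rule DERIV_unique)
  have "summable (\<lambda>n. 2 * t / (t\<^sup>2 + c n))"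
  proof (rule summable_comparison_test'[OF summable_mult[OF smc, of "2 * t"]])
    fix n
    have "norm (2 * t / (t\<^sup>2 + c n)) = 2 * t / (t\<^sup>2 + c n)" using t c[of n] by auto
    also have "\<dots> \<le> 2 * t / c n" using c[of n] t by (intro frac_le) auto
    finally show "norm (2 * t / (t\<^sup>2 + c n)) \<le> 2 * t * inverse (c n)" by (simp add: field_simps)
  qed
  then have "(\<lambda>n. 2 * t / (t\<^sup>2 + c n)) sums (cosh (t/2) / sinh (t/2) / 2 - 1 / t)"
    using e by (simp add: sums_iff)
  also have "cosh (t/2) / sinh (t/2) / 2 = 1 / (exp t - 1) + 1 / 2"
  proof -
    have e1: "exp t = exp (t/2) * exp (t/2)" by (simp flip: exp_add)
    have e2: "exp (t/2) > 1" using t by simp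
    have e3: "exp (t/2) * exp (t/2) > 1" using e2 by (metis e1 one_less_exp_iff t)
    show ?thesis using e2 e3 unfolding e1 cosh_field_def sinh_field_def exp_minus
      by (simp add: field_simps)
  qed
  finally show ?thesis by (simp add: c_def algebra_simps)
qed

lemma has_integral_scale_Ioi:
  fixes f :: "real \<Rightarrow> real"
  assumes y: "y > 0" and f: "(f has_integral I) {0<..}" and nn: "\<And>t. t > 0 \<Longrightarrow> f t \<ge> 0"
  shows "((\<lambda>t. f (y * t)) has_integral I / y) {0<..}"
proof -
  have im: "(*) y ` {0<..} = {0<..}"
    using y by (auto simp: image_iff intro!: bexI[of _ "_ / y"])
  have "f absolutely_integrable_on {0<..} \<and> integral {0<..} f = I"
    using f nn by (auto intro!: nonnegative_absolutely_integrable_1)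
  then have "(\<lambda>t. \<bar>y\<bar> * f (y * t)) absolutely_integrable_on {0<..} \<and> integral {0<..} (\<lambda>t. \<bar>y\<bar> * f (y * t)) = I"
  proof (subst has_absolute_integral_change_of_variables_1'[where g = "(*) y" and g' = "\<lambda>_. y" and f = f and S = "{0<..}"])
    show "inj_on ((*) y) {0<..}" using y by (auto intro: inj_onI)
  qed (auto simp: im intro!: derivative_eq_intros)
  then have "((\<lambda>t. y * f (y * t)) has_integral I) {0<..}"
    using y by (auto simp: absolutely_integrable_on_def has_integral_iff)
  from has_integral_mult_right[OF this, of "1 / y"] y show ?thesis by simp
qed

text \<open>The substitution 1 / (1 + u^2) turns the Beta integral with parameters (1 - s) / 2 and
  (1 + s) / 2 into this one. The parameters add up to 1, so the Beta value is a product of two Gamma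
  values that the reflection formula evaluates as pi / sin (pi b), and sin (pi b) = cos (pi s /
  2).\<close>

lemma has_integral_powr_over_1_plus_square:
  fixes s :: real
  assumes s: "-1 < s" "s < 1"
  shows "((\<lambda>u. 2 * u powr s / (1 + u\<^sup>2)) has_integral (pi / cos (pi * s / 2))) {0<..}"
proof -
  define a b where "a = (1 - s) / 2" and "b = (1 + s) / 2"
  have ab: "a > 0" "b > 0" "a + b = 1" using s by (auto simp: a_def b_def field_simps)
  define g where "g u = 1 / (1 + u\<^sup>2)" for u :: real
  define f where "f t = t powr (a - 1) * (1 - t) powr (b - 1)" for t :: real
  have pos: "1 + u\<^sup>2 > 0" for u :: real by (simp add: add_pos_nonneg)
  have inj: "inj_on g {0<..}"
  proof (rule inj_onI)
    fix u v :: real assume uv: "u \<in> {0<..}" "v \<in> {0<..}" "g u = g v"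
    then have "1 + u\<^sup>2 = 1 + v\<^sup>2" using pos[of u] pos[of v] unfolding g_def by (metis div_by_1 divide_divide_eq_right mult_1)
    then show "u = v" using uv by (simp add: power2_eq_iff_nonneg)
  qed
  have im: "g ` {0<..} = {0<..<1}"
  proof (intro equalityI subsetI)
    fix t :: real assume t: "t \<in> {0<..<1}"
    then have "t = g (sqrt ((1 - t) / t))" "sqrt ((1 - t) / t) > 0" by (auto simp: g_def field_simps)
    then show "t \<in> g ` {0<..}" by blast
  qed (use pos in \<open>auto simp: g_def divide_simps\<close>)
  have "(f has_integral Beta a b) {0..1}"
    unfolding f_def by (rule has_integral_Beta_real) (use ab in auto)
  then have "(f has_integral Beta a b) {0<..<1}"
    by (subst (asm) has_integral_Icc_iff_Ioo)
  then have "f absolutely_integrable_on g ` {0<..} \<and> integral (g ` {0<..}) f = Beta a b"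
    unfolding im by (auto intro!: nonnegative_absolutely_integrable_1 simp: f_def)
  then have "(\<lambda>u. \<bar>- 2 * u / (1 + u\<^sup>2)\<^sup>2\<bar> * f (g u)) absolutely_integrable_on {0<..} \<and>
       integral {0<..} (\<lambda>u. \<bar>- 2 * u / (1 + u\<^sup>2)\<^sup>2\<bar> * f (g u)) = Beta a b"
  proof (subst has_absolute_integral_change_of_variables_1'[where g = g and g' = "\<lambda>u. - 2 * u / (1 + u\<^sup>2)\<^sup>2" and f = f and S = "{0<..}"])
    fix u :: real
    show "(g has_real_derivative - 2 * u / (1 + u\<^sup>2)\<^sup>2) (at u within {0<..})"
      unfolding g_def using pos[of u]
      by (auto intro!: derivative_eq_intros simp: power2_eq_square)
  qed (use inj in auto)
  then have "((\<lambda>u. \<bar>- 2 * u / (1 + u\<^sup>2)\<^sup>2\<bar> * f (g u)) has_integral Beta a b) {0<..}"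
    by (auto simp: absolutely_integrable_on_def has_integral_iff)
  then have "((\<lambda>u. 2 * u powr s / (1 + u\<^sup>2)) has_integral Beta a b) {0<..}"
  proof (rule has_integral_eq[rotated])
    fix u :: real assume "u \<in> {0<..}"
    then have u: "u > 0" by simp
    have e1: "1 - g u = u\<^sup>2 / (1 + u\<^sup>2)" using pos[of u] by (simp add: g_def field_simps)
    have e2: "(u\<^sup>2) powr (b - 1) = u powr s / u"
    proof -
      have "(u\<^sup>2) powr (b - 1) = (u powr 2) powr (b - 1)" using u by simp
      also have "\<dots> = u powr (s - 1)"
      proof -
        have "2 * (b - 1) = s - 1" by (simp add: b_def field_simps)
        then show ?thesis unfolding powr_powr by simp
      qed
      finally show ?thesis using u by (simp add: powr_diff)
    qed
    have e3: "(1 + u\<^sup>2) powr (a - 1) * (1 + u\<^sup>2) powr (b - 1) = 1 / (1 + u\<^sup>2)"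
    proof -
      have "(1 + u\<^sup>2) powr (a - 1) * (1 + u\<^sup>2) powr (b - 1) = (1 + u\<^sup>2) powr (-1)"
      proof -
        have "a - 1 + (b - 1) = -1" using ab(3) by linarith
        then show ?thesis unfolding powr_add[symmetric] by simp
      qed
      then show ?thesis using pos[of u] by (simp add: powr_minus_divide)
    qed
    have "f (g u) = u powr s / u / ((1 + u\<^sup>2) powr (a - 1) * (1 + u\<^sup>2) powr (b - 1))"
      using pos[of u] u unfolding f_def e1 e2[symmetric] by (simp add: g_def powr_divide)
    also have "\<dots> = u powr s / u * (1 + u\<^sup>2)" unfolding e3 by simp
    finally have "f (g u) = u powr s / u * (1 + u\<^sup>2)" .
    then show "\<bar>- 2 * u / (1 + u\<^sup>2)\<^sup>2\<bar> * f (g u) = 2 * u powr s / (1 + u\<^sup>2)"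
      using u pos[of u] by (simp add: abs_mult power2_eq_square)
  qed
  also have "Beta a b = pi / cos (pi * s / 2)"
  proof -
    have "complex_of_real (Gamma b * Gamma (1 - b)) = of_real (pi / sin (pi * b))"
      using Gamma_reflection_complex[of "of_real b"]
      by (simp flip: Gamma_complex_of_real sin_of_real)
    then have "Gamma b * Gamma (1 - b) = pi / sin (pi * b)" by (simp only: of_real_eq_iff)
    moreover have "1 - b = a" using ab by simp
    moreover have "Beta a b = Gamma b * Gamma a" by (simp add: Beta_def ab(3))
    moreover have "sin (pi * b) = cos (pi * s / 2)"
    proof -
      have "pi * b = pi / 2 + pi * s / 2" by (simp add: b_def field_simps)
      then show ?thesis by (simp only: sin_add) simp
    qed
    ultimately show ?thesis by (simp only:)
  qed
  finally show ?thesis .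
qed

text \<open>For 0 < r < 1 this is - zeta r, written as an integral of a nonnegative function. Both
  kernels used for the functional equation reduce to it, one at the exponent s and the other at 1 -
  s.\<close>

definition ceil_defect :: "real \<Rightarrow> ennreal" where
  "ceil_defect r = (\<integral>\<^sup>+y\<in>{0<..}. ennreal (y powr (-r) - of_int \<lceil>y\<rceil> powr (-r)) \<partial>lborel)"

text \<open>\<open>nn_integral_diff_ceiling\<close> for y powr (-s), with the limit supplied by the
  regularised partial sums. That \<open>zeta_num\<close> is real on this interval is recorded
  because the passage to the complex equation compares real parts only.\<close>

lemma ceil_defect_zeta_num:
  assumes s: "0 < s" "s < 1"
  shows "ceil_defect s = ennreal (Re (zeta_num (of_real s)) / (1 - s))"
    and "Re (zeta_num (of_real s)) / (1 - s) \<ge> 0"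
    and "zeta_num (of_real s) = of_real (Re (zeta_num (of_real s)))"
proof -
  define r where "r N = (s - 1) * (\<Sum>n<N. real (Suc n) powr (-s)) + real (Suc N) powr (1 - s)" for N
  have "(\<lambda>N. (of_real s - 1) * (\<Sum>n<N. of_nat (Suc n) powr (- of_real s)) + of_nat (Suc N) powr (1 - of_real s))
     \<longlonglongrightarrow> zeta_num (of_real s)"
    using s by (intro zeta_num_LIMSEQ) auto
  also have "(\<lambda>N. (of_real s - 1) * (\<Sum>n<N. of_nat (Suc n) powr (- of_real s)) + of_nat (Suc N) powr (1 - of_real s))
     = (\<lambda>N. complex_of_real (r N))"
  proof
    fix N
    have "(of_nat (Suc n) powr (- of_real s) :: complex) = of_real (real (Suc n) powr (-s))" for n
      using powr_of_real[of "real (Suc n)" "-s"] by simp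
    moreover have "(of_nat (Suc N) powr (1 - of_real s) :: complex) = of_real (real (Suc N) powr (1-s))"
      using powr_of_real[of "real (Suc N)" "1-s"] by simp
    ultimately show "(of_real s - 1) * (\<Sum>n<N. of_nat (Suc n) powr (- of_real s)) + of_nat (Suc N) powr (1 - of_real s)
       = complex_of_real (r N)" unfolding r_def by (simp del: of_nat_Suc)
  qed
  finally have lim: "(\<lambda>N. complex_of_real (r N)) \<longlonglongrightarrow> zeta_num (of_real s)" .
  have "Im (zeta_num (of_real s)) = 0"
    using tendsto_Im[OF lim] by (simp add: LIMSEQ_const_iff)
  then show "zeta_num (of_real s) = of_real (Re (zeta_num (of_real s)))" by (simp add: complex_eq_iff)
  have "r \<longlonglongrightarrow> Re (zeta_num (of_real s))" using tendsto_Re[OF lim] by simp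
  then have "(\<lambda>N. r N / (1 - s)) \<longlonglongrightarrow> Re (zeta_num (of_real s)) / (1 - s)"
    using s by (intro tendsto_intros) auto
  \<comment> \<open>The integral up to N involves N powr (1 - s), the regularised sum involves
    \<open>Suc N\<close> instead. For s > 0 the two powers differ by a null sequence.\<close>
  moreover have "(\<lambda>N. (real N powr (1 - s) - real (Suc N) powr (1 - s)) / (1 - s)) \<longlonglongrightarrow> 0"
    using s by real_asymp
  ultimately have "(\<lambda>N. r N / (1 - s) + (real N powr (1 - s) - real (Suc N) powr (1 - s)) / (1 - s))
      \<longlonglongrightarrow> Re (zeta_num (of_real s)) / (1 - s) + 0" by (rule tendsto_add)
  also have "(\<lambda>N. r N / (1 - s) + (real N powr (1 - s) - real (Suc N) powr (1 - s)) / (1 - s))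
     = (\<lambda>N. real N powr (1 - s) / (1 - s) - (\<Sum>n<N. real (Suc n) powr (-s)))"
  proof -
    have "((s - 1) * X + Y) / (1 - s) + (Z - Y) / (1 - s) = Z / (1 - s) - X" for X Y Z :: real
    proof -
      have "((s - 1) * X + Y) / (1 - s) + (Z - Y) / (1 - s) = ((s - 1) * X + Z) / (1 - s)"
        by (simp flip: add_divide_distrib)
      also have "\<dots> = Z / (1 - s) - X" using s by (simp add: field_simps)
      finally show ?thesis .
    qed
    then show ?thesis unfolding r_def by simp
  qed
  finally have lim2: "(\<lambda>N. real N powr (1 - s) / (1 - s) - (\<Sum>n<N. real (Suc n) powr (-s)))
      \<longlonglongrightarrow> Re (zeta_num (of_real s)) / (1 - s)" by simp
  have der: "((\<lambda>x. x powr (1 - s) / (1 - s)) has_real_derivative x powr (-s)) (at x)" if "x > 0" for x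
    using that s by (auto intro!: derivative_eq_intros)
  have cont: "continuous_on {0..} (\<lambda>x. x powr (1 - s) / (1 - s))"
    using s by (intro continuous_intros continuous_on_powr') auto
  have anti: "0 < x \<Longrightarrow> x \<le> y \<Longrightarrow> y powr (-s) \<le> x powr (-s)" for x y :: real
    using s by (intro powr_mono2') auto
  note * = nn_integral_diff_ceiling[OF anti der cont _ lim2]
  show "ceil_defect s = ennreal (Re (zeta_num (of_real s)) / (1 - s))"
    unfolding ceil_defect_def by (rule *) auto
  show "Re (zeta_num (of_real s)) / (1 - s) \<ge> 0" by (rule *) auto
qed

text \<open>Tonelli's theorem for t powr (s - 1) times the ceiling defect of the kernel. Integrating
  over y first produces H; integrating over t first produces the defect of y powr (-r). All
  integrands are nonnegative, so only measurability has to be checked.\<close>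

lemma nn_integral_mellin_defect:
  fixes k :: "real \<Rightarrow> real \<Rightarrow> real"
  assumes meas: "case_prod k \<in> borel_measurable (borel \<Otimes>\<^sub>M borel)"
    and anti: "\<And>t x y. 0 < t \<Longrightarrow> 0 < x \<Longrightarrow> x \<le> y \<Longrightarrow> k t y \<le> k t x"
    and H: "\<And>t. t > 0 \<Longrightarrow> (\<integral>\<^sup>+y\<in>{0<..}. ennreal (k t y - k t (of_int \<lceil>y\<rceil>)) \<partial>lborel) = ennreal (H t)"
    and M: "\<And>y. y > 0 \<Longrightarrow> ((\<lambda>t. t powr (s - 1) * k t y) has_integral c * y powr (-r)) {0<..}"
    and c: "c \<ge> 0"
  shows "(\<integral>\<^sup>+t\<in>{0<..}. ennreal (t powr (s - 1) * H t) \<partial>lborel) = ennreal c * ceil_defect r"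
proof -
  define f where "f t y = ennreal (t powr (s - 1) * (k t y - k t (of_int \<lceil>y\<rceil>))) * indicator {0<..} y * indicator {0<..} t" for t y
  have m1: "(\<lambda>p. k (fst p) (snd p)) \<in> borel_measurable (borel \<Otimes>\<^sub>M borel)"
    using meas by (simp add: case_prod_unfold)
  have m2: "(\<lambda>p. k (fst p) (snd p)) \<in> borel_measurable (lborel \<Otimes>\<^sub>M lborel)"
    using m1 by (simp add: measurable_cong_sets[OF sets_pair_measure_cong[OF sets_lborel sets_lborel] refl])
  have ceil: "(\<lambda>y::real. real_of_int \<lceil>y\<rceil>) \<in> borel_measurable borel" by measurable
  have mc: "(\<lambda>p::real \<times> real. (fst p, real_of_int \<lceil>snd p\<rceil>)) \<in> (borel \<Otimes>\<^sub>M borel) \<rightarrow>\<^sub>M (borel \<Otimes>\<^sub>M borel)"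
    by (rule measurable_Pair[OF measurable_fst measurable_compose[OF measurable_snd ceil]])
  have m3: "(\<lambda>p::real \<times> real. k (fst p) (real_of_int \<lceil>snd p\<rceil>)) \<in> borel_measurable (lborel \<Otimes>\<^sub>M lborel)"
    using measurable_compose[OF mc m1]
    by (simp add: measurable_cong_sets[OF sets_pair_measure_cong[OF sets_lborel sets_lborel] refl])
  have mf: "case_prod f \<in> borel_measurable (lborel \<Otimes>\<^sub>M lborel)"
    unfolding f_def case_prod_unfold using m2 m3 by measurable
  have k1: "(\<lambda>y. k t y) \<in> borel_measurable borel" for t
    using measurable_compose[OF _ m1, of "\<lambda>y. (t, y)" borel] by simp
  have k2: "(\<lambda>y::real. k t (of_int \<lceil>y\<rceil>)) \<in> borel_measurable borel" for t
    by (rule measurable_compose[OF _ k1]) measurable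
  have "(\<integral>\<^sup>+t\<in>{0<..}. ennreal (t powr (s - 1) * H t) \<partial>lborel) = (\<integral>\<^sup>+t. \<integral>\<^sup>+y. f t y \<partial>lborel \<partial>lborel)"
  proof (rule nn_integral_cong)
    fix t :: real
    show "ennreal (t powr (s - 1) * H t) * indicator {0<..} t = (\<integral>\<^sup>+y. f t y \<partial>lborel)"
    proof (cases "t > 0")
      case True
      have "(\<integral>\<^sup>+y. f t y \<partial>lborel) = (\<integral>\<^sup>+y. ennreal (t powr (s - 1)) * (ennreal (k t y - k t (of_int \<lceil>y\<rceil>)) * indicator {0<..} y) \<partial>lborel)"
        using True by (intro nn_integral_cong) (simp add: f_def ennreal_mult' mult.assoc)
      also have "\<dots> = ennreal (t powr (s - 1)) * ennreal (H t)"
        using k1[of t] k2[of t] by (subst nn_integral_cmult) (auto simp: H[OF True])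
      finally show ?thesis using True by (simp add: ennreal_mult')
    qed (simp add: f_def)
  qed
  also have "\<dots> = (\<integral>\<^sup>+y. \<integral>\<^sup>+t. f t y \<partial>lborel \<partial>lborel)"
    by (rule lborel_pair.Fubini'[OF mf, symmetric])
  also have "\<dots> = (\<integral>\<^sup>+y. ennreal c * (ennreal (y powr (-r) - of_int \<lceil>y\<rceil> powr (-r)) * indicator {0<..} y) \<partial>lborel)"
  proof (rule nn_integral_cong)
    fix y :: real
    show "(\<integral>\<^sup>+t. f t y \<partial>lborel) = ennreal c * (ennreal (y powr (-r) - of_int \<lceil>y\<rceil> powr (-r)) * indicator {0<..} y)"
    proof (cases "y > 0")
      case True
      have "((\<lambda>t. t powr (s - 1) * k t y - t powr (s - 1) * k t (of_int \<lceil>y\<rceil>)) has_integral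
          (c * y powr (-r) - c * of_int \<lceil>y\<rceil> powr (-r))) {0<..}"
        using True by (intro has_integral_diff M) auto
      then have i: "((\<lambda>t. t powr (s - 1) * (k t y - k t (of_int \<lceil>y\<rceil>))) has_integral
          (c * (y powr (-r) - of_int \<lceil>y\<rceil> powr (-r)))) {0<..}"
        by (simp add: algebra_simps)
      have "(\<integral>\<^sup>+t. f t y \<partial>lborel) = (\<integral>\<^sup>+t. ennreal (t powr (s - 1) * (k t y - k t (of_int \<lceil>y\<rceil>))) * indicator {0<..} t \<partial>lborel)"
        using True by (intro nn_integral_cong) (simp add: f_def)
      also have "\<dots> = ennreal (c * (y powr (-r) - of_int \<lceil>y\<rceil> powr (-r)))"
      proof (rule nn_integral_has_integral_lebesgue'[OF _ i])
        fix t :: real assume "t \<in> {0<..}"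
        then have "k t (of_int \<lceil>y\<rceil>) \<le> k t y" using True by (intro anti) auto
        then show "0 \<le> t powr (s - 1) * (k t y - k t (of_int \<lceil>y\<rceil>))" by simp
      qed
      finally show ?thesis using True c by (simp add: ennreal_mult')
    qed (simp add: f_def)
  qed
  also have "\<dots> = ennreal c * ceil_defect r"
    unfolding ceil_defect_def by (subst nn_integral_cmult) auto
  finally show ?thesis .
qed

text \<open>The exponential kernel has a Mellin transform proportional to y powr (-s), the rational
  kernel one proportional to y powr (-(1 - s)). That both produce the same H is the reason for the
  reflection. Both sides are finite and nonnegative, so the equality in \<open>ennreal\<close>
  descends to the reals.\<close>

lemma zeta_num_reflection_real:
  assumes s: "0 < s" "s < 1"
  shows "Gamma s * (Re (zeta_num (of_real s)) / (1 - s))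
       = pi / cos (pi * s / 2) * (2 * pi) powr (s - 1) * (Re (zeta_num (of_real (1 - s))) / s)"
proof -
  define H where "H t = 1 / t - 1 / (exp t - 1)" for t :: real
  define K where "K = pi / cos (pi * s / 2)"
  have "0 < pi * s" "pi * s < pi * 1" using s by (auto intro!: mult_strict_left_mono)
  then have "cos (pi * s / 2) > 0" using pi_gt_zero by (intro cos_gt_zero_pi) linarith+
  then have K: "K > 0" by (simp add: K_def)
  have G: "Gamma s > 0" using s by (intro Gamma_real_pos) auto
  have H1: "(\<integral>\<^sup>+y\<in>{0<..}. ennreal (exp (-(y * t)) - exp (-(of_int \<lceil>y\<rceil> * t))) \<partial>lborel) = ennreal (H t)" if t: "t > 0" for t
  proof (rule nn_integral_diff_ceiling(1)[where \<Psi> = "\<lambda>y. (1 - exp (-(y * t))) / t"])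
    have "(\<lambda>n. exp (-t) * exp (-t) ^ n) sums (exp (-t) * (1 / (1 - exp (-t))))"
      using t by (intro sums_mult geometric_sums) auto
    also have "(\<lambda>n. exp (-t) * exp (-t) ^ n) = (\<lambda>n. exp (- (real (Suc n) * t)))"
    proof
      fix n
      have "exp (- (real (Suc n) * t)) = exp (real (Suc n) * (-t))" by simp
      also have "\<dots> = exp (-t) ^ Suc n" by (rule exp_of_nat_mult)
      finally show "exp (-t) * exp (-t) ^ n = exp (- (real (Suc n) * t))" by simp
    qed
    also have "exp (-t) * (1 / (1 - exp (-t))) = 1 / (exp t - 1)"
      using t by (simp add: exp_minus field_simps)
    finally have "(\<lambda>N. \<Sum>n<N. exp (- (real (Suc n) * t))) \<longlonglongrightarrow> 1 / (exp t - 1)" by (simp add: sums_def)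
    moreover have "(\<lambda>N. (1 - exp (- (real N * t))) / t) \<longlonglongrightarrow> 1 / t" using t by (real_asymp, simp add: divide_inverse)
    ultimately show "(\<lambda>N. (1 - exp (- (real N * t))) / t - (\<Sum>n<N. exp (- (real (Suc n) * t)))) \<longlonglongrightarrow> H t"
      unfolding H_def by (intro tendsto_diff)
  qed (use t in \<open>auto intro!: derivative_eq_intros continuous_intros\<close>)
  have H2: "(\<integral>\<^sup>+y\<in>{0<..}. ennreal (2 * t / (t\<^sup>2 + 4 * pi\<^sup>2 * y\<^sup>2) - 2 * t / (t\<^sup>2 + 4 * pi\<^sup>2 * (of_int \<lceil>y\<rceil>)\<^sup>2)) \<partial>lborel) = ennreal (H t)"
    if t: "t > 0" for t
  proof (rule nn_integral_diff_ceiling(1)[where \<Psi> = "\<lambda>y. arctan (2 * pi * y / t) / pi"])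
    have "(\<lambda>N. \<Sum>n<N. 2 * t / (t\<^sup>2 + 4 * pi\<^sup>2 * (real (Suc n))\<^sup>2)) \<longlonglongrightarrow> 1 / (exp t - 1) - 1 / t + 1 / 2"
      using sums_partial_fraction_exp[OF t] by (simp add: sums_def)
    \<comment> \<open>The integral of the rational kernel over all y > 0. It cancels the 1 / 2 in
      the partial fraction series.\<close>
    moreover have "(\<lambda>N. arctan (2 * pi * real N / t) / pi) \<longlonglongrightarrow> 1 / 2" 
    proof -
      have "(\<lambda>N. arctan (2 * pi * real N / t) / pi) \<longlonglongrightarrow> (pi / 2) / pi"
        using t by (intro tendsto_divide tendsto_const filterlim_compose[OF tendsto_arctan_at_top]) (auto, real_asymp)
      then show ?thesis by simp
    qed
    ultimately have "(\<lambda>N. arctan (2 * pi * real N / t) / pi - (\<Sum>n<N. 2 * t / (t\<^sup>2 + 4 * pi\<^sup>2 * (real (Suc n))\<^sup>2)))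
       \<longlonglongrightarrow> 1 / 2 - (1 / (exp t - 1) - 1 / t + 1 / 2)" by (rule tendsto_diff[rotated])
    then show "(\<lambda>N. arctan (2 * pi * real N / t) / pi - (\<Sum>n<N. 2 * t / (t\<^sup>2 + 4 * pi\<^sup>2 * (real (Suc n))\<^sup>2))) \<longlonglongrightarrow> H t"
      by (simp add: H_def)
    show "2 * t / (t\<^sup>2 + 4 * pi\<^sup>2 * y\<^sup>2) \<le> 2 * t / (t\<^sup>2 + 4 * pi\<^sup>2 * x\<^sup>2)" if "0 < x" "x \<le> y" for x y
      using that t by (intro divide_left_mono add_left_mono mult_left_mono power_mono mult_pos_pos add_pos_pos) auto
    show "((\<lambda>y. arctan (2 * pi * y / t) / pi) has_real_derivative 2 * t / (t\<^sup>2 + 4 * pi\<^sup>2 * x\<^sup>2)) (at x)" if "x > 0" for x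
    proof -
      have "t\<^sup>2 + 4 * pi\<^sup>2 * x\<^sup>2 > 0" using t by (intro add_pos_nonneg) auto
      moreover have "1 + (2 * pi * x / t)\<^sup>2 = (t\<^sup>2 + 4 * pi\<^sup>2 * x\<^sup>2) / t\<^sup>2"
        using t by (simp add: field_simps power2_eq_square)
      ultimately have e: "inverse (1 + (2 * pi * x / t)\<^sup>2) * (2 * pi / t) / pi = 2 * t / (t\<^sup>2 + 4 * pi\<^sup>2 * x\<^sup>2)"
        using t by (simp add: power2_eq_square)
      have "((\<lambda>y. arctan (2 * pi * y / t) / pi) has_real_derivative inverse (1 + (2 * pi * x / t)\<^sup>2) * (2 * pi / t) / pi) (at x)"
        using t by (auto intro!: derivative_eq_intros)
      then show ?thesis unfolding e .
    qed
    show "continuous_on {0..} (\<lambda>y. arctan (2 * pi * y / t) / pi)" using t by (intro continuous_intros) auto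
  qed auto
  have "((\<lambda>t. t powr (s - 1) / exp t) has_integral Gamma s) {0..}" using s by (intro Gamma_integral_real) auto
  then have gi: "((\<lambda>t. t powr (s - 1) * exp (-t)) has_integral Gamma s) {0<..}"
    by (subst has_integral_spike_set_eq[of _ "{0..}", rotated])
       (auto simp: exp_minus field_simps intro: negligible_subset[of "{0::real}"])
  have M1: "((\<lambda>t. t powr (s - 1) * exp (-(y * t))) has_integral Gamma s * y powr (-s)) {0<..}" if y: "y > 0" for y
  proof -
    have "((\<lambda>t. y powr (1 - s) * ((y * t) powr (s - 1) * exp (-(y * t)))) has_integral y powr (1 - s) * (Gamma s / y)) {0<..}"
      by (intro has_integral_mult_right has_integral_scale_Ioi[OF y gi]) auto
    then have int: "((\<lambda>t. t powr (s - 1) * exp (-(y * t))) has_integral y powr (1 - s) * (Gamma s / y)) {0<..}"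
    proof (rule has_integral_eq[rotated])
      fix t :: real assume "t \<in> {0<..}"
      have "y powr (1 - s) * y powr (s - 1) = 1" using y by (simp flip: powr_add)
      then show "y powr (1 - s) * ((y * t) powr (s - 1) * exp (-(y * t))) = t powr (s - 1) * exp (-(y * t))"
        using y \<open>t \<in> {0<..}\<close> by (simp add: powr_mult)
    qed
    have e: "y powr (1 - s) * (Gamma s / y) = Gamma s * y powr (-s)"
      using y by (simp add: powr_diff powr_minus field_simps)
    show ?thesis using int unfolding e .
  qed
  have M2: "((\<lambda>t. t powr (s - 1) * (2 * t / (t\<^sup>2 + 4 * pi\<^sup>2 * y\<^sup>2))) has_integral (K * (2 * pi) powr (s - 1)) * y powr (-(1-s))) {0<..}"
    if y: "y > 0" for y
  proof -
    \<comment> \<open>The scale at which the denominator becomes (1 + (Y t)^2) / Y^2, so that the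
      substitution u = Y t leads to the integral evaluated by the Beta function.\<close>
    define Y where "Y = 1 / (2 * pi * y)"
    have Y: "Y > 0" "4 * pi\<^sup>2 * y\<^sup>2 = 1 / Y\<^sup>2" using y by (auto simp: Y_def power2_eq_square)
    have "((\<lambda>t. Y powr (2 - s) * (2 * (Y * t) powr s / (1 + (Y * t)\<^sup>2))) has_integral Y powr (2 - s) * (K / Y)) {0<..}"
      unfolding K_def using s
      by (intro has_integral_mult_right has_integral_scale_Ioi[OF Y(1)] has_integral_powr_over_1_plus_square) auto
    then have int: "((\<lambda>t. t powr (s - 1) * (2 * t / (t\<^sup>2 + 4 * pi\<^sup>2 * y\<^sup>2))) has_integral Y powr (2 - s) * (K / Y)) {0<..}"
    proof (rule has_integral_eq[rotated])
      fix t :: real assume "t \<in> {0<..}"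
      then have t: "t > 0" by simp
      have "Y powr (2 - s) * Y powr s = Y\<^sup>2" using Y by (simp flip: powr_add)
      then have "Y powr (2 - s) * (2 * (Y * t) powr s / (1 + (Y * t)\<^sup>2)) = 2 * Y\<^sup>2 * t powr s / (1 + (Y * t)\<^sup>2)"
        using Y t by (simp add: powr_mult)
      also have "\<dots> = t powr (s - 1) * (2 * t / (t\<^sup>2 + 4 * pi\<^sup>2 * y\<^sup>2))"
      proof -
        have e: "1 + (Y * t)\<^sup>2 = Y\<^sup>2 * (t\<^sup>2 + 1 / Y\<^sup>2)" using Y(1) by (simp add: field_simps power_mult_distrib)
        show ?thesis unfolding Y(2) e using Y(1) t by (simp add: powr_diff)
      qed
      finally show "Y powr (2 - s) * (2 * (Y * t) powr s / (1 + (Y * t)\<^sup>2)) = t powr (s - 1) * (2 * t / (t\<^sup>2 + 4 * pi\<^sup>2 * y\<^sup>2))" .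
    qed
    have e1: "Y powr (2 - s) * (K / Y) = K * Y powr (1 - s)"
    proof -
      have "Y powr ((1 - s) + 1) = Y powr (1 - s) * Y" using Y(1) unfolding powr_add by simp
      then show ?thesis using Y(1) by simp
    qed
    have e2: "Y powr (1 - s) = (2 * pi) powr (s - 1) * y powr (-(1-s))"
    proof -
      have "Y powr (1 - s) = 1 / (2 * pi * y) powr (1 - s)" unfolding Y_def using y by (simp add: powr_divide)
      also have "\<dots> = (2 * pi * y) powr (-(1 - s))" by (rule powr_minus_divide[symmetric])
      also have "\<dots> = (2 * pi) powr (-(1 - s)) * y powr (-(1 - s))" by (rule powr_mult)
      finally show ?thesis by (simp only: minus_diff_eq)
    qed
    show ?thesis using int unfolding e1 e2 by (simp only: mult.assoc)
  qed
  have "(\<integral>\<^sup>+t\<in>{0<..}. ennreal (t powr (s - 1) * H t) \<partial>lborel) = ennreal (Gamma s) * ceil_defect s"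
  proof (rule nn_integral_mellin_defect[where k = "\<lambda>t y. exp (-(y * t))", OF _ _ H1 M1])
    show "(\<lambda>(t::real, y::real). exp (- (y * t))) \<in> borel_measurable (borel \<Otimes>\<^sub>M borel)" by measurable
  qed (use G in auto)
  moreover have "(\<integral>\<^sup>+t\<in>{0<..}. ennreal (t powr (s - 1) * H t) \<partial>lborel) = ennreal (K * (2 * pi) powr (s - 1)) * ceil_defect (1 - s)"
  proof (rule nn_integral_mellin_defect[where k = "\<lambda>t y. 2 * t / (t\<^sup>2 + 4 * pi\<^sup>2 * y\<^sup>2)", OF _ _ H2 M2])
    show "(\<lambda>(t::real, y::real). 2 * t / (t\<^sup>2 + 4 * pi\<^sup>2 * y\<^sup>2)) \<in> borel_measurable (borel \<Otimes>\<^sub>M borel)" by measurable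
    show "2 * t / (t\<^sup>2 + 4 * pi\<^sup>2 * y\<^sup>2) \<le> 2 * t / (t\<^sup>2 + 4 * pi\<^sup>2 * x\<^sup>2)" if "0 < t" "0 < x" "x \<le> y" for t x y
      using that by (intro divide_left_mono add_left_mono mult_left_mono power_mono mult_pos_pos add_pos_pos) auto
  qed (use K in auto)
  ultimately have "ennreal (Gamma s) * ceil_defect s = ennreal (K * (2 * pi) powr (s - 1)) * ceil_defect (1 - s)" by simp
  then have "ennreal (Gamma s * (Re (zeta_num (of_real s)) / (1 - s)))
     = ennreal (K * (2 * pi) powr (s - 1) * (Re (zeta_num (of_real (1 - s))) / (1 - (1 - s))))"
    using ceil_defect_zeta_num(1)[of s] ceil_defect_zeta_num(1)[of "1 - s"] s G K
    by (simp only: ennreal_mult' less_imp_le mult_nonneg_nonneg powr_ge_zero)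
  then have "Gamma s * (Re (zeta_num (of_real s)) / (1 - s))
     = K * (2 * pi) powr (s - 1) * (Re (zeta_num (of_real (1 - s))) / (1 - (1 - s)))"
  proof (subst (asm) ennreal_inj)
    show "0 \<le> Gamma s * (Re (zeta_num (of_real s)) / (1 - s))"
      using ceil_defect_zeta_num(2)[of s] s G by (intro mult_nonneg_nonneg) auto
    show "0 \<le> K * (2 * pi) powr (s - 1) * (Re (zeta_num (of_real (1 - s))) / (1 - (1 - s)))"
      using ceil_defect_zeta_num(2)[of "1 - s"] s K by (intro mult_nonneg_nonneg) auto
  qed
  then show ?thesis by (simp add: K_def)
qed

section \<open>The complex functional equation and the existence of \<open>zeta\<close>\<close>

lemma Re_pos_imp_not_nonpos_Int: "Re s > 0 \<Longrightarrow> s \<notin> \<int>\<^sub>\<le>\<^sub>0"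
  by (auto elim!: nonpos_Ints_cases)

lemma zeta_num_reflected_holomorphic:
  assumes "A \<subseteq> {s. Re s < 2}"
  shows "(\<lambda>s. zeta_num (1 - s)) holomorphic_on A"
proof -
  have "(zeta_num \<circ> (\<lambda>s. 1 - s)) holomorphic_on A"
    by (rule holomorphic_on_compose_gen[OF _ zeta_num_holomorphic]) (use assms in \<open>auto intro!: holomorphic_intros\<close>)
  then show ?thesis by (simp add: o_def)
qed

text \<open>Identity theorem on a vertical strip, the two sides being known to agree on the real
  interval from 0 to 1. The equation is cleared of denominators for this purpose:
  \<open>Gamma (s + 1)\<close> absorbs the pole of Gamma at 0 and \<open>zeta_num\<close> the pole
  of zeta at 1, so both sides are holomorphic on the whole strip.\<close>

lemma zeta_num_reflection:
  assumes "-1 < Re s" "Re s < 2"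
  shows "2 * cos (of_real pi * s / 2) * Gamma (s + 1) * zeta_num s
       = (2 * of_real pi) powr s * (1 - s) * zeta_num (1 - s)"
proof -
  let ?S = "{s. Re s > -1} \<inter> {s. Re s < 2}" and ?U = "complex_of_real ` {0<..<1}"
  let ?f = "\<lambda>s. 2 * cos (of_real pi * s / 2) * Gamma (s + 1) * zeta_num s
       - (2 * of_real pi) powr s * (1 - s) * zeta_num (1 - s)"
  have "?f s = 0"
  proof (rule analytic_continuation[of ?f ?S ?U "of_real (1/2)"])
    have "(\<lambda>s. zeta_num (1 - s)) holomorphic_on ?S" by (rule zeta_num_reflected_holomorphic) auto
    moreover have "zeta_num holomorphic_on ?S" using zeta_num_holomorphic by (rule holomorphic_on_subset) auto
    moreover have "s + 1 \<notin> \<int>\<^sub>\<le>\<^sub>0" if "s \<in> ?S" for s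
      using that by (intro Re_pos_imp_not_nonpos_Int) auto
    ultimately show "?f holomorphic_on ?S"
      by (intro holomorphic_intros) auto
    show "open ?S" by (intro open_Int open_halfspace_Re_gt open_halfspace_Re_lt)
    show "connected ?S"
      by (intro convex_connected convex_Int convex_halfspace_Re_gt convex_halfspace_Re_lt)
    show "complex_of_real (1/2) islimpt ?U"
      unfolding islimpt_approachable
    proof (intro allI impI)
      fix e :: real assume "e > 0"
      then show "\<exists>x'\<in>?U. x' \<noteq> of_real (1/2) \<and> dist x' (of_real (1/2)) < e"
        by (intro bexI[of _ "of_real (1/2 + min (e/2) (1/4))"] imageI)
           (auto simp: dist_norm simp del: of_real_add of_real_divide simp flip: of_real_diff of_real_add)
    qed
    fix z assume "z \<in> ?U"
    then obtain r where r: "z = of_real r" "0 < r" "r < 1" by auto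
    define A B where "A = Re (zeta_num (of_real r))" and "B = Re (zeta_num (of_real (1 - r)))"
    have N: "zeta_num z = of_real A" "zeta_num (1 - z) = of_real B"
      using ceil_defect_zeta_num(3)[of r] ceil_defect_zeta_num(3)[of "1 - r"] r by (auto simp: A_def B_def)
    have "0 < pi * r" "pi * r < pi * 1" using r by (auto intro!: mult_strict_left_mono)
    then have c: "cos (pi * r / 2) > 0" using pi_gt_zero by (intro cos_gt_zero_pi) linarith+
    have G: "Gamma (r + 1) = r * Gamma r" using r by (intro Gamma_plus1) (auto elim!: nonpos_Ints_cases)
    have p: "(2 * pi) powr (r - 1) = (2 * pi) powr r / (2 * pi)" by (simp add: powr_diff)
    have "2 * cos (pi * r / 2) * Gamma (r + 1) * A = (2 * cos (pi * r / 2) * r * (1 - r)) * (Gamma r * (A / (1 - r)))"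
      using r by (simp add: G)
    also have "\<dots> = (2 * cos (pi * r / 2) * r * (1 - r)) * (pi / cos (pi * r / 2) * (2 * pi) powr (r - 1) * (B / r))"
      unfolding A_def B_def using zeta_num_reflection_real[of r] r by simp
    also have "\<dots> = (2 * pi) powr r * (1 - r) * B"
      using r c unfolding p by (simp add: field_simps)
    finally have "complex_of_real (2 * cos (pi * r / 2) * Gamma (r + 1) * A) = of_real ((2 * pi) powr r * (1 - r) * B)" by simp
    moreover have "(2 * of_real pi) powr z = complex_of_real ((2 * pi) powr r)"
      using powr_of_real[of "2 * pi" r] by (simp add: r)
    moreover have "cos (of_real pi * z / 2) = complex_of_real (cos (pi * r / 2))"
      by (simp add: r flip: cos_of_real)
    moreover have "Gamma (z + 1) = complex_of_real (Gamma (r + 1))"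
      using Gamma_complex_of_real[of "r + 1"] by (simp add: r)
    ultimately show "?f z = 0" unfolding N by (simp add: r)
  qed (use assms in auto)
  then show ?thesis by simp
qed

text \<open>On Re s < 0 the functional equation is read as a definition: there 1 - s has real part
  above 1, where \<open>zeta_num\<close> is available. It agrees with the Euler-Maclaurin formula
  for -1 < Re s < 0, so the two pieces glue together. The second conjunct keeps the explicit formula
  from which the growth of zeta is later estimated.\<close>

lemma is_zeta_exists: "\<exists>f. is_zeta f \<and> (\<forall>s. Re s > -1 \<longrightarrow> s \<noteq> 1 \<longrightarrow> f s = zeta_num s / (s - 1))"
proof -
  define R where "R s = 2 * (2 * of_real pi) powr (s - 1) * cos (of_real pi * (1 - s) / 2) * Gamma (1 - s) * (zeta_num (1 - s) / (-s))" for s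
  define Z where "Z s = (if s = 1 then 0 else if Re s > -1 then zeta_num s / (s - 1) else R s)" for s
  have ZR: "Z s = R s" if "Re s < 0" for s
  proof (cases "Re s > -1")
    case True
    have s: "s \<noteq> 0" "s \<noteq> 1" using that by auto
    have G: "Gamma (2 - s) = (1 - s) * Gamma (1 - s)"
      using Gamma_plus1[OF Re_pos_imp_not_nonpos_Int, of "1 - s"] that by simp
    have "2 * cos (of_real pi * (1 - s) / 2) * Gamma (1 - s + 1) * zeta_num (1 - s)
       = (2 * of_real pi) powr (1 - s) * (1 - (1 - s)) * zeta_num (1 - (1 - s))"
      using True that by (intro zeta_num_reflection) auto
    then have e: "2 * cos (of_real pi * (1 - s) / 2) * ((1 - s) * Gamma (1 - s)) * zeta_num (1 - s)
       = (2 * of_real pi) powr (1 - s) * s * zeta_num s"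
      by (simp add: G)
    have p: "(2 * complex_of_real pi) powr (s - 1) * (2 * of_real pi) powr (1 - s) = 1"
      by (simp flip: powr_add)
    have "(1 - s) * (-s) * R s = (2 * of_real pi) powr (s - 1) * (2 * cos (of_real pi * (1 - s) / 2) * ((1 - s) * Gamma (1 - s)) * zeta_num (1 - s))"
      unfolding R_def using s by (simp add: field_simps)
    also have "\<dots> = ((2 * of_real pi) powr (s - 1) * (2 * of_real pi) powr (1 - s)) * s * zeta_num s"
      unfolding e by (simp add: mult_ac)
    also have "\<dots> = s * zeta_num s" unfolding p by simp
    also have "\<dots> = (1 - s) * (-s) * (zeta_num s / (s - 1))" using s by (simp add: field_simps)
    finally have "R s = zeta_num s / (s - 1)"
      using s mult_left_cancel[of "(1 - s) * (-s)" "R s" "zeta_num s / (s - 1)"] by simp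
    then show ?thesis using True s by (simp add: Z_def)
  qed (use that in \<open>auto simp: Z_def\<close>)
  have h1: "Z holomorphic_on {s. Re s < 0}"
  proof (rule holomorphic_transform)
    have "(\<lambda>s. zeta_num (1 - s)) holomorphic_on {s. Re s < 0}" by (rule zeta_num_reflected_holomorphic) auto
    moreover have "1 - s \<notin> \<int>\<^sub>\<le>\<^sub>0" if "Re s < 0" for s
      using that by (intro Re_pos_imp_not_nonpos_Int) auto
    ultimately show "R holomorphic_on {s. Re s < 0}"
      unfolding R_def by (intro holomorphic_intros) auto
  qed (simp add: ZR)
  have h2: "Z holomorphic_on ({s. Re s > -1} - {1})"
  proof (rule holomorphic_transform)
    show "(\<lambda>s. zeta_num s / (s - 1)) holomorphic_on ({s. Re s > -1} - {1})"
      by (intro holomorphic_intros holomorphic_on_subset[OF zeta_num_holomorphic]) auto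
  qed (auto simp: Z_def)
  have "Z holomorphic_on ({s. Re s < 0} \<union> ({s. Re s > -1} - {1}))"
    by (intro holomorphic_on_Un h1 h2 open_Diff open_halfspace_Re_lt open_halfspace_Re_gt) auto
  also have "{s. Re s < 0} \<union> ({s. Re s > -1} - {1}) = - {1}" by auto
  finally have hol: "Z holomorphic_on - {1}" .
  have "(\<lambda>n. 1 / of_nat (Suc n) powr s) sums Z s" if "Re s > 1" for s
  proof -
    have "Z s = zeta_num s / (s - 1)" using that by (auto simp: Z_def)
    then show ?thesis using zeta_num_sums[OF that] by simp
  qed
  moreover have "Z 1 = 0" by (simp add: Z_def)
  ultimately have "is_zeta Z" using hol unfolding is_zeta_def by blast
  then show ?thesis by (intro exI[of _ Z]) (auto simp: Z_def)
qed

lemma is_zeta_zeta: "is_zeta zeta"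
  and zeta_eq_zeta_num: "Re s > -1 \<Longrightarrow> s \<noteq> 1 \<Longrightarrow> zeta s = zeta_num s / (s - 1)"
  using is_zeta_exists zeta_eqI by metis+

lemma zeta_holomorphic: "zeta holomorphic_on - {1}"
  and zeta_sums: "Re s > 1 \<Longrightarrow> (\<lambda>n. 1 / of_nat (Suc n) powr s) sums zeta s"
  using is_zeta_zeta by (auto simp: is_zeta_def)

lemma zeta_reflection:
  assumes "0 < Re s" "Re s < 2" "s \<noteq> 1"
  shows "zeta (1 - s) = 2 * (2 * of_real pi) powr (-s) * cos (of_real pi * s / 2) * Gamma s * zeta s"
proof -
  have s: "s \<noteq> 0" "s \<noteq> 1" using assms by auto
  have G: "Gamma (s + 1) = s * Gamma s"
    using Gamma_plus1[OF Re_pos_imp_not_nonpos_Int] assms by simp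
  have p: "(2 * complex_of_real pi) powr (-s) * (2 * of_real pi) powr s = 1"
    by (simp flip: powr_add)
  have e: "2 * cos (of_real pi * s / 2) * (s * Gamma s) * zeta_num s
       = (2 * of_real pi) powr s * (1 - s) * zeta_num (1 - s)"
    using zeta_num_reflection[of s] assms by (simp add: G)
  have z: "zeta s = zeta_num s / (s - 1)" "zeta (1 - s) = zeta_num (1 - s) / (-s)"
    using assms s by (auto simp: zeta_eq_zeta_num)
  have "s * (1 - s) * zeta (1 - s) = - (1 - s) * zeta_num (1 - s)" using s unfolding z by simp (simp add: algebra_simps)
  also have "\<dots> = - ((2 * complex_of_real pi) powr (-s) * (2 * of_real pi) powr s) * (1 - s) * zeta_num (1 - s)"
    unfolding p by simp
  also have "\<dots> = - ((2 * of_real pi) powr (-s) * (2 * cos (of_real pi * s / 2) * (s * Gamma s) * zeta_num s))"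
    unfolding e by (simp add: mult_ac)
  also have "\<dots> = s * (1 - s) * (2 * (2 * of_real pi) powr (-s) * cos (of_real pi * s / 2) * Gamma s * zeta s)"
    unfolding z using s by (simp add: field_simps)
  finally show ?thesis using s by simp
qed

section \<open>The Dirichlet series of the logarithmic derivative\<close>

lemma zeta_sums_powr:
  assumes "Re s > 1"
  shows "(\<lambda>n. of_nat n powr (-s)) sums zeta s"
proof -
  have "(\<lambda>n. of_nat (Suc n) powr (-s)) sums (zeta s - of_nat 0 powr (-s))"
    using zeta_sums[OF assms] by (simp add: powr_minus_divide del: of_nat_Suc)
  then show ?thesis by (subst (asm) sums_Suc_iff) simp
qed

lemma norm_of_nat_powr: "norm (of_nat n powr s :: complex) = real n powr Re s"
  using norm_powr_real_powr[of "of_nat n" s] by simp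

lemma summable_ln_powr:
  assumes "\<sigma> > (1::real)"
  shows "summable (\<lambda>n. ln (real n) * real n powr (-\<sigma>))"
proof (rule summable_comparison_test')
  define d where "d = (\<sigma> - 1) / 2"
  have d: "d > 0" using assms by (simp add: d_def)
  show "summable (\<lambda>n. 1 / d * real n powr (d - \<sigma>))"
    using assms by (intro summable_mult) (simp add: summable_real_powr_iff d_def field_simps)
  fix n :: nat assume n: "n \<ge> 1"
  have "norm (ln (real n) * real n powr (-\<sigma>)) = ln (real n) * real n powr (-\<sigma>)" using n by simp
  also have "\<dots> \<le> real n powr d / d * real n powr (-\<sigma>)"
    using n d by (intro mult_right_mono ln_powr_bound) auto
  also have "\<dots> = 1 / d * real n powr (d - \<sigma>)" using n by (simp add: powr_diff powr_minus field_simps)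
  finally show "norm (ln (real n) * real n powr (-\<sigma>)) \<le> 1 / d * real n powr (d - \<sigma>)" .
qed

lemma summable_mangoldt_powr:
  assumes "\<sigma> > (1::real)"
  shows "summable (\<lambda>n. mangoldt n * real n powr (-\<sigma>))"
proof (rule summable_comparison_test'[OF summable_ln_powr[OF assms]])
  fix n :: nat assume n: "n \<ge> 1"
  then have "mangoldt n \<le> ln (real n)" using mangoldt_le[of n] by simp
  then show "norm (mangoldt n * real n powr (-\<sigma>)) \<le> ln (real n) * real n powr (-\<sigma>)"
    by (simp add: abs_mult mult_right_mono)
qed

text \<open>Locally uniform convergence: the ball of radius d = (Re s - 1) / 2 around s stays in Re
  y \<ge> 1 + d. It is used with constant coefficients, to differentiate zeta, and with
  \<open>mangoldt\<close>, to know that the series is holomorphic before it is identified with a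
  quotient.\<close>

lemma Dirichlet_series_derivative:
  fixes a :: "nat \<Rightarrow> real"
  assumes a: "\<And>\<sigma>. \<sigma> > 1 \<Longrightarrow> summable (\<lambda>n. norm (a n) * real n powr (-\<sigma>))"
  obtains g g' where "\<And>s. Re s > 1 \<Longrightarrow> (\<lambda>n. of_real (a n) * of_nat n powr (-s)) sums g s"
    "\<And>s. Re s > 1 \<Longrightarrow> (\<lambda>n. - of_real (a n * ln (real n)) * of_nat n powr (-s)) sums g' s"
    "\<And>s. Re s > 1 \<Longrightarrow> (g has_field_derivative g' s) (at s)"
proof -
  have "\<exists>g g'. \<forall>s\<in>{s. Re s > 1}. ((\<lambda>n. of_real (a n) * of_nat n powr (-s)) sums g s)
      \<and> ((\<lambda>n. - of_real (a n * ln (real n)) * of_nat n powr (-s)) sums g' s)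
      \<and> (g has_field_derivative g' s) (at s)"
  proof (rule series_and_derivative_comparison_complex)
    show "open {s. Re s > 1}" by (rule open_halfspace_Re_gt)
    fix n and s :: complex
    show "((\<lambda>s. of_real (a n) * of_nat n powr (-s)) has_field_derivative
       - of_real (a n * ln (real n)) * of_nat n powr (-s)) (at s)"
    proof (cases "n = 0")
      case False
      then have "((\<lambda>s. of_nat n powr (-s)) has_field_derivative (Ln (of_nat n) * of_nat n powr (-s)) * (-1)) (at s)"
        by (intro DERIV_chain2[OF has_field_derivative_powr_right]) (auto intro!: derivative_eq_intros)
      from DERIV_cmult[OF this, of "of_real (a n)"] show ?thesis
        using False by (simp add: Ln_of_nat mult_ac)
    qed auto
  next
    fix s :: complex assume "s \<in> {s. Re s > 1}"
    then have s: "Re s > 1" by simp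
    define d where "d = (Re s - 1) / 2"
    have d: "d > 0" using s by (simp add: d_def)
    show "\<exists>d h. 0 < d \<and> summable h \<and> range h \<subseteq> \<real>\<^sub>\<ge>\<^sub>0 \<and>
        (\<forall>\<^sub>F n in sequentially. \<forall>y\<in>ball s d \<inter> {s. Re s > 1}. cmod (of_real (a n) * of_nat n powr (-y)) \<le> cmod (h n))"
    proof (intro exI conjI)
      show "summable (\<lambda>n. complex_of_real (norm (a n) * real n powr (- (1 + d))))"
        using a[of "1 + d"] d by (intro summable_of_real) auto
      show "range (\<lambda>n. complex_of_real (norm (a n) * real n powr (- (1 + d)))) \<subseteq> \<real>\<^sub>\<ge>\<^sub>0"
        by auto
      show "\<forall>\<^sub>F n in sequentially. \<forall>y\<in>ball s d \<inter> {s. Re s > 1}. cmod (of_real (a n) * of_nat n powr (-y))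
          \<le> cmod (complex_of_real (norm (a n) * real n powr (- (1 + d))))"
        using eventually_ge_at_top[of 1]
      proof eventually_elim
        case (elim n)
        show ?case
        proof
          fix y assume "y \<in> ball s d \<inter> {s. Re s > 1}"
          then have "\<bar>Re (s - y)\<bar> < d" using abs_Re_le_cmod[of "s - y"] by (auto simp: dist_norm)
          then have "Re y \<ge> 1 + d" unfolding d_def by (simp add: abs_if field_simps split: if_splits)
          then have "real n powr (- Re y) \<le> real n powr (- (1 + d))" using elim by (intro powr_mono) auto
          then show "cmod (of_real (a n) * of_nat n powr (-y)) \<le> cmod (complex_of_real (norm (a n) * real n powr (- (1 + d))))"
            by (simp add: norm_mult norm_of_nat_powr abs_mult mult_left_mono)
        qed
      qed
    qed (use d in auto)
  qed
  then obtain g g' where gg: "\<forall>s\<in>{s. Re s > 1}. ((\<lambda>n. of_real (a n) * of_nat n powr (-s)) sums g s)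
      \<and> ((\<lambda>n. - of_real (a n * ln (real n)) * of_nat n powr (-s)) sums g' s)
      \<and> (g has_field_derivative g' s) (at s)" by (elim exE)
  show ?thesis
  proof (rule that)
    fix s :: complex assume "Re s > 1"
    with gg show "(\<lambda>n. of_real (a n) * of_nat n powr (-s)) sums g s"
      "(\<lambda>n. - of_real (a n * ln (real n)) * of_nat n powr (-s)) sums g' s"
      "(g has_field_derivative g' s) (at s)" by (simp_all only: mem_Collect_eq Ball_def)
  qed
qed

lemma deriv_zeta_sums:
  assumes s: "Re s > 1"
  shows "(\<lambda>n. of_real (ln (real n)) * of_nat n powr (-s)) sums (- deriv zeta s)"
proof -
  obtain g g' where g: "\<And>s. Re s > 1 \<Longrightarrow> (\<lambda>n. of_real 1 * of_nat n powr (-s)) sums g s"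
    "\<And>s. Re s > 1 \<Longrightarrow> (\<lambda>n. - of_real (1 * ln (real n)) * of_nat n powr (-s)) sums g' s"
    "\<And>s. Re s > 1 \<Longrightarrow> (g has_field_derivative g' s) (at s)"
    by (rule Dirichlet_series_derivative[of "\<lambda>_. 1"]) (auto simp: summable_real_powr_iff)
  have "g z = zeta z" if "Re z > 1" for z
    using g(1)[OF that] zeta_sums_powr[OF that] sums_unique2 by fastforce
  then have "(zeta has_field_derivative g' s) (at s)"
    using has_field_derivative_transform_within_open[OF g(3)[OF s] open_halfspace_Re_gt[of 1]] s by auto
  then have "deriv zeta s = g' s" by (rule DERIV_imp_deriv)
  then show ?thesis using sums_minus[OF g(2)[OF s]] by simp
qed

text \<open>The sum of \<open>mangoldt d\<close> over the divisors d of n is ln n. The absolutely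
  convergent double series over d and e is grouped by n = d e, and the result is the series of -
  zeta'.\<close>

lemma mangoldt_times_zeta:
  assumes s: "Re s > 1"
  shows "(\<Sum>n. mangoldt n * of_nat n powr (-s)) * zeta s = - deriv zeta s"
proof -
  define F where "F n = mangoldt n * of_nat n powr (-s)" for n :: nat
  define G where "G n = (of_nat n powr (-s) :: complex)" for n :: nat
  \<comment> \<open>Zero is left out because it has infinitely many divisors, so that the inner sums
    would not be finite. Nothing is lost, as the terms with index 0 vanish.\<close>
  define P where "P = {n::nat. n > 0}"
  have sF: "summable (\<lambda>n. norm (F n))"
    using summable_mangoldt_powr[OF s] by (simp add: F_def norm_mult norm_of_nat_powr)
  have sG: "summable (\<lambda>n. norm (G n))"
    using s by (simp add: G_def norm_of_nat_powr summable_real_powr_iff)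
  have iffP: "(f has_sum S) P \<longleftrightarrow> (f has_sum S) UNIV" if "f 0 = 0" for f :: "nat \<Rightarrow> complex" and S
    by (rule has_sum_cong_neutral) (use that in \<open>auto simp: P_def\<close>)
  note toP = iffP[THEN iffD2, rotated] and ofP = iffP[THEN iffD1, rotated]
  have F: "(F has_sum suminf F) P"
    by (intro toP norm_summable_imp_has_sum sF summable_sums[OF summable_norm_cancel[OF sF]]) (simp add: F_def)
  have G: "(G has_sum zeta s) P"
    using zeta_sums_powr[OF s] by (intro toP norm_summable_imp_has_sum sG) (auto simp: G_def [abs_def])
  have aF: "(\<lambda>n. norm (F n)) summable_on P" and aG: "(\<lambda>n. norm (G n)) summable_on P"
    using sF sG by (auto intro!: summable_on_subset_banach[OF norm_summable_imp_summable_on])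
  have "(\<lambda>x. norm (case x of (d, e) \<Rightarrow> F d * G e)) summable_on P \<times> P"
    unfolding Infinite_Sum.abs_summable_on_Sigma_iff
  proof (intro conjI ballI)
    show "(\<lambda>y. norm (case (x, y) of (d, e) \<Rightarrow> F d * G e)) summable_on P" for x
      unfolding prod.case norm_mult using aG by (rule summable_on_cmult_right)
    have "(\<lambda>x. norm (F x) * (\<Sum>\<^sub>\<infinity>y\<in>P. norm (G y))) summable_on P"
      using aF by (rule summable_on_cmult_left)
    moreover have "(\<Sum>\<^sub>\<infinity>y\<in>P. norm (G y)) \<ge> 0" by (intro infsum_nonneg) auto
    ultimately show "(\<lambda>x. norm (\<Sum>\<^sub>\<infinity>y\<in>P. norm (case (x, y) of (d, e) \<Rightarrow> F d * G e))) summable_on P"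
      unfolding prod.case norm_mult infsum_cmult_right' by simp
  qed
  then have sP: "(\<lambda>(d, e). F d * G e) summable_on P \<times> P" by (rule Infinite_Sum.abs_summable_summable)
  have 1: "((\<lambda>(d, e). F d * G e) has_sum (suminf F * zeta s)) (P \<times> P)"
  proof (rule has_sum_SigmaI[OF _ _ sP])
    show "((\<lambda>y. case (d, y) of (d, e) \<Rightarrow> F d * G e) has_sum (F d * zeta s)) P" for d
      unfolding prod.case using G by (rule has_sum_cmult_right)
    show "((\<lambda>d. F d * zeta s) has_sum (suminf F * zeta s)) P" using F by (rule has_sum_cmult_left)
  qed
  have "((\<lambda>(n, d). mangoldt d * of_nat n powr (-s)) has_sum (suminf F * zeta s)) (SIGMA n:P. {d. d dvd n})
      \<longleftrightarrow> ((\<lambda>(d, e). F d * G e) has_sum (suminf F * zeta s)) (P \<times> P)"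
  proof (rule has_sum_reindex_bij_witness[where j = "\<lambda>(n, d). (d, n div d)" and i = "\<lambda>(d, e). (d * e, d)"])
    fix a :: "nat \<times> nat" assume "a \<in> (SIGMA n:P. {d. d dvd n})"
    then obtain n d where a: "a = (n, d)" "n > 0" "d dvd n" by (auto simp: P_def)
    then have nd: "d > 0" "n div d > 0" "d * (n div d) = n" by (auto simp: dvd_pos_nat div_greater_zero_iff dvd_imp_le)
    show "(case (case a of (n, d) \<Rightarrow> (d, n div d)) of (d, e) \<Rightarrow> (d * e, d)) = a"
      and "(case a of (n, d) \<Rightarrow> (d, n div d)) \<in> P \<times> P"
      using a nd by (auto simp: P_def)
    have "(of_nat n :: complex) powr (-s) = of_nat d powr (-s) * of_nat (n div d) powr (-s)"
      using powr_times_real[of "of_nat d" "of_nat (n div d)" "-s"] nd(3) by (simp flip: of_nat_mult)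
    then show "(case (case a of (n, d) \<Rightarrow> (d, n div d)) of (d, e) \<Rightarrow> F d * G e)
        = (case a of (n, d) \<Rightarrow> mangoldt d * of_nat n powr (-s))"
      by (simp add: F_def G_def a(1))
  qed (auto simp: P_def)
  with 1 have "((\<lambda>(n, d). mangoldt d * of_nat n powr (-s)) has_sum (suminf F * zeta s)) (SIGMA n:P. {d. d dvd n})"
    by simp
  then have "((\<lambda>n. \<Sum>d | d dvd n. mangoldt d * of_nat n powr (-s)) has_sum (suminf F * zeta s)) P"
  proof (rule has_sum_SigmaD)
    show "((\<lambda>d. case (n, d) of (n, d) \<Rightarrow> mangoldt d * of_nat n powr (-s)) has_sum
        (\<Sum>d | d dvd n. mangoldt d * of_nat n powr (-s))) {d. d dvd n}" if "n \<in> P" for n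
      unfolding prod.case by (rule has_sum_finite) (use that in \<open>auto simp: P_def\<close>)
  qed
  then have h: "((\<lambda>n. \<Sum>d | d dvd n. mangoldt d * of_nat n powr (-s)) has_sum (suminf F * zeta s)) P" .
  have "(\<Sum>d | d dvd n. mangoldt d * of_nat n powr (-s)) = of_real (ln (real n)) * of_nat n powr (-s)"
    if "n \<in> P" for n
    using that mangoldt_sum[of n, where ?'a = complex] by (simp add: P_def flip: sum_distrib_right)
  from has_sum_cong[THEN iffD1, OF this h]
  have "((\<lambda>n. of_real (ln (real n)) * of_nat n powr (-s)) has_sum (suminf F * zeta s)) P" .
  then have "((\<lambda>n. of_real (ln (real n)) * of_nat n powr (-s)) has_sum (suminf F * zeta s)) UNIV"
    by (rule ofP) simp
  from sums_unique2[OF has_sum_imp_sums[OF this] deriv_zeta_sums[OF s]]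
  show ?thesis by (simp add: F_def [abs_def])
qed

text \<open>The series differs from its leading term 1 by at most pi^2 / 6 - 1, which is below 3 /
  4. This is the lower bound at the centres of the discs in which zeros are counted.\<close>

lemma norm_zeta_ge_quarter:
  assumes "Re s = 2"
  shows "norm (zeta s) \<ge> 1 / 4"
proof -
  have sm: "summable (\<lambda>n. 1 / real (Suc (Suc n)) ^ 2)"
    using inverse_squares_sums by (subst summable_Suc_iff) (auto simp: sums_iff)
  have "(\<lambda>n. 1 / of_nat (Suc n) powr s) sums zeta s" using assms by (intro zeta_sums) auto
  then have *: "(\<lambda>n. 1 / of_nat (Suc (Suc n)) powr s) sums (zeta s - 1)"
    by (subst sums_Suc_iff) simp
  have n: "norm (1 / of_nat (Suc (Suc n)) powr s :: complex) = 1 / real (Suc (Suc n)) ^ 2" for n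
    using assms norm_of_nat_powr[of "Suc (Suc n)" s] by (simp add: norm_divide del: of_nat_Suc)
  have "norm (zeta s - 1) = norm (\<Sum>n. 1 / of_nat (Suc (Suc n)) powr s :: complex)"
    using * by (simp add: sums_iff)
  also have "\<dots> \<le> (\<Sum>n. norm (1 / of_nat (Suc (Suc n)) powr s :: complex))"
    by (rule summable_norm) (use sm in \<open>simp only: n\<close>)
  also have "\<dots> = (\<Sum>n. 1 / real (Suc (Suc n)) ^ 2)" by (simp only: n)
  also have "(\<lambda>n. 1 / real (Suc (Suc n)) ^ 2) sums (pi\<^sup>2 / 6 - 1)"
    using inverse_squares_sums by (subst sums_Suc_iff) simp
  then have "(\<Sum>n. 1 / real (Suc (Suc n)) ^ 2) = pi\<^sup>2 / 6 - 1" by (simp add: sums_iff)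
  also have "pi\<^sup>2 \<le> 3.15\<^sup>2" using pi_approx(2) by (intro power_mono) auto
  then have "pi\<^sup>2 / 6 - 1 \<le> 3 / 4" by (simp add: power2_eq_square)
  finally have "norm (zeta s - 1) \<le> 3 / 4" .
  moreover have "norm (1::complex) - norm (zeta s) \<le> norm (1 - zeta s)" by (rule norm_triangle_ineq2)
  ultimately show ?thesis by (simp add: norm_minus_commute)
qed

lemma zeta_has_field_derivative: "s \<noteq> 1 \<Longrightarrow> (zeta has_field_derivative deriv zeta s) (at s)"
  using holomorphic_derivI[OF zeta_holomorphic, of s] by auto

text \<open>No Euler product is involved: \<open>mangoldt_times_zeta\<close> is a linear
  differential equation for zeta. If P is a primitive of the Dirichlet series of
  \<open>mangoldt\<close>, then zeta times exp P is constant on the half plane, so a single zero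
  would force zeta 2 = 0.\<close>

lemma zeta_nonzero_Re_gt_1:
  assumes "Re s > 1"
  shows "zeta s \<noteq> 0"
proof
  assume z: "zeta s = 0"
  obtain D D' where D: "\<And>s. Re s > 1 \<Longrightarrow> (\<lambda>n. of_real (mangoldt n) * of_nat n powr (-s)) sums D s"
    "\<And>s. Re s > 1 \<Longrightarrow> (D has_field_derivative D' s) (at s)"
    by (rule Dirichlet_series_derivative[of mangoldt]) (auto simp: summable_mangoldt_powr[simplified])
  have Dz: "D s * zeta s = - deriv zeta s" if "Re s > 1" for s
    using mangoldt_times_zeta[OF that] D(1)[OF that] by (simp add: sums_iff)
  let ?H = "{s. Re s > 1}"
  have "D holomorphic_on ?H"
    using D(2) by (auto simp: holomorphic_on_open open_halfspace_Re_gt)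
  then obtain P where P: "\<And>s. s \<in> ?H \<Longrightarrow> (P has_field_derivative D s) (at s within ?H)"
    using holomorphic_convex_primitive'[OF convex_halfspace_Re_gt open_halfspace_Re_gt] by metis
  have "\<exists>c. \<forall>s\<in>?H. zeta s * exp (P s) = c"
  proof (rule has_field_derivative_zero_constant)
    fix s assume "s \<in> ?H"
    then have s: "Re s > 1" by simp
    have "s \<noteq> 1" using s by auto
    then have "((\<lambda>s. zeta s * exp (P s)) has_field_derivative
        zeta s * (exp (P s) * D s) + deriv zeta s * exp (P s)) (at s within ?H)"
      by (intro DERIV_mult' DERIV_chain2[OF DERIV_exp P] has_field_derivative_at_within[OF zeta_has_field_derivative])
         (use s in auto)
    also have "zeta s * (exp (P s) * D s) + deriv zeta s * exp (P s) = exp (P s) * (D s * zeta s + deriv zeta s)"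
      by (simp add: algebra_simps)
    also have "\<dots> = 0" using Dz[OF s] by simp
    finally show "((\<lambda>s. zeta s * exp (P s)) has_field_derivative 0) (at s within ?H)" .
  qed (rule convex_halfspace_Re_gt)
  then obtain c where c: "\<And>s. Re s > 1 \<Longrightarrow> zeta s * exp (P s) = c" by auto
  have "c = 0" using c[OF assms] z by simp
  then have "zeta 2 = 0" using c[of 2] by simp
  then show False using norm_zeta_ge_quarter[of 2] by simp
qed

lemma logderiv_zeta_sums:
  assumes "Re s > 1"
  shows "(\<lambda>n. mangoldt n * of_nat n powr (-s)) sums (- deriv zeta s / zeta s)"
proof -
  have "summable (\<lambda>n. norm (mangoldt n * of_nat n powr (-s) :: complex))"
    using summable_mangoldt_powr[OF assms] by (simp add: norm_mult norm_of_nat_powr)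
  then have "summable (\<lambda>n. mangoldt n * of_nat n powr (-s) :: complex)" by (rule summable_norm_cancel)
  moreover have "(\<Sum>n. mangoldt n * of_nat n powr (-s)) = - deriv zeta s / zeta s"
    by (rule nonzero_eq_divide_eq[THEN iffD2, OF zeta_nonzero_Re_gt_1[OF assms] mangoldt_times_zeta[OF assms]])
  ultimately show ?thesis by (simp only: sums_iff)
qed

section \<open>Non-vanishing on the lines Re s = 1 and Re s = 0\<close>

text \<open>Here f' / f = g' / g + n / (w - z0), and multiplication by w - z0 removes the first
  summand in the limit. The exponent is an integer so that zeros and the simple pole of zeta (n =
  -1) are treated alike.\<close>

lemma logderiv_tendsto_order:
  fixes f g :: "complex \<Rightarrow> complex"
  assumes "r > 0" and g: "g holomorphic_on ball z0 r" "g z0 \<noteq> 0"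
    and f: "\<And>w. w \<in> ball z0 r \<Longrightarrow> w \<noteq> z0 \<Longrightarrow> f w = g w * (w - z0) powi n"
  shows "((\<lambda>w. (w - z0) * (deriv f w / f w)) \<longlongrightarrow> of_int n) (at z0)"
proof -
  have z0: "z0 \<in> ball z0 r" using \<open>r > 0\<close> by simp
  have isc: "isCont g z0" "isCont (deriv g) z0"
    using g(1) z0 holomorphic_deriv[OF g(1)]
    by (auto intro!: continuous_on_interior holomorphic_on_imp_continuous_on simp: interior_open)
  then have "((\<lambda>w. (w - z0) * (deriv g w / g w) + of_int n) \<longlongrightarrow> (z0 - z0) * (deriv g z0 / g z0) + of_int n) (at z0)"
    using g(2) by (intro tendsto_intros) (auto simp: isCont_def)
  then have "((\<lambda>w. (w - z0) * (deriv g w / g w) + of_int n) \<longlongrightarrow> of_int n) (at z0)" by simp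
  moreover have "\<forall>\<^sub>F w in at z0. (w - z0) * (deriv g w / g w) + of_int n = (w - z0) * (deriv f w / f w)"
  proof -
    have "\<forall>\<^sub>F w in at z0. g w \<noteq> 0"
      using isc(1) g(2) by (intro tendsto_imp_eventually_ne) (auto simp: isCont_def)
    moreover have "\<forall>\<^sub>F w in at z0. w \<in> ball z0 r - {z0}"
      using \<open>r > 0\<close> by (intro eventually_at_in_open) auto
    ultimately show ?thesis
    proof eventually_elim
      case (elim w)
      then have w: "w \<in> ball z0 r" "w \<noteq> z0" "w - z0 \<noteq> 0" by auto
      have dg: "(g has_field_derivative deriv g w) (at w)"
        using g(1) w(1) by (intro holomorphic_derivI[of g "ball z0 r"]) auto
      have "((\<lambda>w. g w * (w - z0) powi n) has_field_derivative
          g w * (of_int n * (w - z0) powi (n - 1)) + deriv g w * (w - z0) powi n) (at w)"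
        using w by (auto intro!: derivative_eq_intros dg)
      then have "(f has_field_derivative
          g w * (of_int n * (w - z0) powi (n - 1)) + deriv g w * (w - z0) powi n) (at w)"
        using w f by (elim has_field_derivative_transform_within_open[where S = "ball z0 r - {z0}"]) auto
      then have "deriv f w = g w * (of_int n * (w - z0) powi (n - 1)) + deriv g w * (w - z0) powi n"
        by (rule DERIV_imp_deriv)
      also have "(w - z0) powi (n - 1) = (w - z0) powi n / (w - z0)"
        using w by (simp add: power_int_diff)
      finally have df: "deriv f w = g w * (of_int n * ((w - z0) powi n / (w - z0))) + deriv g w * (w - z0) powi n" .
      have cancel: "d * ((a * (m * (E / d)) + b * E) / (a * E)) = d * (b / a) + m"
        if "d \<noteq> 0" "E \<noteq> 0" "a \<noteq> 0" for d E a b m :: complex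
        using that by (simp add: field_simps)
      show ?case unfolding df f[OF w(1,2)] by (rule cancel[symmetric]) (use w elim in auto)
    qed
  qed
  ultimately show ?thesis by (rule Lim_transform_eventually)
qed

text \<open>Zeta is holomorphic off 1 and not identically zero, so it factors locally as a
  nonvanishing function times a power. Points where zeta does not vanish are included, with order 0.
  Nonnegativity of the order is what makes \<open>nat (zorder zeta z)\<close> a faithful
  multiplicity.\<close>

lemma zeta_logderiv_tendsto_zorder:
  assumes "z \<noteq> 1"
  shows "((\<lambda>w. (w - z) * (deriv zeta w / zeta w)) \<longlongrightarrow> of_int (zorder zeta z)) (at z)"
    and "zorder zeta z \<ge> 0" and "zeta z = 0 \<Longrightarrow> zorder zeta z \<ge> 1"
proof -
  have ex: "\<exists>w\<in>-{1}. zeta w \<noteq> 0"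
    using zeta_nonzero_Re_gt_1[of 2] by (intro bexI[of _ 2]) auto
  have op: "open (- {1 :: complex})" "connected (- {1 :: complex})" and z: "z \<in> - {1}"
    using assms by (auto intro: connected_punctured_universe)
  define g where "g = zor_poly zeta z"
  have Z: "(if zeta z = 0 then zorder zeta z > 0 else zorder zeta z = 0) \<and>
     (\<exists>r>0. cball z r \<subseteq> -{1} \<and> g holomorphic_on cball z r \<and>
     (\<forall>w\<in>cball z r. zeta w = g w * (w - z) ^ nat (zorder zeta z) \<and> g w \<noteq> 0))"
    unfolding g_def by (rule zorder_exist_zero[OF zeta_holomorphic op z ex])
  obtain r where r: "r>0 \<and> cball z r \<subseteq> -{1} \<and> g holomorphic_on cball z r \<and>
     (\<forall>w\<in>cball z r. zeta w = g w * (w - z) ^ nat (zorder zeta z) \<and> g w \<noteq> 0)"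
    using Z[THEN conjunct2] by (rule exE)
  note gr = Z[THEN conjunct1] r[THEN conjunct1] r[THEN conjunct2, THEN conjunct1]
    r[THEN conjunct2, THEN conjunct2, THEN conjunct1] r[THEN conjunct2, THEN conjunct2, THEN conjunct2]
  from gr(1) show nn: "zorder zeta z \<ge> 0" "zeta z = 0 \<Longrightarrow> zorder zeta z \<ge> 1" by (auto split: if_splits)
  show "((\<lambda>w. (w - z) * (deriv zeta w / zeta w)) \<longlongrightarrow> of_int (zorder zeta z)) (at z)"
  proof (rule logderiv_tendsto_order[where g = g, OF gr(2)])
    show "g holomorphic_on ball z r" using gr(4) by (rule holomorphic_on_subset) auto
    show "g z \<noteq> 0" using gr(2,5) by auto
    show "zeta w = g w * (w - z) powi zorder zeta z" if "w \<in> ball z r" for w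
      using gr(5) that nn(1) by (simp add: power_int_def)
  qed
qed

lemma zeta_logderiv_tendsto_1: "((\<lambda>w. (w - 1) * (deriv zeta w / zeta w)) \<longlongrightarrow> -1) (at 1)"
proof -
  have b: "Re w > -1" if "w \<in> ball 1 1" for w
    using abs_Re_le_cmod[of "1 - w"] that by (auto simp: dist_norm)
  have "((\<lambda>w. (w - 1) * (deriv zeta w / zeta w)) \<longlongrightarrow> of_int (-1)) (at 1)"
  proof (rule logderiv_tendsto_order[of 1 zeta_num])
    show "zeta_num holomorphic_on ball 1 1"
      using b by (intro holomorphic_on_subset[OF zeta_num_holomorphic]) auto
    show "zeta w = zeta_num w * (w - 1) powi - 1" if "w \<in> ball 1 1" "w \<noteq> 1" for w
      using zeta_eq_zeta_num[OF b] that by (simp add: divide_inverse)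
  qed (auto simp: zeta_num_1)
  then show ?thesis by simp
qed

text \<open>The classical identity 3 + 4 cos u + cos (2 u) = 2 (1 + cos u)^2, applied to each term
  of the Dirichlet series. That series represents - zeta' / zeta, which is why the sum is
  nonpositive.\<close>

lemma zeta_3_4_1:
  assumes \<sigma>: "\<sigma> > 1"
  shows "3 * Re (deriv zeta (of_real \<sigma>) / zeta (of_real \<sigma>))
       + 4 * Re (deriv zeta (Complex \<sigma> t) / zeta (Complex \<sigma> t))
       + Re (deriv zeta (Complex \<sigma> (2 * t)) / zeta (Complex \<sigma> (2 * t))) \<le> 0"
proof -
  have S: "(\<lambda>n. mangoldt n * real n powr (-\<sigma>) * cos (u * ln (real n))) sums
      (- Re (deriv zeta (Complex \<sigma> u) / zeta (Complex \<sigma> u)))" for u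
  proof -
    have "(\<lambda>n. Re (mangoldt n * of_nat n powr (- Complex \<sigma> u))) sums
       Re (- deriv zeta (Complex \<sigma> u) / zeta (Complex \<sigma> u))"
      using \<sigma> by (intro sums_Re logderiv_zeta_sums) auto
    moreover have "Re (mangoldt n * of_nat n powr (- Complex \<sigma> u)) = mangoldt n * real n powr (-\<sigma>) * cos (u * ln (real n))" for n
    proof (cases "n = 0")
      case False
      then have "Re (of_nat n powr (- Complex \<sigma> u)) = real n powr (-\<sigma>) * cos (u * ln (real n))"
        by (simp add: powr_def Ln_of_nat Re_exp)
      then show ?thesis by simp
    qed auto
    then have "(\<lambda>n. Re (mangoldt n * of_nat n powr (- Complex \<sigma> u))) = (\<lambda>n. mangoldt n * real n powr (-\<sigma>) * cos (u * ln (real n)))"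
      by (rule ext)
    moreover have "Re (- a / b) = - Re (a / b)" for a b by (simp flip: minus_divide_left)
    ultimately show ?thesis by (simp only:)
  qed
  have sm: "(\<lambda>n. 3 * (mangoldt n * real n powr (-\<sigma>) * cos (0 * ln (real n)))
        + 4 * (mangoldt n * real n powr (-\<sigma>) * cos (t * ln (real n)))
        + mangoldt n * real n powr (-\<sigma>) * cos (2 * t * ln (real n)))
     sums (3 * - Re (deriv zeta (Complex \<sigma> 0) / zeta (Complex \<sigma> 0))
       + 4 * - Re (deriv zeta (Complex \<sigma> t) / zeta (Complex \<sigma> t))
       + - Re (deriv zeta (Complex \<sigma> (2 * t)) / zeta (Complex \<sigma> (2 * t))))" (is "?f sums ?S")
    by (intro sums_add sums_mult S)
  have nn: "0 \<le> ?f n" for n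
  proof -
    let ?c = "cos (t * ln (real n))"
    have "cos (2 * t * ln (real n)) = 2 * ?c\<^sup>2 - 1"
      using cos_double_cos[of "t * ln (real n)"] by (simp add: mult.assoc)
    moreover have "3 * (m * cos (0 * ln (real n))) + 4 * (m * c) + m * (2 * c\<^sup>2 - 1) = m * (2 * (1 + c)\<^sup>2)" for m c :: real
      by (simp add: algebra_simps power2_eq_square)
    ultimately have "?f n = mangoldt n * real n powr (-\<sigma>) * (2 * (1 + ?c)\<^sup>2)" by (simp only:)
    also have "\<dots> \<ge> 0" by (intro mult_nonneg_nonneg mangoldt_nonneg) auto
    finally show ?thesis .
  qed
  have "0 \<le> ?S" by (rule sums_le[OF nn sums_zero sm])
  then show ?thesis by (simp add: complex_of_real_def)
qed

text \<open>Evaluate the 3-4-1 inequality at abscissa 1 + \<epsilon>, multiply by \<epsilon> and let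
  \<epsilon> tend to 0. The pole contributes -3, a zero at s contributes at least 4, and the point
  at twice the height contributes a nonnegative order. The limit would be at least 1, yet
  nonpositive.\<close>

lemma zeta_nonzero_Re_1:
  assumes "Re s = 1" "s \<noteq> 1"
  shows "zeta s \<noteq> 0"
proof
  assume z: "zeta s = 0"
  define t where "t = Im s"
  have s: "s = Complex 1 t" and t: "t \<noteq> 0" using assms by (auto simp: t_def complex_eq_iff)
  have s2: "Complex 1 (2 * t) \<noteq> 1" using t by (auto simp: complex_eq_iff)
  have lim: "((\<lambda>\<epsilon>. \<epsilon> * Re (deriv zeta (Complex (1 + \<epsilon>) u) / zeta (Complex (1 + \<epsilon>) u))) \<longlongrightarrow> Re l) (at_right 0)"
    if l: "((\<lambda>w. (w - Complex 1 u) * (deriv zeta w / zeta w)) \<longlongrightarrow> l) (at (Complex 1 u))" for u l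
  proof -
    have "filterlim (\<lambda>\<epsilon>. Complex 1 u + of_real \<epsilon>) (at (Complex 1 u)) (at_right 0)"
      unfolding filterlim_at
      by (auto intro!: tendsto_eq_intros simp: eventually_at_filter)
    from tendsto_Re[OF filterlim_compose[OF l this]]
    have "((\<lambda>\<epsilon>. Re (of_real \<epsilon> * (deriv zeta (Complex 1 u + of_real \<epsilon>) / zeta (Complex 1 u + of_real \<epsilon>)))) \<longlongrightarrow> Re l) (at_right 0)"
      by simp
    moreover have "Complex 1 u + of_real \<epsilon> = Complex (1 + \<epsilon>) u" for \<epsilon> by (simp add: complex_eq_iff)
    moreover have "Re (of_real \<epsilon> * x) = \<epsilon> * Re x" for \<epsilon> x by simp
    ultimately show ?thesis by (simp only:)
  qed
  have l1: "((\<lambda>\<epsilon>. \<epsilon> * Re (deriv zeta (Complex (1 + \<epsilon>) 0) / zeta (Complex (1 + \<epsilon>) 0))) \<longlongrightarrow> Re (-1)) (at_right 0)"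
    by (rule lim) (use zeta_logderiv_tendsto_1 in \<open>simp flip: one_complex.code\<close>)
  have l2: "((\<lambda>\<epsilon>. \<epsilon> * Re (deriv zeta (Complex (1 + \<epsilon>) t) / zeta (Complex (1 + \<epsilon>) t))) \<longlongrightarrow> Re (of_int (zorder zeta s))) (at_right 0)"
    by (rule lim) (use zeta_logderiv_tendsto_zorder(1)[OF assms(2)] s in simp)
  have l3: "((\<lambda>\<epsilon>. \<epsilon> * Re (deriv zeta (Complex (1 + \<epsilon>) (2*t)) / zeta (Complex (1 + \<epsilon>) (2*t)))) \<longlongrightarrow> Re (of_int (zorder zeta (Complex 1 (2*t))))) (at_right 0)"
    by (rule lim) (use zeta_logderiv_tendsto_zorder(1)[OF s2] in simp)
  have "((\<lambda>\<epsilon>. 3 * (\<epsilon> * Re (deriv zeta (Complex (1 + \<epsilon>) 0) / zeta (Complex (1 + \<epsilon>) 0)))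
     + 4 * (\<epsilon> * Re (deriv zeta (Complex (1 + \<epsilon>) t) / zeta (Complex (1 + \<epsilon>) t)))
     + \<epsilon> * Re (deriv zeta (Complex (1 + \<epsilon>) (2*t)) / zeta (Complex (1 + \<epsilon>) (2*t))))
     \<longlongrightarrow> 3 * Re (-1) + 4 * Re (of_int (zorder zeta s)) + Re (of_int (zorder zeta (Complex 1 (2*t))))) (at_right 0)"
    (is "(?F \<longlongrightarrow> ?L) _")
    by (intro tendsto_intros l1 l2 l3)
  moreover have "\<forall>\<^sub>F \<epsilon> in at_right 0. ?F \<epsilon> \<le> 0"
    using eventually_at_right_less[of "0::real"]
  proof eventually_elim
    case (elim \<epsilon>)
    have "\<epsilon> * (3 * Re (deriv zeta (Complex (1+\<epsilon>) 0) / zeta (Complex (1+\<epsilon>) 0))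
       + 4 * Re (deriv zeta (Complex (1+\<epsilon>) t) / zeta (Complex (1+\<epsilon>) t))
       + Re (deriv zeta (Complex (1+\<epsilon>) (2 * t)) / zeta (Complex (1+\<epsilon>) (2 * t)))) \<le> 0"
      using zeta_3_4_1[of "1 + \<epsilon>" t] elim by (intro mult_nonneg_nonpos) (auto simp: complex_of_real_def)
    then show ?case by (simp only: distrib_left mult_ac)
  qed
  ultimately have "?L \<le> 0" by (intro tendsto_upperbound[of ?F ?L "at_right 0" 0]) auto
  moreover have "real_of_int (zorder zeta s) \<ge> 1" "real_of_int (zorder zeta (Complex 1 (2*t))) \<ge> 0"
    using zeta_logderiv_tendsto_zorder(3)[OF assms(2) z] zeta_logderiv_tendsto_zorder(2)[OF s2] by auto
  ultimately show False by simp
qed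

lemma cos_nonzero_complex:
  assumes "Im z \<noteq> 0"
  shows "cos (of_real pi * z / 2) \<noteq> (0::complex)"
proof
  assume "cos (of_real pi * z / 2) = (0::complex)"
  then obtain n where "of_real pi * z / 2 = complex_of_real (of_int n * pi) + of_real pi / 2"
    unfolding cos_eq_0 by auto
  from arg_cong[OF this, of Im] have "pi * Im z / 2 = 0" by simp
  with assms show False by simp
qed

text \<open>Off the real axis the cosine in the functional equation has no zero, so a zero with Re s
  \<le> 0 would reflect to one with real part at least 1, where there is none. Thanks to this, every
  zero met in a contour or disc below is one of the \<open>nontrivial_zeros\<close>.\<close>

lemma zeta_eq_0_imp_critical_strip:
  assumes "zeta s = 0" "-1 < Re s" "Im s \<noteq> 0"
  shows "0 < Re s \<and> Re s < 1"
proof (intro conjI)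
  show "Re s < 1"
  proof -
    have "s \<noteq> 1" using assms by auto
    then show ?thesis
      using assms zeta_nonzero_Re_gt_1[of s] zeta_nonzero_Re_1[of s] by (cases "Re s" "1 :: real" rule: linorder_cases) auto
  qed
  show "0 < Re s"
  proof (rule ccontr)
    assume "\<not> 0 < Re s"
    then have r: "1 \<le> Re (1 - s)" "Re (1 - s) < 2" "1 - s \<noteq> 1" using assms by auto
    have "zeta (1 - (1 - s)) = 2 * (2 * of_real pi) powr (-(1 - s)) * cos (of_real pi * (1 - s) / 2) * Gamma (1 - s) * zeta (1 - s)"
      using r by (intro zeta_reflection) auto
    moreover have "cos (of_real pi * (1 - s) / 2) \<noteq> 0" using assms by (intro cos_nonzero_complex) auto
    moreover have "Gamma (1 - s) \<noteq> 0"
      using r Re_pos_imp_not_nonpos_Int[of "1 - s"] by (simp add: Gamma_eq_zero_iff)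
    moreover have "zeta (1 - s) \<noteq> 0"
      using zeta_nonzero_Re_gt_1[of "1 - s"] zeta_nonzero_Re_1[of "1 - s"] r by (cases "Re (1 - s) = 1") auto
    ultimately show False using assms(1) by simp
  qed
qed

section \<open>The right side of the rectangle\<close>

text \<open>Both sides unfold to the same parametrised integral over the unit interval, up to the
  sign of the direction, so no integrability enters.\<close>

lemma contour_integral_linepath_reflect:
  "contour_integral (linepath a b) (\<lambda>s. f (1 - s)) = - contour_integral (linepath (1 - a) (1 - b)) f"
proof -
  have e: "1 - linepath a b t = linepath (1 - a) (1 - b) t" for t
    by (simp add: linepath_def scaleR_conv_of_real) (simp add: algebra_simps)
  have "contour_integral (linepath a b) (\<lambda>s. f (1 - s)) = integral {0..1} (\<lambda>t. f (1 - linepath a b t) * (b - a))"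
    by (simp add: contour_integral_integral)
  also have "\<dots> = integral {0..1} (\<lambda>t. - (f (linepath (1 - a) (1 - b) t) * ((1 - b) - (1 - a))))"
    by (simp add: e algebra_simps)
  also have "\<dots> = - integral {0..1} (\<lambda>t. f (linepath (1 - a) (1 - b) t) * ((1 - b) - (1 - a)))"
    by (rule integral_neg)
  also have "\<dots> = - contour_integral (linepath (1 - a) (1 - b)) f"
    by (simp add: contour_integral_integral)
  finally show ?thesis .
qed

lemma closed_segment_vertical:
  assumes "s \<in> closed_segment (Complex c t1) (Complex c t2)"
  shows "Re s = c" and "t1 \<le> t2 \<Longrightarrow> t1 \<le> Im s" and "t1 \<le> t2 \<Longrightarrow> Im s \<le> t2"
proof -
  obtain u where u: "0 \<le> u" "u \<le> 1" "s = (1 - u) *\<^sub>R Complex c t1 + u *\<^sub>R Complex c t2"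
    using assms unfolding in_segment by (elim exE conjE)
  have "Re s = (1 - u) * c + u * c" using u(3) by simp
  then show "Re s = c" by (simp add: algebra_simps)
  have im: "Im s = (1 - u) * t1 + u * t2" using u(3) by simp
  assume "t1 \<le> t2"
  then have "0 \<le> u * (t2 - t1)" "0 \<le> (1 - u) * (t2 - t1)" using u by auto
  then show "t1 \<le> Im s" "Im s \<le> t2" unfolding im by (simp_all add: algebra_simps)
qed

text \<open>Only finitely many n have ln n < \<kappa> + 1; all others are at distance at least 1
  from \<kappa>. The gap bounds the denominators that arise when the oscillating terms of the
  Dirichlet series are integrated.\<close>

lemma ln_nat_gap:
  fixes \<kappa> :: real
  obtains \<delta> where "\<delta> > 0" "\<And>n::nat. n > 0 \<Longrightarrow> real n \<noteq> exp \<kappa> \<Longrightarrow> \<delta> \<le> \<bar>\<kappa> - ln (real n)\<bar>"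
proof -
  define A where "A = insert 1 ((\<lambda>n::nat. \<bar>\<kappa> - ln (real n)\<bar>) ` {n. 0 < n \<and> real n < exp (\<kappa> + 1) \<and> real n \<noteq> exp \<kappa>})"
  have "{n::nat. real n < exp (\<kappa> + 1)} \<subseteq> {..nat \<lceil>exp (\<kappa> + 1)\<rceil>}"
  proof
    fix n :: nat assume "n \<in> {n. real n < exp (\<kappa> + 1)}"
    then have "real n < exp (\<kappa> + 1)" by simp
    from order_less_le_trans[OF this real_nat_ceiling_ge] show "n \<in> {..nat \<lceil>exp (\<kappa> + 1)\<rceil>}" by simp
  qed
  then have "finite {n::nat. real n < exp (\<kappa> + 1)}" by (rule finite_subset) simp
  then have "finite {n::nat. 0 < n \<and> real n < exp (\<kappa> + 1) \<and> real n \<noteq> exp \<kappa>}"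
    by (rule finite_subset[rotated]) blast
  then have fin: "finite A" unfolding A_def by simp
  show ?thesis
  proof (rule that)
    have "a > 0" if "a \<in> A" for a
    proof (cases "a = 1")
      case False
      then have "a \<in> (\<lambda>n::nat. \<bar>\<kappa> - ln (real n)\<bar>) ` {n. 0 < n \<and> real n < exp (\<kappa> + 1) \<and> real n \<noteq> exp \<kappa>}"
        using that by (simp add: A_def)
      then obtain n :: nat where n: "a = \<bar>\<kappa> - ln (real n)\<bar>" "n \<in> {n. 0 < n \<and> real n < exp (\<kappa> + 1) \<and> real n \<noteq> exp \<kappa>}"
        by (rule imageE)
      then have "\<kappa> \<noteq> ln (real n)" by auto
      then show ?thesis using n(1) by simp
    qed auto
    then show "Min A > 0" using fin by (subst Min_gr_iff) (auto simp: A_def)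
    fix n :: nat assume n: "n > 0" "real n \<noteq> exp \<kappa>"
    show "Min A \<le> \<bar>\<kappa> - ln (real n)\<bar>"
    proof (cases "real n < exp (\<kappa> + 1)")
      case True
      then have "\<bar>\<kappa> - ln (real n)\<bar> \<in> A" using n by (auto simp: A_def)
      then show ?thesis using fin by simp
    next
      case False
      then have "ln (exp (\<kappa> + 1)) \<le> ln (real n)" using n by (subst ln_le_cancel_iff) auto
      then have "1 \<le> \<bar>\<kappa> - ln (real n)\<bar>" by simp
      moreover have "Min A \<le> 1" using fin by (intro Min_le) (auto simp: A_def)
      ultimately show ?thesis by linarith
    qed
  qed
qed

text \<open>Links the series over n with the function of a real argument: at most one index equals
  exp \<kappa>, and none does if exp \<kappa> is not a natural number.\<close>

lemma sum_mangoldt_delta: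
  fixes N :: nat
  assumes "exp \<kappa> < real N"
  shows "(\<Sum>n<N. if real n = exp \<kappa> then mangoldt n else 0) = von_mangoldt (exp \<kappa>)"
proof (cases "exp \<kappa> \<in> \<nat>")
  case True
  then obtain m where m: "exp \<kappa> = real m" by (auto elim: Nats_cases)
  have "(\<Sum>n<N. if real n = exp \<kappa> then mangoldt n else 0) = (\<Sum>n<N. if n = m then mangoldt n else (0::real))"
    by (simp add: m)
  also have "\<dots> = mangoldt m" using assms m by simp
  finally show ?thesis using m by (simp add: von_mangoldt_def)
next
  case False
  then have "real n \<noteq> exp \<kappa>" for n by (metis of_nat_in_Nats)
  then show ?thesis using False by (simp add: von_mangoldt_def)
qed

text \<open>A term with frequency \<kappa> - ln n \<noteq> 0 integrates to a difference of two
  boundary values divided by the frequency. Its modulus is at most 2 exp (\<kappa> c) / \<delta>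
  times \<open>mangoldt n\<close> n powr (-c), which is summable and does not depend on the end
  points. The end points are not ordered, so that the bound also applies to the downward segment
  produced by s to 1 - s.\<close>

lemma contour_integral_exp_logderiv_right:
  fixes c \<kappa> :: real
  assumes c: "c > 1"
  obtains C where "\<And>t1 t2. norm (contour_integral (linepath (Complex c t1) (Complex c t2))
      (\<lambda>s. exp (of_real \<kappa> * s) * (deriv zeta s / zeta s))
      + \<i> * of_real ((t2 - t1) * von_mangoldt (exp \<kappa>))) \<le> C"
proof -
  obtain \<delta> where \<delta>: "\<delta> > 0" "\<And>n::nat. n > 0 \<Longrightarrow> real n \<noteq> exp \<kappa> \<Longrightarrow> \<delta> \<le> \<bar>\<kappa> - ln (real n)\<bar>"
    using ln_nat_gap[of \<kappa>] by auto
  define B where "B n = mangoldt n * real n powr (-c)" for n :: nat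
  have sB: "summable B" unfolding B_def using c by (rule summable_mangoldt_powr)
  have B0: "B n \<ge> 0" for n by (simp add: B_def mangoldt_nonneg)
  define C where "C = 2 * exp (\<kappa> * c) / \<delta> * suminf B"
  define u where "u n s = mangoldt n * exp (of_real (\<kappa> - ln (real n)) * s)" for n and s :: complex
  have norm_u: "norm (u n s) = exp (\<kappa> * c) * B n" if "Re s = c" for n s
  proof (cases "n = 0")
    case False
    have "norm (u n s) = mangoldt n * exp ((\<kappa> - ln (real n)) * c)"
      using that by (simp add: u_def norm_mult norm_exp_eq_Re)
    also have "exp ((\<kappa> - ln (real n)) * c) = exp (\<kappa> * c) * exp (- c * ln (real n))"
      unfolding exp_add[symmetric] by (simp add: algebra_simps)
    also have "exp (- c * ln (real n)) = real n powr (-c)" using False by (simp add: powr_def)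
    finally show ?thesis by (simp add: B_def)
  qed (simp add: u_def B_def)
  have cont_u: "continuous_on A (u n)" for A n unfolding u_def by (intro continuous_intros)
  have int_u: "u n contour_integrable_on linepath a b" for n a b
    by (intro contour_integrable_continuous_linepath cont_u)
  have "norm (contour_integral (linepath (Complex c t1) (Complex c t2))
      (\<lambda>s. exp (of_real \<kappa> * s) * (deriv zeta s / zeta s))
      + \<i> * of_real ((t2 - t1) * von_mangoldt (exp \<kappa>))) \<le> C" for t1 t2
  proof -
    define a b where "a = Complex c t1" and "b = Complex c t2"
    have ba: "b - a = \<i> * of_real (t2 - t1)" by (simp add: a_def b_def complex_eq_iff)
    let ?p = "linepath a b"
    let ?f = "\<lambda>s. exp (of_real \<kappa> * s) * (deriv zeta s / zeta s)"
    have Re_p: "Re s = c" if "s \<in> path_image ?p" for s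
      using that closed_segment_vertical(1) by (simp add: a_def b_def)
    have su: "(\<lambda>n. u n s) sums (- ?f s)" if "Re s = c" for s
    proof -
      have "(\<lambda>n. exp (of_real \<kappa> * s) * (mangoldt n * of_nat n powr (-s))) sums (exp (of_real \<kappa> * s) * (- deriv zeta s / zeta s))"
        using that c by (intro sums_mult logderiv_zeta_sums) auto
      moreover have "exp (of_real \<kappa> * s) * (mangoldt n * of_nat n powr (-s)) = u n s" for n
      proof (cases "n = 0")
        case False
        then have "exp (of_real \<kappa> * s) * of_nat n powr (-s) = exp (of_real (\<kappa> - ln (real n)) * s)"
          by (simp add: powr_def Ln_of_nat left_diff_distrib exp_diff exp_minus field_simps)
        then show ?thesis by (simp add: u_def mult_ac)
      qed (simp add: u_def)
      ultimately show ?thesis by simp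
    qed
    \<comment> \<open>On the vertical line the moduli of the terms do not depend on Im s, so the
      M-test gives uniform convergence and integration may be done term by term.\<close>
    have ul: "uniform_limit (path_image ?p) (\<lambda>N s. \<Sum>n<N. u n s) (\<lambda>s. - ?f s) sequentially"
    proof -
      have "uniform_limit (path_image ?p) (\<lambda>N s. \<Sum>n<N. u n s) (\<lambda>s. \<Sum>n. u n s) sequentially"
        using norm_u[OF Re_p] by (intro Weierstrass_m_test[OF _ summable_mult[OF sB, of "exp (\<kappa> * c)"]]) simp
      moreover have "(\<Sum>n. u n s) = - ?f s" if "s \<in> path_image ?p" for s
        using su[OF Re_p[OF that]] by (simp add: sums_iff)
      ultimately show ?thesis by (subst (asm) uniform_limit_cong'[where g = "\<lambda>N s. \<Sum>n<N. u n s" and i = "\<lambda>s. - ?f s"]) auto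
    qed
    have lim: "(\<lambda>N. contour_integral ?p (\<lambda>s. \<Sum>n<N. u n s)) \<longlonglongrightarrow> contour_integral ?p (\<lambda>s. - ?f s)"
    proof (rule contour_integral_uniform_limit(2)[OF _ ul])
      show "\<forall>\<^sub>F N in sequentially. (\<lambda>s. \<Sum>n<N. u n s) contour_integrable_on ?p"
        by (intro always_eventually allI contour_integrable_sum int_u) auto
      show "norm (vector_derivative ?p (at t)) \<le> norm (b - a)" for t by simp
    qed auto
    have cu: "contour_integral ?p (u n) = (if real n = exp \<kappa> then mangoldt n else 0) * (b - a) + R"
      if R: "R = (if real n = exp \<kappa> then 0 else contour_integral ?p (u n))" for n R
    proof (cases "real n = exp \<kappa>")
      case True
      then have "u n = (\<lambda>s. mangoldt n)" by (simp add: u_def fun_eq_iff ln_exp)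
      then show ?thesis using R True by simp
    qed (use R in simp)
    define R where "R n = (if real n = exp \<kappa> then 0 else contour_integral ?p (u n))" for n
    have R: "norm (R n) \<le> 2 * exp (\<kappa> * c) / \<delta> * B n" for n
    proof (cases "real n = exp \<kappa> \<or> n = 0")
      case True
      moreover have "u 0 = (\<lambda>_. 0)" by (simp add: u_def fun_eq_iff)
      ultimately have "R n = 0" by (auto simp: R_def)
      then show ?thesis using \<delta>(1) B0[of n] by simp
    next
      case False
      define \<mu> where "\<mu> = \<kappa> - ln (real n)"
      have \<mu>: "\<bar>\<mu>\<bar> \<ge> \<delta>" using \<delta>(2)[of n] False by (simp add: \<mu>_def)
      then have \<mu>0: "\<mu> \<noteq> 0" using \<delta>(1) by auto
      have "(u n has_contour_integral (u n (pathfinish ?p) / of_real \<mu> - u n (pathstart ?p) / of_real \<mu>)) ?p"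
      proof (rule contour_integral_primitive)
        show "((\<lambda>s. u n s / of_real \<mu>) has_field_derivative u n s) (at s within UNIV)" for s
          unfolding u_def \<mu>_def[symmetric] using \<mu>0 by (auto intro!: derivative_eq_intros)
      qed auto
      then have "R n = (u n b - u n a) / of_real \<mu>"
        using False by (simp add: R_def contour_integral_unique diff_divide_distrib)
      then have "norm (R n) = norm (u n b - u n a) / \<bar>\<mu>\<bar>" by (simp add: norm_divide)
      also have "\<dots> \<le> (exp (\<kappa> * c) * B n + exp (\<kappa> * c) * B n) / \<delta>"
        using \<mu> \<delta>(1) norm_triangle_ineq4[of "u n b" "u n a"] norm_u[of b n] norm_u[of a n]
        by (intro frac_le) (auto simp: a_def b_def B0)
      finally show ?thesis by (simp add: field_simps)
    qed
    have "norm (contour_integral ?p (\<lambda>s. - ?f s) - of_real (von_mangoldt (exp \<kappa>)) * (b - a)) \<le> C"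
    proof (rule Lim_norm_ubound[of sequentially])
      show "(\<lambda>N. contour_integral ?p (\<lambda>s. \<Sum>n<N. u n s) - of_real (von_mangoldt (exp \<kappa>)) * (b - a))
         \<longlonglongrightarrow> contour_integral ?p (\<lambda>s. - ?f s) - of_real (von_mangoldt (exp \<kappa>)) * (b - a)"
        by (intro tendsto_intros lim)
      have "\<forall>\<^sub>F N in sequentially. exp \<kappa> < real N"
        using filterlim_real_sequentially by (rule filterlim_at_top_dense[THEN iffD1, rule_format])
      then show "\<forall>\<^sub>F N in sequentially. norm (contour_integral ?p (\<lambda>s. \<Sum>n<N. u n s) - of_real (von_mangoldt (exp \<kappa>)) * (b - a)) \<le> C"
      proof eventually_elim
        case (elim N)
        have "contour_integral ?p (\<lambda>s. \<Sum>n<N. u n s) = (\<Sum>n<N. contour_integral ?p (u n))"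
          by (intro contour_integral_sum int_u) auto
        also have "\<dots> = (\<Sum>n<N. (if real n = exp \<kappa> then mangoldt n else 0) * (b - a) + R n)"
          by (intro sum.cong refl cu) (simp add: R_def)
        also have "\<dots> = of_real (\<Sum>n<N. if real n = exp \<kappa> then mangoldt n else 0) * (b - a) + (\<Sum>n<N. R n)"
          by (simp add: sum.distrib if_distrib[of complex_of_real] flip: sum_distrib_right cong: if_cong)
        also have "(\<Sum>n<N. if real n = exp \<kappa> then mangoldt n else 0) = von_mangoldt (exp \<kappa>)"
          by (rule sum_mangoldt_delta[OF elim])
        finally have "norm (contour_integral ?p (\<lambda>s. \<Sum>n<N. u n s) - of_real (von_mangoldt (exp \<kappa>)) * (b - a)) = norm (\<Sum>n<N. R n)"
          by simp
        also have "\<dots> \<le> (\<Sum>n<N. 2 * exp (\<kappa> * c) / \<delta> * B n)" by (intro sum_norm_le R)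
        also have "\<dots> = 2 * exp (\<kappa> * c) / \<delta> * (\<Sum>n<N. B n)" by (simp add: sum_distrib_left)
        also have "\<dots> \<le> C" unfolding C_def using \<delta>(1) B0 sB
          by (intro mult_left_mono sum_le_suminf) auto
        finally show ?case .
      qed
    qed auto
    moreover have "contour_integral ?p (\<lambda>s. - ?f s) - of_real (von_mangoldt (exp \<kappa>)) * (b - a)
       = - (contour_integral ?p ?f + \<i> * of_real ((t2 - t1) * von_mangoldt (exp \<kappa>)))"
      unfolding ba by (simp add: contour_integral_neg algebra_simps)
    ultimately show ?thesis unfolding a_def b_def by (simp only: norm_minus_cancel)
  qed
  then show ?thesis using that by blast
qed

lemma von_mangoldt_le_1: "x \<le> 1 \<Longrightarrow> von_mangoldt x = 0"
proof (cases "x \<in> \<nat>")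
  case True
  assume "x \<le> 1"
  then show ?thesis using True by (auto elim!: Nats_cases simp: von_mangoldt_def le_Suc_eq)
qed (simp add: von_mangoldt_def)

text \<open>With z = 1 - s, exp (\<kappa> s) becomes exp \<kappa> times exp (- \<kappa> z). The only
  possible resonance is now at exp (- \<kappa>) \<le> 1, where the von Mangoldt function vanishes,
  so there is no main term.\<close>

lemma contour_integral_exp_logderiv_reflected:
  fixes c \<kappa> :: real
  assumes c: "c > 1" and \<kappa>: "\<kappa> \<ge> 0"
  obtains C where "\<And>t1 t2. norm (contour_integral (linepath (Complex (1 - c) t1) (Complex (1 - c) t2))
      (\<lambda>s. exp (of_real \<kappa> * s) * (deriv zeta (1 - s) / zeta (1 - s)))) \<le> C"
proof -
  obtain C where C: "\<And>t1 t2. norm (contour_integral (linepath (Complex c t1) (Complex c t2))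
      (\<lambda>s. exp (of_real (-\<kappa>) * s) * (deriv zeta s / zeta s))
      + \<i> * of_real ((t2 - t1) * von_mangoldt (exp (-\<kappa>)))) \<le> C"
    using contour_integral_exp_logderiv_right[OF c] by blast
  have v: "von_mangoldt (exp (-\<kappa>)) = 0" using \<kappa> by (intro von_mangoldt_le_1) simp
  have "norm (contour_integral (linepath (Complex (1 - c) t1) (Complex (1 - c) t2))
      (\<lambda>s. exp (of_real \<kappa> * s) * (deriv zeta (1 - s) / zeta (1 - s)))) \<le> exp \<kappa> * C" for t1 t2
  proof -
    let ?F = "\<lambda>z. exp (of_real (-\<kappa>) * z) * (deriv zeta z / zeta z)"
    have e: "exp (of_real \<kappa> * s) * (deriv zeta (1 - s) / zeta (1 - s)) = exp (of_real \<kappa>) * ?F (1 - s)" for s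
    proof -
      have "exp (of_real \<kappa> * s) = exp (of_real \<kappa>) * exp (of_real (-\<kappa>) * (1 - s))"
        unfolding exp_add[symmetric] by (simp add: algebra_simps)
      then show ?thesis by simp
    qed
    have l: "1 - Complex (1 - c) t = Complex c (-t)" for t by (simp add: complex_eq_iff)
    have "contour_integral (linepath (Complex (1 - c) t1) (Complex (1 - c) t2))
      (\<lambda>s. exp (of_real \<kappa> * s) * (deriv zeta (1 - s) / zeta (1 - s)))
      = - contour_integral (linepath (Complex c (-t1)) (Complex c (-t2))) (\<lambda>z. exp (of_real \<kappa>) * ?F z)"
      unfolding e using contour_integral_linepath_reflect[of "Complex (1 - c) t1" "Complex (1 - c) t2" "\<lambda>z. exp (of_real \<kappa>) * ?F z"]
      by (simp only: l)
    also have "contour_integral (linepath (Complex c (-t1)) (Complex c (-t2))) (\<lambda>z. exp (of_real \<kappa>) * ?F z)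
      = exp (of_real \<kappa>) * contour_integral (linepath (Complex c (-t1)) (Complex c (-t2))) ?F"
      by (simp only: contour_integral_integral mult.assoc integral_mult_right)
    finally show ?thesis using C[of "-t1" "-t2"] by (simp add: v norm_mult)
  qed
  then show ?thesis using that by blast
qed

section \<open>The left side of the rectangle\<close>

text \<open>Mean value bound for Ln (w + v) - v / w with v between 0 and 1; its derivative is - v /
  (w (w + v)), and adding v does not decrease the modulus in the right half plane. These are the
  errors summed in the digamma estimate.\<close>

lemma norm_Ln_add_1_diff_le:
  fixes w :: complex
  assumes w: "Re w > 0"
  shows "norm (Ln (w + 1) - Ln w - inverse w) \<le> 1 / (norm w)\<^sup>2"
proof -
  let ?S = "closed_segment (0::complex) 1"
  define q where "q v = Ln (w + v) - v / w" for v
  have w0: "w \<noteq> 0" using w by auto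
  have seg: "\<exists>u. v = of_real u \<and> 0 \<le> u \<and> u \<le> 1" if "v \<in> ?S" for v
    using that by (auto simp: in_segment scaleR_conv_of_real)
  have "norm (q 1 - q 0) \<le> (1 / (norm w)\<^sup>2) * norm (1 - 0 :: complex)"
  proof (rule field_differentiable_bound[of ?S])
    fix v assume "v \<in> ?S"
    then obtain u where u: "v = of_real u" "0 \<le> u" "u \<le> 1" using seg by auto
    have R: "Re (w + v) > 0" using w u by simp
    then have nz: "w + v \<noteq> 0" "w + v \<notin> \<real>\<^sub>\<le>\<^sub>0" by (auto simp: complex_nonpos_Reals_iff simp del: plus_complex.sel)
    show "(q has_field_derivative (1 / (w + v) - 1 / w)) (at v within ?S)"
      unfolding q_def using nz w0 by (auto intro!: derivative_eq_intros simp: divide_inverse)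
    have "1 / (w + v) - 1 / w = - v / (w * (w + v))" using nz w0 by (simp add: field_simps)
    then have "norm (1 / (w + v) - 1 / w) = norm v / (norm w * norm (w + v))"
      by (simp add: norm_divide norm_mult)
    also have "norm (w + v) \<ge> norm w"
      unfolding cmod_def using u w by (intro real_sqrt_le_mono add_right_mono power_mono) auto
    then have "norm v / (norm w * norm (w + v)) \<le> 1 / (norm w * norm w)"
      using u w0 by (intro frac_le mult_left_mono) auto
    finally show "norm (1 / (w + v) - 1 / w) \<le> 1 / (norm w)\<^sup>2" by (simp add: power2_eq_square)
  qed auto
  then show ?thesis by (simp add: q_def divide_inverse algebra_simps)
qed

text \<open>Comparison with the integral of 1 / (x^2 + t^2), whose primitive arctan (x / t) / t
  stays below pi / (2 t).\<close>

lemma sum_inverse_squares_le: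
  fixes t :: real
  assumes t: "t > 0"
  shows "(\<Sum>n<m. 1 / ((real n + 1)\<^sup>2 + t\<^sup>2)) \<le> 2 / t"
proof -
  have step: "1 / ((real n + 1)\<^sup>2 + t\<^sup>2) \<le> arctan (real (Suc n) / t) / t - arctan (real n / t) / t" for n
  proof -
    have d: "((\<lambda>x. arctan (x / t) / t) has_real_derivative 1 / (x\<^sup>2 + t\<^sup>2)) (at x)" for x
    proof -
      have "((\<lambda>x. arctan (x / t) / t) has_real_derivative inverse (1 + (x / t)\<^sup>2) * (1 / t) / t) (at x)"
        using t by (auto intro!: derivative_eq_intros)
      moreover have "1 + (x / t)\<^sup>2 = (x\<^sup>2 + t\<^sup>2) / t\<^sup>2" using t by (simp add: field_simps)
      ultimately show ?thesis using t by (simp add: power2_eq_square)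
    qed
    obtain z where z: "real n < z" "z < real (Suc n)"
      "arctan (real (Suc n) / t) / t - arctan (real n / t) / t = (real (Suc n) - real n) * (1 / (z\<^sup>2 + t\<^sup>2))"
      using MVT2[of "real n" "real (Suc n)" "\<lambda>x. arctan (x / t) / t" "\<lambda>x. 1 / (x\<^sup>2 + t\<^sup>2)"] d by auto
    have "1 / ((real n + 1)\<^sup>2 + t\<^sup>2) \<le> 1 / (z\<^sup>2 + t\<^sup>2)"
      using z t by (intro divide_left_mono add_right_mono power_mono mult_pos_pos add_nonneg_pos) auto
    then show ?thesis using z(3) by simp
  qed
  have "(\<Sum>n<m. 1 / ((real n + 1)\<^sup>2 + t\<^sup>2)) \<le> (\<Sum>n<m. arctan (real (Suc n) / t) / t - arctan (real n / t) / t)"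
    by (intro sum_mono step)
  also have "\<dots> = arctan (real m / t) / t" by (subst sum_lessThan_telescope) simp
  also have "arctan (real m / t) \<le> 2" using arctan_ubound[of "real m / t"] pi_less_4 by linarith
  then have "arctan (real m / t) / t \<le> 2 / t" using t by (intro divide_right_mono) auto
  finally show ?thesis .
qed

text \<open>Write Ln (m + z) - Ln z as a telescoping sum and subtract the reciprocals in the limit
  formula for \<open>Digamma\<close>; each remaining term is at most 1 / |z + n|^2. Because Re z
  \<ge> 1, these squares are at least (n + 1)^2 + (Im z)^2.\<close>

lemma norm_Digamma_minus_Ln_le:
  fixes z :: complex
  assumes z: "Re z \<ge> 1" "Im z \<noteq> 0"
  shows "norm (Digamma z - Ln z) \<le> 2 / \<bar>Im z\<bar>"
proof -
  have z0: "z \<noteq> 0" using z by auto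
  have L: "(\<lambda>m. of_real (ln (real m)) - (\<Sum>n<m. inverse (z + of_nat n))) \<longlonglongrightarrow> Digamma z"
    by (rule Digamma_LIMSEQ[OF z0])
  \<comment> \<open>The limit formula is normalised by ln m, the telescoping sum by Ln (m + z). By
    the mean value theorem the two differ by at most |z| / m.\<close>
  have "(\<lambda>m. Ln (of_nat m + z) - of_real (ln (real m))) \<longlonglongrightarrow> 0"
  proof (rule Lim_null_comparison)
    show "(\<lambda>m. norm z / real m) \<longlonglongrightarrow> 0" by real_asymp
    show "\<forall>\<^sub>F m in sequentially. norm (Ln (of_nat m + z) - of_real (ln (real m))) \<le> norm z / real m"
      using eventually_gt_at_top[of 0]
    proof eventually_elim
      case (elim m)
      have R: "Re w \<ge> real m" if w: "w \<in> closed_segment (of_nat m) (of_nat m + z)" for w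
      proof -
        obtain u where u: "0 \<le> u" "u \<le> 1" "w = (1 - u) *\<^sub>R of_nat m + u *\<^sub>R (of_nat m + z)"
          using w unfolding in_segment by (elim exE conjE)
        then have "Re w = real m + u * Re z" by (simp add: algebra_simps)
        then show ?thesis using u z by simp
      qed
      have "norm (Ln (of_nat m + z) - Ln (of_nat m)) \<le> (1 / real m) * norm (of_nat m + z - of_nat m)"
      proof (rule field_differentiable_bound[where S = "closed_segment (of_nat m) (of_nat m + z)" and f = Ln and f' = inverse])
        fix w assume "w \<in> closed_segment (of_nat m) (of_nat m + z)"
        then have w: "Re w \<ge> real m" by (rule R)
        have "real m > 0" using elim by simp
        then have "Re w > 0" using w by (rule order_less_le_trans)
        then have nz: "w \<noteq> 0" "w \<notin> \<real>\<^sub>\<le>\<^sub>0"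
          using complex_nonpos_Reals_iff[of w] by force+
        show "(Ln has_field_derivative inverse w) (at w within closed_segment (of_nat m) (of_nat m + z))"
          using nz(2) by (rule has_field_derivative_at_within[OF has_field_derivative_Ln])
        have "real m \<le> norm w" using w complex_Re_le_cmod by (rule order_trans)
        then have "inverse (norm w) \<le> inverse (real m)" using \<open>real m > 0\<close> by (rule le_imp_inverse_le)
        then show "norm (inverse w) \<le> 1 / real m" by (simp add: norm_inverse divide_inverse)
      qed auto
      then show ?case using elim by (simp add: Ln_of_nat)
    qed
  qed
  from tendsto_diff[OF L tendsto_const, of "Ln z"] this
  have "(\<lambda>m. (of_real (ln (real m)) - (\<Sum>n<m. inverse (z + of_nat n))) - Ln z + (Ln (of_nat m + z) - of_real (ln (real m))))
     \<longlonglongrightarrow> Digamma z - Ln z + 0" by (rule tendsto_add)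
  then have L2: "(\<lambda>m. Ln (of_nat m + z) - Ln z - (\<Sum>n<m. inverse (z + of_nat n))) \<longlonglongrightarrow> Digamma z - Ln z"
    by (simp add: algebra_simps)
  show ?thesis
  proof (rule Lim_norm_ubound[OF _ L2])
    have "norm (Ln (of_nat m + z) - Ln z - (\<Sum>n<m. inverse (z + of_nat n))) \<le> 2 / \<bar>Im z\<bar>" for m
    proof -
      have "Ln (of_nat m + z) - Ln z = (\<Sum>n<m. Ln (z + of_nat (Suc n)) - Ln (z + of_nat n))"
        by (subst sum_lessThan_telescope) (simp add: add.commute)
      then have "Ln (of_nat m + z) - Ln z - (\<Sum>n<m. inverse (z + of_nat n))
         = (\<Sum>n<m. Ln (z + of_nat n + 1) - Ln (z + of_nat n) - inverse (z + of_nat n))"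
        by (simp add: sum_subtractf add_ac)
      also have "norm \<dots> \<le> (\<Sum>n<m. 1 / ((real n + 1)\<^sup>2 + \<bar>Im z\<bar>\<^sup>2))"
      proof (rule sum_norm_le)
        fix n
        have "norm (Ln (z + of_nat n + 1) - Ln (z + of_nat n) - inverse (z + of_nat n)) \<le> 1 / (norm (z + of_nat n))\<^sup>2"
          using z by (intro norm_Ln_add_1_diff_le) simp
        also have "(norm (z + of_nat n))\<^sup>2 = (Re z + real n)\<^sup>2 + \<bar>Im z\<bar>\<^sup>2" by (simp add: cmod_power2)
        also have "1 / \<dots> \<le> 1 / ((real n + 1)\<^sup>2 + \<bar>Im z\<bar>\<^sup>2)"
          using z by (intro divide_left_mono add_right_mono power_mono mult_pos_pos add_nonneg_pos) auto
        finally show "norm (Ln (z + of_nat n + 1) - Ln (z + of_nat n) - inverse (z + of_nat n)) \<le> 1 / ((real n + 1)\<^sup>2 + \<bar>Im z\<bar>\<^sup>2)" .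
      qed
      also have "\<dots> \<le> 2 / \<bar>Im z\<bar>" using z by (intro sum_inverse_squares_le) auto
      finally show ?thesis .
    qed
    then show "\<forall>\<^sub>F m in sequentially. norm (Ln (of_nat m + z) - Ln z - (\<Sum>n<m. inverse (z + of_nat n))) \<le> 2 / \<bar>Im z\<bar>"
      by (intro always_eventually allI)
  qed auto
qed

text \<open>From tan w + \<i> = \<i> exp (- \<i> w) / cos w: far down in the lower half plane tan is
  close to - \<i>. The decay is in fact exponential, but an error of order 1 / |Im w| integrates to
  a logarithm and so stays within the error term.\<close>

lemma norm_tan_plus_ii_le:
  fixes w :: complex
  assumes "Im w < 0"
  shows "norm (tan w + \<i>) \<le> 2 / (- Im w)"
proof -
  define y where "y = - Im w"
  have y: "y > 0" using assms by (simp add: y_def)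
  have e: "norm (exp (\<i> * w)) = exp y" "norm (exp (- (\<i> * w))) = exp (-y)"
    by (simp_all add: y_def norm_exp_eq_Re)
  have c2: "2 * norm (cos w) = norm (exp (\<i> * w) + exp (- (\<i> * w)))"
    by (simp add: cos_exp_eq norm_divide)
  have "exp y - exp (-y) \<le> 2 * norm (cos w)"
    unfolding c2 using norm_diff_ineq[of "exp (\<i> * w)" "exp (- (\<i> * w))"] by (simp only: e)
  moreover have "exp y \<ge> 1 + y" "exp (-y) \<le> 1" using exp_ge_add_one_self[of y] y by auto
  ultimately have cy: "norm (cos w) \<ge> y / 2" by linarith
  then have c0: "cos w \<noteq> 0" using y by auto
  have "tan w + \<i> = (sin w + \<i> * cos w) / cos w" using c0 by (simp add: tan_def field_simps)
  also have "sin w + \<i> * cos w = \<i> * exp (- (\<i> * w))"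
    by (simp add: sin_exp_eq cos_exp_eq field_simps)
  finally have "norm (tan w + \<i>) = exp (-y) / norm (cos w)" by (simp add: norm_divide norm_mult y_def)
  also have "\<dots> \<le> 1 / (y / 2)" using cy y by (intro frac_le) auto
  finally show ?thesis by (simp add: y_def)
qed

text \<open>Logarithmic derivative of \<open>zeta_reflection\<close> at z = 1 - s. There 1 < Re z <
  2, so zeta z and Gamma z do not vanish, and Im z \<noteq> 0 keeps the cosine away from 0.\<close>

lemma zeta_logderiv_reflection:
  assumes s: "-1 < Re s" "Re s < 0" "Im s \<noteq> 0"
  shows "deriv zeta s / zeta s = of_real (ln (2 * pi)) + of_real (pi / 2) * tan (of_real pi * (1 - s) / 2)
     - Digamma (1 - s) - deriv zeta (1 - s) / zeta (1 - s)"
proof -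
  define z where "z = 1 - s"
  have z: "1 < Re z" "Re z < 2" "Im z \<noteq> 0" "z \<noteq> 1" using s by (auto simp: z_def)
  have nz: "zeta z \<noteq> 0" "Gamma z \<noteq> 0" "cos (of_real pi * z / 2) \<noteq> 0" "z \<notin> \<int>\<^sub>\<le>\<^sub>0"
    using zeta_nonzero_Re_gt_1 cos_nonzero_complex Re_pos_imp_not_nonpos_Int[of z] z
    by (auto simp: Gamma_eq_zero_iff)
  define X where "X w = 2 * (2 * of_real pi) powr (-w) * cos (of_real pi * w / 2) * Gamma w" for w :: complex
  have X0: "X z \<noteq> 0" using nz by (simp add: X_def)
  have dX: "(X has_field_derivative X z * (Digamma z - of_real (ln (2 * pi)) - of_real (pi / 2) * tan (of_real pi * z / 2))) (at z)"
  proof -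
    have p: "((\<lambda>w. (2 * of_real pi) powr (-w)) has_field_derivative (of_real (ln (2 * pi)) * (2 * of_real pi) powr (-z)) * (-1)) (at z)"
      using Ln_of_real[of "2 * pi"]
      by (intro DERIV_chain2[OF has_field_derivative_powr_right[THEN DERIV_cong]]) (auto intro!: derivative_eq_intros)
    have c: "((\<lambda>w. cos (of_real pi * w / 2)) has_field_derivative - sin (of_real pi * z / 2) * (of_real pi / 2)) (at z)"
      by (auto intro!: derivative_eq_intros)
    have g: "(Gamma has_field_derivative Gamma z * Digamma z) (at z)"
      using nz(4) by (rule has_field_derivative_Gamma)
    show ?thesis unfolding X_def
      by (rule DERIV_cong[OF DERIV_mult[OF DERIV_mult[OF DERIV_cmult[OF p] c] g]])
         (use nz(3) in \<open>simp add: tan_def field_simps\<close>)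
  qed
  have dz: "(zeta has_field_derivative deriv zeta z) (at z)" using z by (intro zeta_has_field_derivative) auto
  have sz: "s = 1 - z" by (simp add: z_def)
  have ds: "(zeta has_field_derivative deriv zeta s) (at (1 - z))" unfolding sz[symmetric]
    using s by (intro zeta_has_field_derivative) auto
  have "((\<lambda>w. zeta (1 - w)) has_field_derivative deriv zeta s * (-1)) (at z)"
    by (rule DERIV_chain2[where f = zeta and g = "\<lambda>w. 1 - w", OF ds]) (auto intro!: derivative_eq_intros)
  moreover have "((\<lambda>w. zeta (1 - w)) has_field_derivative
      X z * (Digamma z - of_real (ln (2 * pi)) - of_real (pi / 2) * tan (of_real pi * z / 2)) * zeta z + deriv zeta z * X z) (at z)"
  proof (rule has_field_derivative_transform_within_open[OF DERIV_mult[OF dX dz]])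
    show "open ({w. Re w > 1} \<inter> {w. Re w < 2})" by (intro open_Int open_halfspace_Re_gt open_halfspace_Re_lt)
    show "X w * zeta w = zeta (1 - w)" if "w \<in> {w. Re w > 1} \<inter> {w. Re w < 2}" for w
    proof -
      have "w \<noteq> 1" using that by auto
      then show ?thesis using zeta_reflection[of w] that by (simp add: X_def)
    qed
  qed (use z in auto)
  ultimately have d: "deriv zeta s * (-1) =
      X z * (Digamma z - of_real (ln (2 * pi)) - of_real (pi / 2) * tan (of_real pi * z / 2)) * zeta z + deriv zeta z * X z"
    by (rule DERIV_unique)
  have zs: "zeta s = X z * zeta z" unfolding sz using zeta_reflection[of z] z by (simp add: X_def)
  define q where "q = Digamma z - of_real (ln (2 * pi)) - of_real (pi / 2) * tan (of_real pi * z / 2)"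
  have "deriv zeta s = - (deriv zeta s * (-1))" by simp
  also have "\<dots> = - (X z * q * zeta z + deriv zeta z * X z)" unfolding d q_def ..
  finally have "deriv zeta s / zeta s = - (X z * q * zeta z + deriv zeta z * X z) / (X z * zeta z)"
    unfolding zs by (rule arg_cong)
  also have "\<dots> = - q - deriv zeta z / zeta z"
    using X0 nz(1) by (simp add: field_simps)
  finally have "deriv zeta s / zeta s = - q - deriv zeta z / zeta z" .
  then show ?thesis by (simp add: z_def q_def)
qed

text \<open>Since \<open>1 - s\<close> lies in the fourth quadrant for \<open>s\<close> on the left side, this is \<open>- ln (i (1 - s) / (2 pi))\<close>.\<close>
definition refl_main :: "complex \<Rightarrow> complex" where
  "refl_main s = of_real (ln (2 * pi)) - \<i> * of_real (pi / 2) - Ln (1 - s)"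

text \<open>Since 1 - s lies in the lower half plane, tan may be replaced by - \<i>, and Digamma may
  be replaced by Ln. Each replacement costs 2 / Im s.\<close>

lemma norm_zeta_logderiv_reflection_le:
  assumes s: "-1 < Re s" "Re s < 0" "Im s > 0"
  shows "norm (deriv zeta s / zeta s + deriv zeta (1 - s) / zeta (1 - s) - refl_main s) \<le> 4 / Im s"
proof -
  define T where "T = of_real (pi / 2) * (tan (of_real pi * (1 - s) / 2) + \<i>)"
  have "deriv zeta s / zeta s + deriv zeta (1 - s) / zeta (1 - s) - refl_main s = T - (Digamma (1 - s) - Ln (1 - s))"
    using s by (subst zeta_logderiv_reflection) (auto simp: refl_main_def T_def algebra_simps)
  also have "norm \<dots> \<le> norm T + norm (Digamma (1 - s) - Ln (1 - s))" by (rule norm_triangle_ineq4)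
  also have "norm (Digamma (1 - s) - Ln (1 - s)) \<le> 2 / Im s"
    using norm_Digamma_minus_Ln_le[of "1 - s"] s by simp
  also have "norm T \<le> 2 / Im s"
  proof -
    have "norm (tan (of_real pi * (1 - s) / 2) + \<i>) \<le> 2 / (- Im (of_real pi * (1 - s) / 2))"
      using s by (intro norm_tan_plus_ii_le) simp
    also have "\<dots> = 4 / (pi * Im s)" by simp
    finally have "pi / 2 * norm (tan (of_real pi * (1 - s) / 2) + \<i>) \<le> pi / 2 * (4 / (pi * Im s))"
      by (intro mult_left_mono) auto
    then show ?thesis by (simp add: T_def norm_mult)
  qed
  finally show ?thesis by (simp add: field_simps)
qed

text \<open>It is this bound that makes errors of order 1 / Im s harmless on the left side: they
  cost a logarithm of the height and no more.\<close>

lemma norm_vertical_integral_le: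
  assumes f: "continuous_on (closed_segment (Complex c t1) (Complex c t2)) f"
    and t: "0 < t1" "t1 \<le> t2"
    and K: "\<And>s. s \<in> closed_segment (Complex c t1) (Complex c t2) \<Longrightarrow> norm (f s) \<le> K / Im s"
  shows "norm (contour_integral (linepath (Complex c t1) (Complex c t2)) f) \<le> K * (ln t2 - ln t1)"
proof -
  define a b where "a = Complex c t1" and "b = Complex c t2"
  define d where "d = t2 - t1"
  have d: "d \<ge> 0" using t by (simp add: d_def)
  have ba: "norm (b - a) = d" using d by (simp add: a_def b_def d_def cmod_def)
  have im: "Im (linepath a b x) = t1 + x * d" for x
    by (simp add: a_def b_def d_def linepath_def algebra_simps)
  have inseg: "linepath a b x \<in> closed_segment a b" if "x \<in> {0..1}" for x
    using that by (simp add: linepath_in_path)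
  have "contour_integral (linepath a b) f = integral {0..1} (\<lambda>x. f (linepath a b x) * (b - a))"
    by (simp add: contour_integral_integral)
  also have "norm \<dots> \<le> integral {0..1} (\<lambda>x. K * d / (t1 + x * d))"
  proof (rule integral_norm_bound_integral)
    show "(\<lambda>x. f (linepath a b x) * (b - a)) integrable_on {0..1}"
      by (intro integrable_continuous_real continuous_intros continuous_on_compose2[OF f[folded a_def b_def]])
         (use inseg in auto)
    show "(\<lambda>x. K * d / (t1 + x * d)) integrable_on {0..1}"
      using t d by (intro integrable_continuous_real continuous_intros ballI) (auto intro!: add_pos_nonneg simp: add_nonneg_eq_0_iff)
    fix x :: real assume x: "x \<in> {0..1}"
    have "norm (f (linepath a b x) * (b - a)) = norm (f (linepath a b x)) * d" by (simp add: norm_mult ba)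
    also have "\<dots> \<le> K / (t1 + x * d) * d"
      using K[of "linepath a b x"] inseg[OF x] d by (intro mult_right_mono) (auto simp: im a_def[symmetric] b_def[symmetric])
    finally show "norm (f (linepath a b x) * (b - a)) \<le> K * d / (t1 + x * d)" by simp
  qed
  also have "((\<lambda>x. K * d / (t1 + x * d)) has_integral (K * ln (t1 + 1 * d) - K * ln (t1 + 0 * d))) {0..1}"
  proof (rule fundamental_theorem_of_calculus)
    fix x :: real assume "x \<in> {0..1}"
    then have "t1 + x * d > 0" using t d by (intro add_pos_nonneg) auto
    then show "((\<lambda>x. K * ln (t1 + x * d)) has_vector_derivative K * d / (t1 + x * d)) (at x within {0..1})"
      unfolding has_real_derivative_iff_has_vector_derivative[symmetric]
      by (auto intro!: derivative_eq_intros)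
  qed simp
  then have "integral {0..1} (\<lambda>x. K * d / (t1 + x * d)) = K * (ln t2 - ln t1)"
    by (simp add: integral_unique d_def algebra_simps)
  finally show ?thesis by (simp add: a_def b_def)
qed

text \<open>The constant is generous: ln (2 T) \<le> 2 ln T, and pi \<le> 4 \<le> 6 ln T because ln
  T \<ge> 2/3.\<close>

lemma norm_Ln_le_9_ln:
  assumes T: "T \<ge> 2" and z: "0 \<le> Re z" "Re z \<le> 2" "Im z = - T"
  shows "norm (Ln z) \<le> 9 * ln T"
proof -
  have z0: "z \<noteq> 0" using z T by auto
  have "norm z \<ge> T" using abs_Im_le_cmod[of z] z T by simp
  moreover have "norm z \<le> \<bar>Re z\<bar> + \<bar>Im z\<bar>" by (rule cmod_le)
  then have "norm z \<le> 2 * T" using z T by simp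
  ultimately have n: "1 \<le> norm z" "norm z \<le> 2 * T" using T by auto
  have "norm (Ln z) \<le> \<bar>Re (Ln z)\<bar> + \<bar>Im (Ln z)\<bar>" by (rule cmod_le)
  also have "Re (Ln z) = ln (norm z)" using z0 by simp
  also have "\<bar>ln (norm z)\<bar> = ln (norm z)" using n(1) by simp
  also have "ln (norm z) \<le> ln (2 * T)" using n by (subst ln_le_cancel_iff) auto
  also have "ln (2 * T) = ln 2 + ln T" using T by (simp add: ln_mult)
  also have "\<bar>Im (Ln z)\<bar> \<le> pi" using mpi_less_Im_Ln[OF z0] Im_Ln_le_pi[OF z0] by (simp add: abs_le_iff)
  finally have "norm (Ln z) \<le> ln 2 + ln T + pi" by simp
  moreover have "ln 2 \<le> ln T" using T by (subst ln_le_cancel_iff) auto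
  moreover have "pi \<le> 4" using pi_less_4 by simp
  moreover have "ln (2::real) \<ge> 2 / 3" by (rule ln2_ge_two_thirds)
  ultimately show ?thesis by linarith
qed

lemma ln_ge_two_thirds: "T \<ge> 2 \<Longrightarrow> ln T \<ge> 2 / (3::real)"
  using ln2_ge_two_thirds ln_le_cancel_iff[of 2 T] by linarith

text \<open>15 = 3 + 3 + 9, from ln (2 pi) \<le> 3 ln 2, from pi / 2 \<le> 2 \<le> 3 ln T, and from
  the bound for Ln.\<close>

lemma norm_refl_main_le:
  assumes T: "T \<ge> 2" and \<sigma>: "-1 < \<sigma>" "\<sigma> < 0"
  shows "norm (refl_main (Complex \<sigma> T)) \<le> 15 * ln T"
proof -
  have "norm (refl_main (Complex \<sigma> T)) \<le> norm (complex_of_real (ln (2 * pi)) - \<i> * of_real (pi / 2)) + norm (Ln (1 - Complex \<sigma> T))"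
    unfolding refl_main_def by (rule norm_triangle_ineq4)
  also have "norm (Ln (1 - Complex \<sigma> T)) \<le> 9 * ln T" using assms by (intro norm_Ln_le_9_ln) auto
  also have "norm (complex_of_real (ln (2 * pi)) - \<i> * of_real (pi / 2)) \<le> norm (complex_of_real (ln (2 * pi))) + norm (\<i> * complex_of_real (pi / 2))"
    by (rule norm_triangle_ineq4)
  also have "\<dots> = ln (2 * pi) + pi / 2" using pi_gt3 by (simp add: norm_mult)
  also have "ln (2 * pi) \<le> ln (2 ^ 3)" using pi_less_4 by (subst ln_le_cancel_iff) auto
  also have "ln (2 ^ 3 :: real) = 3 * ln 2" by (subst ln_realpow) auto
  finally have "norm (refl_main (Complex \<sigma> T)) \<le> 3 * ln 2 + pi / 2 + 9 * ln T" by simp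
  moreover have "ln 2 \<le> ln T" using T by (subst ln_le_cancel_iff) auto
  moreover have "pi / 2 \<le> 2" using pi_less_4 by simp
  ultimately show ?thesis using ln_ge_two_thirds[OF T] by linarith
qed

lemma reflected_side_facts:
  assumes s: "-1 < Re s" "Re s < 0" "Im s > 0"
  shows "s \<noteq> 1" "1 - s \<noteq> 1" "zeta s \<noteq> 0" "zeta (1 - s) \<noteq> 0" "1 - s \<notin> \<real>\<^sub>\<le>\<^sub>0" "1 - s \<noteq> 0"
  using s zeta_eq_0_imp_critical_strip[of s] zeta_nonzero_Re_gt_1[of "1 - s"]
  by (auto simp: complex_nonpos_Reals_iff complex_eq_iff[of _ 1] complex_eq_iff[of _ 0])

section \<open>Integration along the left side\<close>

text \<open>The logarithmic derivative at 1 - s has a bounded integral, and the approximation error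
  4 / Im s integrates to 4 ln T; what is left is the explicit \<open>refl_main\<close>. With
  \<sigma> < 0 and \<kappa> \<ge> 0 the exponential factor has modulus at most 1 on this
  side.\<close>

lemma left_integral_minus_refl_main:
  assumes t0: "t0 \<ge> 2" and \<sigma>: "-1 < \<sigma>" "\<sigma> < 0" and \<kappa>: "\<kappa> \<ge> 0"
  shows "\<exists>C. \<forall>T\<ge>t0.
     norm (contour_integral (linepath (Complex \<sigma> t0) (Complex \<sigma> T)) (\<lambda>s. exp (of_real \<kappa> * s) * (deriv zeta s / zeta s))
         - contour_integral (linepath (Complex \<sigma> t0) (Complex \<sigma> T)) (\<lambda>s. exp (of_real \<kappa> * s) * refl_main s)) \<le> C * ln T"
proof -
  obtain C where C: "\<And>t1 t2. norm (contour_integral (linepath (Complex (1 - (1 - \<sigma>)) t1) (Complex (1 - (1 - \<sigma>)) t2))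
      (\<lambda>s. exp (of_real \<kappa> * s) * (deriv zeta (1 - s) / zeta (1 - s)))) \<le> C"
    using contour_integral_exp_logderiv_reflected[of "1 - \<sigma>" \<kappa>] \<sigma> \<kappa> by auto
  have C0: "C \<ge> 0" using C[of 0 0] norm_ge_zero order_trans by blast
  have "norm (contour_integral (linepath (Complex \<sigma> t0) (Complex \<sigma> T)) (\<lambda>s. exp (of_real \<kappa> * s) * (deriv zeta s / zeta s))
         - contour_integral (linepath (Complex \<sigma> t0) (Complex \<sigma> T)) (\<lambda>s. exp (of_real \<kappa> * s) * refl_main s)) \<le> (4 + 3 / 2 * C) * ln T"
    if T: "T \<ge> t0" for T
  proof -
    let ?p = "linepath (Complex \<sigma> t0) (Complex \<sigma> T)"
    let ?S = "closed_segment (Complex \<sigma> t0) (Complex \<sigma> T)"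
    have S: "Re s = \<sigma>" "Im s \<ge> t0" if "s \<in> ?S" for s
      using closed_segment_vertical[OF that] T by auto
    have f: "s \<noteq> 1" "1 - s \<noteq> 1" "zeta s \<noteq> 0" "zeta (1 - s) \<noteq> 0" "1 - s \<notin> \<real>\<^sub>\<le>\<^sub>0" "1 - s \<noteq> 0" if "s \<in> ?S" for s
      using reflected_side_facts[of s] S[OF that] \<sigma> t0 by auto
    have cz: "continuous_on (-{1}) zeta" "continuous_on (-{1}) (deriv zeta)"
      using zeta_holomorphic holomorphic_deriv[OF zeta_holomorphic]
      by (auto intro: holomorphic_on_imp_continuous_on)
    have c1: "continuous_on ?S (\<lambda>s. exp (of_real \<kappa> * s) * (deriv zeta s / zeta s))"
      by (intro continuous_intros continuous_on_subset[OF cz(1)] continuous_on_subset[OF cz(2)]) (use f in auto)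
    have c2: "continuous_on ?S (\<lambda>s. exp (of_real \<kappa> * s) * (deriv zeta (1 - s) / zeta (1 - s)))"
      by (intro continuous_intros continuous_on_compose2[OF cz(1)] continuous_on_compose2[OF cz(2)]) (use f in auto)
    have c3: "continuous_on ?S (\<lambda>s. exp (of_real \<kappa> * s) * refl_main s)"
      unfolding refl_main_def by (intro continuous_intros) (use f in auto)
    have i: "(\<lambda>s. exp (of_real \<kappa> * s) * (deriv zeta s / zeta s)) contour_integrable_on ?p"
       "(\<lambda>s. exp (of_real \<kappa> * s) * (deriv zeta (1 - s) / zeta (1 - s))) contour_integrable_on ?p"
       "(\<lambda>s. exp (of_real \<kappa> * s) * refl_main s) contour_integrable_on ?p"
      using c1 c2 c3 by (auto intro!: contour_integrable_continuous_linepath)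
    define h where "h s = exp (of_real \<kappa> * s) * (deriv zeta s / zeta s) + exp (of_real \<kappa> * s) * (deriv zeta (1 - s) / zeta (1 - s))
        - exp (of_real \<kappa> * s) * refl_main s" for s
    have ih: "contour_integral ?p h = contour_integral ?p (\<lambda>s. exp (of_real \<kappa> * s) * (deriv zeta s / zeta s))
       + contour_integral ?p (\<lambda>s. exp (of_real \<kappa> * s) * (deriv zeta (1 - s) / zeta (1 - s)))
       - contour_integral ?p (\<lambda>s. exp (of_real \<kappa> * s) * refl_main s)"
      unfolding h_def using i by (simp only: contour_integral_diff contour_integral_add contour_integrable_add)
    have "norm (contour_integral ?p h) \<le> 4 * (ln T - ln t0)"
    proof (rule norm_vertical_integral_le)
      show "continuous_on ?S h" unfolding h_def by (intro continuous_on_diff continuous_on_add c1 c2 c3)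
      fix s assume s: "s \<in> ?S"
      have "h s = exp (of_real \<kappa> * s) * (deriv zeta s / zeta s + deriv zeta (1 - s) / zeta (1 - s) - refl_main s)"
        by (simp add: h_def algebra_simps)
      then have "norm (h s) = exp (\<kappa> * Re s) * norm (deriv zeta s / zeta s + deriv zeta (1 - s) / zeta (1 - s) - refl_main s)"
        by (simp add: norm_mult norm_exp_eq_Re)
      also have "\<dots> \<le> 1 * (4 / Im s)"
        using S[OF s] \<sigma> \<kappa> t0 by (intro mult_mono norm_zeta_logderiv_reflection_le) (auto simp: mult_nonneg_nonpos)
      finally show "norm (h s) \<le> 4 / Im s" by simp
    qed (use t0 T in auto)
    moreover have "ln t0 \<ge> 0" using t0 by simp
    ultimately have h: "norm (contour_integral ?p h) \<le> 4 * ln T" by (simp add: right_diff_distrib)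
    have C': "norm (contour_integral ?p (\<lambda>s. exp (of_real \<kappa> * s) * (deriv zeta (1 - s) / zeta (1 - s)))) \<le> C"
      using C[of t0 T] by simp
    have "contour_integral ?p (\<lambda>s. exp (of_real \<kappa> * s) * (deriv zeta s / zeta s))
         - contour_integral ?p (\<lambda>s. exp (of_real \<kappa> * s) * refl_main s)
       = contour_integral ?p h - contour_integral ?p (\<lambda>s. exp (of_real \<kappa> * s) * (deriv zeta (1 - s) / zeta (1 - s)))"
      unfolding ih by simp
    also have "norm \<dots> \<le> 4 * ln T + C" using norm_triangle_ineq4 h C' by (rule order_trans[OF _ add_mono])
    \<comment> \<open>Bounded quantities are absorbed into the logarithm by means of ln T \<ge>
      2/3.\<close>
    also have "C \<le> 3 / 2 * C * ln T"
      using mult_left_mono[OF ln_ge_two_thirds[of T] C0] t0 T by simp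
    finally show ?thesis by (simp add: algebra_simps)
  qed
  then show ?thesis by (intro exI allI impI)
qed

text \<open>Integration by parts: the exponential oscillates along the line, while
  \<open>refl_main\<close> is of size ln T and has derivative 1 / (1 - s). In units of ln T /
  \<kappa> the two boundary terms contribute 15 each and the remaining integral 1, hence the
  31.\<close>

lemma left_integral_exp_logderiv:
  assumes t0: "t0 \<ge> 2" and \<sigma>: "-1 < \<sigma>" "\<sigma> < 0" and \<kappa>: "\<kappa> > 0"
  shows "\<exists>C. \<forall>T\<ge>t0.
     norm (contour_integral (linepath (Complex \<sigma> t0) (Complex \<sigma> T)) (\<lambda>s. exp (of_real \<kappa> * s) * (deriv zeta s / zeta s))) \<le> C * ln T"
proof -
  obtain C where C: "\<forall>T\<ge>t0.
     norm (contour_integral (linepath (Complex \<sigma> t0) (Complex \<sigma> T)) (\<lambda>s. exp (of_real \<kappa> * s) * (deriv zeta s / zeta s))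
         - contour_integral (linepath (Complex \<sigma> t0) (Complex \<sigma> T)) (\<lambda>s. exp (of_real \<kappa> * s) * refl_main s)) \<le> C * ln T"
    using left_integral_minus_refl_main[OF t0 \<sigma> less_imp_le[OF \<kappa>]] by (rule exE)
  have "norm (contour_integral (linepath (Complex \<sigma> t0) (Complex \<sigma> T)) (\<lambda>s. exp (of_real \<kappa> * s) * (deriv zeta s / zeta s))) \<le> (C + 31 / \<kappa>) * ln T"
    if T: "T \<ge> t0" for T
  proof -
    define a b where "a = Complex \<sigma> t0" and "b = Complex \<sigma> T"
    let ?p = "linepath a b"
    let ?S = "closed_segment a b"
    have S: "Re s = \<sigma>" "Im s \<ge> t0" if "s \<in> ?S" for s
      using closed_segment_vertical that T by (auto simp: a_def b_def)
    have f: "1 - s \<notin> \<real>\<^sub>\<le>\<^sub>0" "1 - s \<noteq> 0" if "s \<in> ?S" for s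
      using reflected_side_facts[of s] S[OF that] \<sigma> t0 by auto
    define P where "P s = exp (of_real \<kappa> * s) * refl_main s / of_real \<kappa>" for s
    define g where "g s = exp (of_real \<kappa> * s) * (1 / (of_real \<kappa> * (1 - s)))" for s :: complex
    have dP: "(P has_field_derivative exp (of_real \<kappa> * s) * refl_main s + g s) (at s within ?S)" if s: "s \<in> ?S" for s
      unfolding P_def g_def refl_main_def using f[OF s] \<kappa>
      by (auto intro!: derivative_eq_intros simp: field_simps)
    have "((\<lambda>s. exp (of_real \<kappa> * s) * refl_main s + g s) has_contour_integral (P (pathfinish ?p) - P (pathstart ?p))) ?p"
      by (rule contour_integral_primitive[OF dP]) auto
    then have 1: "contour_integral ?p (\<lambda>s. exp (of_real \<kappa> * s) * refl_main s + g s) = P b - P a"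
      by (simp add: contour_integral_unique)
    have c3: "continuous_on ?S (\<lambda>s. exp (of_real \<kappa> * s) * refl_main s)"
      unfolding refl_main_def by (intro continuous_intros) (use f in auto)
    have cg: "continuous_on ?S g"
      unfolding g_def by (intro continuous_intros) (use f \<kappa> in auto)
    have 2: "contour_integral ?p (\<lambda>s. exp (of_real \<kappa> * s) * refl_main s + g s)
       = contour_integral ?p (\<lambda>s. exp (of_real \<kappa> * s) * refl_main s) + contour_integral ?p g"
      using c3 cg by (intro contour_integral_add contour_integrable_continuous_linepath)
    have ex: "exp (\<kappa> * \<sigma>) \<le> 1" using \<kappa> \<sigma> by (simp add: mult_nonneg_nonpos)
    have "norm (contour_integral ?p g) \<le> 1 / \<kappa> * (ln T - ln t0)" unfolding a_def b_def
    proof (rule norm_vertical_integral_le)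
      show "continuous_on (closed_segment (Complex \<sigma> t0) (Complex \<sigma> T)) g" using cg by (simp add: a_def b_def)
      fix s assume "s \<in> closed_segment (Complex \<sigma> t0) (Complex \<sigma> T)"
      then have s: "s \<in> ?S" by (simp add: a_def b_def)
      have "norm (1 - s) \<ge> Im s" using abs_Im_le_cmod[of "1 - s"] by simp
      then have "1 / (\<kappa> * norm (1 - s)) \<le> 1 / (\<kappa> * Im s)"
        using S[OF s] t0 \<kappa> by (intro divide_left_mono mult_left_mono mult_pos_pos) auto
      moreover have "norm (g s) = exp (\<kappa> * \<sigma>) * (1 / (\<kappa> * norm (1 - s)))"
        using S[OF s] \<kappa> by (simp add: g_def norm_mult norm_divide norm_exp_eq_Re)
      moreover have "exp (\<kappa> * \<sigma>) * (1 / (\<kappa> * norm (1 - s))) \<le> 1 * (1 / (\<kappa> * norm (1 - s)))"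
        using ex \<kappa> by (intro mult_right_mono) auto
      ultimately have "norm (g s) \<le> 1 / (\<kappa> * Im s)" by linarith
      then show "norm (g s) \<le> 1 / \<kappa> / Im s" by simp
    qed (use t0 T in auto)
    also have "\<dots> \<le> 1 / \<kappa> * ln T" using \<kappa> t0 by (intro mult_left_mono) auto
    finally have g: "norm (contour_integral ?p g) \<le> 1 / \<kappa> * ln T" .
    have P: "norm (P (Complex \<sigma> t)) \<le> 15 / \<kappa> * ln T" if "t0 \<le> t" "t \<le> T" for t
    proof -
      have "norm (P (Complex \<sigma> t)) = exp (\<kappa> * \<sigma>) * norm (refl_main (Complex \<sigma> t)) / \<kappa>"
        using \<kappa> by (simp add: P_def norm_mult norm_divide norm_exp_eq_Re)
      also have "\<dots> \<le> 1 * (15 * ln t) / \<kappa>"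
        using ex \<kappa> norm_refl_main_le[of t \<sigma>] that t0 \<sigma> by (intro divide_right_mono mult_mono) auto
      also have "ln t \<le> ln T" using that t0 by (subst ln_le_cancel_iff) auto
      finally show ?thesis using \<kappa> by (simp add: divide_right_mono)
    qed
    have "contour_integral ?p (\<lambda>s. exp (of_real \<kappa> * s) * refl_main s) = P b - P a - contour_integral ?p g"
      using 1 2 by (simp add: algebra_simps)
    also have "norm \<dots> \<le> norm (P b - P a) + norm (contour_integral ?p g)" by (rule norm_triangle_ineq4)
    also have "norm (P b - P a) \<le> norm (P b) + norm (P a)" by (rule norm_triangle_ineq4)
    finally have m: "norm (contour_integral ?p (\<lambda>s. exp (of_real \<kappa> * s) * refl_main s)) \<le> 31 / \<kappa> * ln T"
      using g P[of T] P[of t0] T by (simp add: a_def b_def)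
    let ?A = "contour_integral ?p (\<lambda>s. exp (of_real \<kappa> * s) * (deriv zeta s / zeta s))"
    let ?B = "contour_integral ?p (\<lambda>s. exp (of_real \<kappa> * s) * refl_main s)"
    have "norm ?A = norm ((?A - ?B) + ?B)" by simp
    also have "\<dots> \<le> norm (?A - ?B) + norm ?B" by (rule norm_triangle_ineq)
    also have "\<dots> \<le> C * ln T + 31 / \<kappa> * ln T" using C[rule_format, OF T] m unfolding a_def b_def by (rule add_mono)
    finally show ?thesis unfolding a_def b_def by (simp only: distrib_right)
  qed
  then show ?thesis by (intro exI allI impI)
qed

text \<open>With no oscillating factor to exploit, \<open>refl_main\<close> is integrated exactly by
  \<open>P\<close>, and the value of \<open>P\<close> at the upper end contains the main term. The
  lower end and all bounded quantities are collected in \<open>D\<close>.\<close>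

lemma left_integral_logderiv:
  assumes t0: "t0 \<ge> 2" and \<sigma>: "-1 < \<sigma>" "\<sigma> < 0"
  shows "\<exists>C. \<forall>T\<ge>t0.
     norm (contour_integral (linepath (Complex \<sigma> t0) (Complex \<sigma> T)) (\<lambda>s. deriv zeta s / zeta s)
        + \<i> * of_real (T * (ln (T / (2 * pi)) - 1))) \<le> C * ln T"
proof -
  obtain C where C: "\<forall>T\<ge>t0.
     norm (contour_integral (linepath (Complex \<sigma> t0) (Complex \<sigma> T)) (\<lambda>s. exp (of_real 0 * s) * (deriv zeta s / zeta s))
         - contour_integral (linepath (Complex \<sigma> t0) (Complex \<sigma> T)) (\<lambda>s. exp (of_real 0 * s) * refl_main s)) \<le> C * ln T"
    using left_integral_minus_refl_main[OF t0 \<sigma> order_refl] by (rule exE)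
  define A where "A = complex_of_real (ln (2 * pi)) - \<i> * of_real (pi / 2)"
  define P where "P s = A * s + (1 - s) * Ln (1 - s) - (1 - s)" for s
  define D where "D = norm A + 2 + norm (P (Complex \<sigma> t0))"
  have "norm (contour_integral (linepath (Complex \<sigma> t0) (Complex \<sigma> T)) (\<lambda>s. deriv zeta s / zeta s)
        + \<i> * of_real (T * (ln (T / (2 * pi)) - 1))) \<le> (C + 22 + 3 / 2 * D) * ln T"
    if T: "T \<ge> t0" for T
  proof -
    define a b where "a = Complex \<sigma> t0" and "b = Complex \<sigma> T"
    let ?p = "linepath a b"
    let ?S = "closed_segment a b"
    have T2: "T \<ge> 2" using t0 T by simp
    have S: "Re s = \<sigma>" "Im s \<ge> t0" if "s \<in> ?S" for s
      using closed_segment_vertical that T by (auto simp: a_def b_def)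
    have f: "1 - s \<notin> \<real>\<^sub>\<le>\<^sub>0" "1 - s \<noteq> 0" if "s \<in> ?S" for s
      using reflected_side_facts[of s] S[OF that] \<sigma> t0 by auto
    have dP: "(P has_field_derivative refl_main s) (at s within ?S)" if s: "s \<in> ?S" for s
      unfolding P_def refl_main_def A_def[symmetric] using f[OF s]
      by (auto intro!: derivative_eq_intros)
    have "(refl_main has_contour_integral (P (pathfinish ?p) - P (pathstart ?p))) ?p"
      by (rule contour_integral_primitive[OF dP]) auto
    then have 1: "contour_integral ?p refl_main = P b - P a"
      by (simp add: contour_integral_unique)
    define z where "z = 1 - b"
    have z: "Re z = 1 - \<sigma>" "Im z = - T" by (auto simp: z_def b_def)
    \<comment> \<open>The point z = 1 - b moved horizontally onto the imaginary axis, where Ln is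
      explicit. In A b + w Ln w - z the pi / 2 of A cancels against the argument of w, and up to
      bounded terms - \<i> T (ln (T / (2 pi)) - 1) remains. The move itself changes z Ln z by O(ln
      T), as the derivative Ln v + 1 is of that size.\<close>
    define w where "w = - (\<i> * of_real T)"
    have seg: "0 \<le> Re v" "Re v \<le> 2" "Im v = - T" if v: "v \<in> closed_segment w z" for v
    proof -
      obtain u where u: "0 \<le> u" "u \<le> 1" "v = (1 - u) *\<^sub>R w + u *\<^sub>R z"
        using v unfolding in_segment by (elim exE conjE)
      have "Re v = u * (1 - \<sigma>)" unfolding u(3) using z by (simp add: w_def)
      moreover have "u * (1 - \<sigma>) \<le> 1 * 2" using u \<sigma> by (intro mult_mono) auto
      ultimately show "0 \<le> Re v" "Re v \<le> 2" using u \<sigma> by auto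
      show "Im v = - T" unfolding u(3) using z by (simp add: w_def algebra_simps)
    qed
    have "norm (z * Ln z - w * Ln w) \<le> (9 * ln T + 1) * norm (z - w)"
    proof (rule field_differentiable_bound[where S = "closed_segment w z" and f = "\<lambda>v. v * Ln v" and f' = "\<lambda>v. Ln v + 1"])
      fix v assume v: "v \<in> closed_segment w z"
      have "v \<noteq> 0" "v \<notin> \<real>\<^sub>\<le>\<^sub>0" using seg[OF v] T2 by (auto simp: complex_nonpos_Reals_iff)
      then show "((\<lambda>v. v * Ln v) has_field_derivative Ln v + 1) (at v within closed_segment w z)"
        by (auto intro!: derivative_eq_intros)
      have "norm (Ln v + 1) \<le> norm (Ln v) + norm (1::complex)" by (rule norm_triangle_ineq)
      then show "norm (Ln v + 1) \<le> 9 * ln T + 1" using norm_Ln_le_9_ln[OF T2 seg[OF v]] by simp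
    qed auto
    also have "z - w = of_real (1 - \<sigma>)" by (simp add: z_def w_def b_def complex_eq_iff)
    then have "norm (z - w) = 1 - \<sigma>" using \<sigma> by (simp only: norm_of_real; simp)
    also have "(9 * ln T + 1) * (1 - \<sigma>) \<le> (9 * ln T + 1) * 2"
      using \<sigma> T2 by (intro mult_left_mono) auto
    finally have zw: "norm (z * Ln z - w * Ln w) \<le> 18 * ln T + 2" by simp
    have "w = of_real T * (- \<i>)" by (simp add: w_def)
    then have "Ln w = of_real (ln T) + Ln (- \<i>)"
      using T2 Ln_times_of_real[of T "- \<i>"] Ln_of_real[of T] by simp
    then have Lw: "Ln w = of_real (ln T) - \<i> * of_real (pi / 2)" by (simp add: Ln_minus_ii)
    have lnT: "ln (T / (2 * pi)) = ln T - ln (2 * pi)" using T2 by (simp add: ln_div)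
    have b: "b = of_real \<sigma> + \<i> * of_real T" by (simp add: b_def complex_eq_iff)
    have "P b + \<i> * of_real (T * (ln (T / (2 * pi)) - 1)) = A * of_real \<sigma> + (z * Ln z - w * Ln w) - of_real (1 - \<sigma>)"
      unfolding P_def z_def[symmetric] Lw lnT A_def
      by (simp add: b w_def z_def algebra_simps complex_eq_iff)
    also have "norm \<dots> \<le> norm (A * of_real \<sigma>) + (18 * ln T + 2) + norm (complex_of_real (1 - \<sigma>))"
      using norm_triangle_ineq4 zw norm_triangle_ineq by (meson add_mono add_left_mono order_trans order_refl)
    also have "norm (A * of_real \<sigma>) \<le> norm A * 1" unfolding norm_mult using \<sigma> by (intro mult_left_mono) auto
    also have "norm (complex_of_real (1 - \<sigma>)) \<le> 2" using \<sigma> by (simp only: norm_of_real; simp)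
    finally have Pb: "norm (P b + \<i> * of_real (T * (ln (T / (2 * pi)) - 1))) \<le> norm A + 18 * ln T + 4" by simp
    let ?A = "contour_integral ?p (\<lambda>s. deriv zeta s / zeta s)"
    let ?M = "\<i> * of_real (T * (ln (T / (2 * pi)) - 1))"
    have CT: "norm (?A - contour_integral ?p refl_main) \<le> C * ln T"
      using C[rule_format, OF T] by (simp add: a_def b_def)
    have "?A + ?M = (?A - contour_integral ?p refl_main) + ((P b + ?M) - P a)" unfolding 1 by simp
    also have "norm \<dots> \<le> norm (?A - contour_integral ?p refl_main) + norm ((P b + ?M) - P a)" by (rule norm_triangle_ineq)
    also have "norm ((P b + ?M) - P a) \<le> norm (P b + ?M) + norm (P a)" by (rule norm_triangle_ineq4)
    finally have "norm (?A + ?M) \<le> C * ln T + (norm A + 18 * ln T + 4 + norm (P a))"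
      using CT Pb by linarith
    also have "\<dots> = (C + 18) * ln T + 2 + D" by (simp add: D_def a_def algebra_simps)
    also have "\<dots> \<le> (C + 18) * ln T + 4 * ln T + 3 / 2 * D * ln T"
    proof -
      have "D \<ge> 0" by (simp add: D_def)
      then have "D * (2 / 3) \<le> D * ln T" using ln_ge_two_thirds[OF T2] by (intro mult_left_mono) auto
      then show ?thesis using ln_ge_two_thirds[OF T2] by simp
    qed
    finally show ?thesis unfolding a_def b_def by (simp add: algebra_simps)
  qed
  then show ?thesis by (intro exI allI impI)
qed

section \<open>The horizontal sides of the rectangle\<close>

text \<open>Away from Z, g is f divided by the product; at a zero it is the local quotient
  \<open>zor_poly\<close> divided by the remaining factors. Near a point of Z the two prescriptions
  agree, because the local factorisation of f splits off exactly the power that the product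
  contains. So g is holomorphic across Z.\<close>

lemma holomorphic_factor_zeros:
  fixes f :: "complex \<Rightarrow> complex"
  assumes f: "f holomorphic_on S" and S: "open S" "connected S" and Z: "finite Z" "Z \<subseteq> S"
    and ex: "\<exists>w\<in>S. f w \<noteq> 0"
  shows "\<exists>g. g holomorphic_on S \<and> (\<forall>w\<in>S. f w = g w * (\<Prod>\<rho>\<in>Z. (w - \<rho>) ^ nat (zorder f \<rho>))) \<and> (\<forall>\<rho>\<in>Z. g \<rho> \<noteq> 0)"
proof -
  define m where "m \<rho> = nat (zorder f \<rho>)" for \<rho>
  define h where "h \<rho> = zor_poly f \<rho>" for \<rho>
  have Zr: "\<exists>r>0. cball \<rho> r \<subseteq> S \<and> h \<rho> holomorphic_on cball \<rho> r \<and>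
     (\<forall>w\<in>cball \<rho> r. f w = h \<rho> w * (w - \<rho>) ^ m \<rho> \<and> h \<rho> w \<noteq> 0)" if "\<rho> \<in> Z" for \<rho>
  proof -
    have "\<rho> \<in> S" using that Z by auto
    from zorder_exist_zero[OF f S this ex, THEN conjunct2] show ?thesis by (simp only: m_def h_def)
  qed
  define Q where "Q A w = (\<Prod>\<rho>\<in>A. (w - \<rho>) ^ m \<rho>)" for A and w :: complex
  have Q0: "Q A w \<noteq> 0" if "A \<subseteq> Z" "w \<notin> A" for A w
  proof -
    have "finite A" using that(1) Z(1) by (rule finite_subset)
    then show ?thesis using that(2) by (auto simp: Q_def)
  qed
  have Qhol: "Q A holomorphic_on B" for A B unfolding Q_def by (intro holomorphic_intros)
  define g where "g w = (if w \<in> Z then h w w / Q (Z - {w}) w else f w / Q Z w)" for w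
  have Qsplit: "Q Z w = (w - \<rho>) ^ m \<rho> * Q (Z - {\<rho>}) w" if "\<rho> \<in> Z" for \<rho> w
    unfolding Q_def using Z(1) that by (rule prod.remove)
  have gZ: "g \<rho> \<noteq> 0" if \<rho>: "\<rho> \<in> Z" for \<rho>
  proof -
    obtain r where r: "r > 0" "\<forall>w\<in>cball \<rho> r. f w = h \<rho> w * (w - \<rho>) ^ m \<rho> \<and> h \<rho> w \<noteq> 0"
      using Zr[OF \<rho>] by blast
    then have "h \<rho> \<rho> \<noteq> 0" by (auto dest!: bspec[of _ _ \<rho>])
    then show ?thesis using \<rho> Q0[of "Z - {\<rho>}" \<rho>] by (simp add: g_def)
  qed
  have fg: "f w = g w * Q Z w" if "w \<in> S" for w
  proof (cases "w \<in> Z")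
    case True
    obtain r where r: "r > 0" "\<forall>v\<in>cball w r. f v = h w v * (v - w) ^ m w \<and> h w v \<noteq> 0"
      using Zr[OF True] by blast
    then have "f w = h w w * (w - w) ^ m w" by (auto dest!: bspec[of _ _ w])
    then show ?thesis using True Q0[of "Z - {w}" w] by (simp add: g_def Qsplit[OF True])
  next
    case False
    then show ?thesis using Q0[of Z w] by (simp add: g_def)
  qed
  have "g field_differentiable (at a within S)" if a: "a \<in> S" for a
  proof (cases "a \<in> Z")
    case False
    have "(\<lambda>w. f w / Q Z w) holomorphic_on (S - Z)"
      by (intro holomorphic_on_divide Qhol holomorphic_on_subset[OF f]) (use Q0[of Z] in auto)
    then have "g holomorphic_on (S - Z)" by (rule holomorphic_transform) (simp add: g_def)
    moreover have "open (S - Z)" using S(1) Z(1) by (intro open_Diff finite_imp_closed)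
    ultimately have "g field_differentiable (at a)"
      using a False by (intro holomorphic_on_imp_differentiable_at[of g "S - Z"]) auto
    then show ?thesis by (rule field_differentiable_at_within)
  next
    case True
    obtain r where r: "r > 0" "cball a r \<subseteq> S" "h a holomorphic_on cball a r" "\<forall>w\<in>cball a r. f w = h a w * (w - a) ^ m a \<and> h a w \<noteq> 0"
      using Zr[OF True] by blast
    let ?U = "ball a r - (Z - {a})"
    have "(\<lambda>w. h a w / Q (Z - {a}) w) holomorphic_on ?U"
      by (intro holomorphic_on_divide Qhol holomorphic_on_subset[OF r(3)]) (use Q0[of "Z - {a}"] in auto)
    moreover have "h a w / Q (Z - {a}) w = g w" if w: "w \<in> ?U" for w
    proof (cases "w = a")
      case False
      then have "w \<notin> Z" using w by auto
      moreover have "f w = h a w * (w - a) ^ m a" using r(4) w by auto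
      ultimately show ?thesis using False by (simp add: g_def Qsplit[OF True])
    qed (use True in \<open>simp add: g_def\<close>)
    ultimately have "g holomorphic_on ?U" by (rule holomorphic_transform)
    moreover have "open ?U" using Z(1) by (intro open_Diff finite_imp_closed) auto
    ultimately have "g field_differentiable (at a)"
      using r(1) by (intro holomorphic_on_imp_differentiable_at[of g ?U]) auto
    then show ?thesis by (rule field_differentiable_at_within)
  qed
  then have "g holomorphic_on S" unfolding holomorphic_on_def by blast
  then show ?thesis using fg gZ unfolding Q_def m_def by blast
qed

text \<open>Logarithmic differentiation of a finite product. The factors are arbitrary because it is
  applied both to w - \<rho> and to the auxiliary factors \<open>b \<rho>\<close> that replace
  them.\<close>

lemma has_field_derivative_prod_power:
  fixes h :: "'b \<Rightarrow> complex \<Rightarrow> complex"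
  assumes "finite Z" and "\<And>\<rho>. \<rho> \<in> Z \<Longrightarrow> (h \<rho> has_field_derivative h' \<rho>) (at w)"
    and "\<And>\<rho>. \<rho> \<in> Z \<Longrightarrow> h \<rho> w \<noteq> 0"
  shows "((\<lambda>w. \<Prod>\<rho>\<in>Z. h \<rho> w ^ m \<rho>) has_field_derivative
    (\<Prod>\<rho>\<in>Z. h \<rho> w ^ m \<rho>) * (\<Sum>\<rho>\<in>Z. of_nat (m \<rho>) * (h' \<rho> / h \<rho> w))) (at w)"
  using assms
proof (induction Z rule: finite_induct)
  case (insert \<rho> Z)
  have h: "(h \<rho> has_field_derivative h' \<rho>) (at w)" "h \<rho> w \<noteq> 0" using insert.prems by auto
  have p: "((\<lambda>w. h \<rho> w ^ m \<rho>) has_field_derivative h \<rho> w ^ m \<rho> * (of_nat (m \<rho>) * (h' \<rho> / h \<rho> w))) (at w)"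
  proof (rule DERIV_cong[OF DERIV_power[OF h(1)]])
    show "of_nat (m \<rho>) * (h' \<rho> * h \<rho> w ^ (m \<rho> - Suc 0)) = h \<rho> w ^ m \<rho> * (of_nat (m \<rho>) * (h' \<rho> / h \<rho> w))"
      using h(2) by (cases "m \<rho>") (simp_all add: field_simps)
  qed
  have IH: "((\<lambda>w. \<Prod>\<rho>\<in>Z. h \<rho> w ^ m \<rho>) has_field_derivative
    (\<Prod>\<rho>\<in>Z. h \<rho> w ^ m \<rho>) * (\<Sum>\<rho>\<in>Z. of_nat (m \<rho>) * (h' \<rho> / h \<rho> w))) (at w)"
    using insert.prems by (intro insert.IH) auto
  have "((\<lambda>w. h \<rho> w ^ m \<rho> * (\<Prod>\<rho>\<in>Z. h \<rho> w ^ m \<rho>)) has_field_derivative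
     h \<rho> w ^ m \<rho> * (of_nat (m \<rho>) * (h' \<rho> / h \<rho> w)) * (\<Prod>\<rho>\<in>Z. h \<rho> w ^ m \<rho>) +
     (\<Prod>\<rho>\<in>Z. h \<rho> w ^ m \<rho>) * (\<Sum>\<rho>\<in>Z. of_nat (m \<rho>) * (h' \<rho> / h \<rho> w)) * h \<rho> w ^ m \<rho>) (at w)"
    by (rule DERIV_mult[OF p IH])
  then show ?case using insert.hyps by (simp add: algebra_simps)
qed simp

text \<open>The map sending q to q / (2 A - q) takes the half plane Re q < A into the unit disc, so
  Schwarz's lemma bounds h - h z on the disc of the intermediate radius R. Cauchy's inequality on
  discs of radius (r - r') / 2 then bounds the derivative; the constant is 4 A r / (r - r') divided
  by that radius.\<close>

lemma Borel_Caratheodory_deriv: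
  fixes h :: "complex \<Rightarrow> complex"
  assumes h: "h holomorphic_on ball z r" and A: "A > 0"
    and Re: "\<And>w. w \<in> ball z r \<Longrightarrow> Re (h w - h z) < A"
    and r: "0 < r'" "r' < r" and w: "w \<in> cball z r'"
  shows "norm (deriv h w) \<le> 8 * A * r / (r - r')\<^sup>2"
proof -
  define R where "R = (r + r') / 2"
  have R: "r' < R" "R < r" "0 < R" using r by (auto simp: R_def)
  have bound: "norm (h v - h z) \<le> 4 * A * r / (r - r')" if v: "norm (v - z) \<le> R" for v
  proof -
    define \<phi> where "\<phi> u = (h (z + of_real r * u) - h z) / (2 * of_real A - (h (z + of_real r * u) - h z))" for u
    have inb: "z + of_real r * u \<in> ball z r" if "norm u < 1" for u
      using that r by (simp add: dist_norm norm_mult)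
    have den: "2 * of_real A - (h (z + of_real r * u) - h z) \<noteq> 0" if "norm u < 1" for u
    proof
      assume "2 * of_real A - (h (z + of_real r * u) - h z) = 0"
      from arg_cong[OF this, of Re] Re[OF inb[OF that]] A show False by simp
    qed
    have "(\<lambda>u. h (z + of_real r * u)) holomorphic_on ball 0 1"
    proof -
      have "(h \<circ> (\<lambda>u. z + of_real r * u)) holomorphic_on ball 0 1"
        by (rule holomorphic_on_compose_gen[OF _ h]) (use inb in \<open>auto intro!: holomorphic_intros simp: dist_norm\<close>)
      then show ?thesis by (simp add: o_def)
    qed
    then have hol: "\<phi> holomorphic_on ball 0 1"
      unfolding \<phi>_def using den by (intro holomorphic_intros) auto
    have lt: "norm (\<phi> u) < 1" if "norm u < 1" for u
    proof -
      define q where "q = h (z + of_real r * u) - h z"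
      have q: "Re q < A" using Re[OF inb[OF that]] by (simp add: q_def)
      have "(norm q)\<^sup>2 < (norm (2 * of_real A - q))\<^sup>2"
      proof -
        have "(norm (2 * of_real A - q))\<^sup>2 - (norm q)\<^sup>2 = 4 * A * (A - Re q)"
          unfolding cmod_power2 by (simp add: power2_eq_square algebra_simps)
        also have "\<dots> > 0" using A q by simp
        finally show ?thesis by simp
      qed
      then have "norm q < norm (2 * of_real A - q)" by (rule power2_less_imp_less) simp
      then show ?thesis unfolding \<phi>_def q_def[symmetric] norm_divide by (subst divide_less_eq_1_pos) (auto intro: le_less_trans[OF norm_ge_zero])
    qed
    define u where "u = (v - z) / of_real r"
    have nu: "norm u = norm (v - z) / r" using r by (simp add: u_def norm_divide)
    have u1: "norm u < 1" using v R r by (simp add: nu)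
    have "norm (\<phi> u) \<le> norm u" by (rule Schwarz_Lemma(1)[OF hol _ lt u1]) (simp add: \<phi>_def)
    also have "\<dots> \<le> R / r" unfolding nu using v r by (intro divide_right_mono) auto
    finally have ph: "norm (\<phi> u) \<le> R / r" .
    define q where "q = h v - h z"
    have zu: "z + of_real r * u = v" using r by (simp add: u_def)
    have "q = \<phi> u * (2 * of_real A - q)" using den[OF u1] by (simp add: \<phi>_def zu q_def)
    then have "norm q = norm (\<phi> u) * norm (2 * of_real A - q)" by (metis norm_mult)
    also have "\<dots> \<le> R / r * (2 * A + norm q)"
      using norm_triangle_ineq4[of "2 * of_real A" q] A R r by (intro mult_mono ph) (auto simp: norm_mult)
    finally have "norm q * r \<le> R * (2 * A + norm q)" using r by (simp add: field_simps)
    then have "norm q * (r - R) \<le> 2 * A * R" by (simp add: algebra_simps)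
    also have "\<dots> \<le> 2 * A * r" using A R by simp
    finally have "norm q \<le> 2 * A * r / (r - R)" using R by (simp add: field_simps)
    also have "r - R = (r - r') / 2" by (simp add: R_def field_simps)
    finally show ?thesis by (simp add: q_def)
  qed
  have d: "(r - r') / 2 > 0" using r by simp
  have sub: "norm (v - z) \<le> R" if "norm (w - v) \<le> (r - r') / 2" for v
  proof -
    have "norm (v - z) \<le> norm (v - w) + norm (w - z)" using norm_triangle_ineq[of "v - w" "w - z"] by simp
    also have "\<dots> \<le> (r - r') / 2 + r'" using that w by (intro add_mono) (auto simp: dist_norm norm_minus_commute)
    also have "\<dots> = R" by (simp add: R_def field_simps)
    finally show ?thesis .
  qed
  have cb: "cball w ((r - r') / 2) \<subseteq> ball z r"
  proof
    fix v assume "v \<in> cball w ((r - r') / 2)"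
    then have "norm (v - z) \<le> R" by (intro sub) (simp add: dist_norm)
    then show "v \<in> ball z r" using R by (simp add: dist_norm norm_minus_commute)
  qed
  have hc: "(\<lambda>v. h v - h z) holomorphic_on cball w ((r - r') / 2)"
    by (intro holomorphic_intros holomorphic_on_subset[OF h cb])
  have "norm ((deriv ^^ 1) (\<lambda>v. h v - h z) w) \<le> fact 1 * (4 * A * r / (r - r')) / ((r - r') / 2) ^ 1"
  proof (rule Cauchy_inequality)
    show "(\<lambda>v. h v - h z) holomorphic_on ball w ((r - r') / 2)" by (rule holomorphic_on_subset[OF hc]) auto
    show "continuous_on (cball w ((r - r') / 2)) (\<lambda>v. h v - h z)" by (rule holomorphic_on_imp_continuous_on[OF hc])
    show "norm (h x - h z) \<le> 4 * A * r / (r - r')" if "norm (w - x) = (r - r') / 2" for x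
      using that by (intro bound sub) simp
  qed (use d in auto)
  moreover have "deriv (\<lambda>v. h v - h z) w = deriv h w"
  proof (rule DERIV_imp_deriv)
    have "w \<in> ball z r" using w r by auto
    then have "(h has_field_derivative deriv h w) (at w)" by (intro holomorphic_derivI[OF h]) auto
    from DERIV_diff[OF this DERIV_const] show "((\<lambda>v. h v - h z) has_field_derivative deriv h w) (at w)" by simp
  qed
  ultimately show ?thesis using r by (simp add: power2_eq_square field_simps)
qed

context
  fixes f :: "complex \<Rightarrow> complex" and s0 :: complex and M r2 r3 R R' :: real
  assumes r: "0 < r3" "r3 < r2" "r2 < R" "R < R'"
    and f: "f holomorphic_on ball s0 R'" and M: "\<And>w. w \<in> cball s0 R \<Longrightarrow> norm (f w) \<le> M"
    and f0: "f s0 \<noteq> 0"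
begin

lemma local_zeros_finite: "finite {\<rho> \<in> cball s0 r2. f \<rho> = 0}"
proof (cases "f constant_on ball s0 R'")
  case True
  then obtain c where c: "\<And>w. w \<in> ball s0 R' \<Longrightarrow> f w = c" unfolding constant_on_def by blast
  have "c \<noteq> 0" using c[of s0] f0 r by simp
  moreover have "cball s0 r2 \<subseteq> ball s0 R'" using r by (intro cball_subset_ball_iff[THEN iffD2]) auto
  ultimately have "{\<rho> \<in> cball s0 r2. f \<rho> = 0} = {}" using c by blast
  then show ?thesis by (simp only: finite.emptyI)
next
  case False
  have "cball s0 r2 \<subseteq> ball s0 R'" using r by (intro cball_subset_ball_iff[THEN iffD2]) auto
  then show ?thesis
    by (intro holomorphic_compact_finite_zeros[OF f _ _ _ _ False]) auto
qed

text \<open>Jensen's inequality and the local partial fraction expansion in one argument. Replacing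
  each w - \<rho> in f by a factor of equal modulus on the circle of radius R, but without zeros in
  the disc, gives a function G that is still bounded by M and is zero-free on the disc of radius r2.
  Values at the centre limit the number of zeros, and Borel-Caratheodory for a logarithm of G bounds
  G' / G. The holomorphic part E = g' / g differs from it only by the logarithmic derivatives of the
  new factors, which are bounded on the disc of radius r3.\<close>

lemma local_logderiv_expansion:
  defines "Z \<equiv> {\<rho> \<in> cball s0 r2. f \<rho> = 0}" and "A \<equiv> ln (M / norm (f s0))"
  shows "real (\<Sum>\<rho>\<in>Z. nat (zorder f \<rho>)) \<le> A / ln (R / r2)"
    and "\<exists>E. E holomorphic_on ball s0 r2
       \<and> (\<forall>w\<in>cball s0 r3. norm (E w) \<le> 8 * (A + 1) * r2 / (r2 - r3)\<^sup>2 + A / ln (R / r2) * (r2 / R / (R - r2 * r3 / R)))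
       \<and> (\<forall>w\<in>ball s0 r2 - Z. deriv f w / f w = E w + (\<Sum>\<rho>\<in>Z. of_nat (nat (zorder f \<rho>)) / (w - \<rho>)))"
proof -
  define m where "m \<rho> = nat (zorder f \<rho>)" for \<rho>
  define n where "n = (\<Sum>\<rho>\<in>Z. m \<rho>)"
  have Zf: "finite Z" unfolding Z_def by (rule local_zeros_finite)
  have sub: "cball s0 R \<subseteq> ball s0 R'" "cball s0 r2 \<subseteq> cball s0 R" "cball s0 r2 \<subseteq> ball s0 R'"
    using r by (auto simp: cball_subset_ball_iff)
  have ZS: "Z \<subseteq> ball s0 R'" using sub(3) by (auto simp: Z_def)
  have s0: "s0 \<in> ball s0 R'" using r by simp
  have "\<exists>g. g holomorphic_on ball s0 R' \<and> (\<forall>w\<in>ball s0 R'. f w = g w * (\<Prod>\<rho>\<in>Z. (w - \<rho>) ^ nat (zorder f \<rho>))) \<and> (\<forall>\<rho>\<in>Z. g \<rho> \<noteq> 0)"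
    by (rule holomorphic_factor_zeros[OF f _ _ Zf ZS]) (use f0 s0 in auto)
  then obtain g where g': "g holomorphic_on ball s0 R' \<and> (\<forall>w\<in>ball s0 R'. f w = g w * (\<Prod>\<rho>\<in>Z. (w - \<rho>) ^ nat (zorder f \<rho>))) \<and> (\<forall>\<rho>\<in>Z. g \<rho> \<noteq> 0)"
    by (rule exE)
  define P where "P w = (\<Prod>\<rho>\<in>Z. (w - \<rho>) ^ m \<rho>)" for w
  have g: "g holomorphic_on ball s0 R'" by (rule g'[THEN conjunct1])
  have fg: "f w = g w * P w" if "w \<in> ball s0 R'" for w
    unfolding P_def m_def by (rule bspec[OF g'[THEN conjunct2, THEN conjunct1] that])
  have gZ: "g \<rho> \<noteq> 0" if "\<rho> \<in> Z" for \<rho>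
    by (rule bspec[OF g'[THEN conjunct2, THEN conjunct2] that])
  have g0: "g w \<noteq> 0" if "w \<in> cball s0 r2" for w
  proof (cases "f w = 0")
    case True
    then show ?thesis using that by (intro gZ) (simp add: Z_def)
  next
    case False
    then show ?thesis using fg[of w] that sub(3) by auto
  qed
  \<comment> \<open>The denominator of the Blaschke factor (w - \<rho>) / b for the disc of radius R
    around s0.\<close>
  define b where "b \<rho> w = of_real R - cnj (\<rho> - s0) * (w - s0) / of_real R" for \<rho> w
  define B where "B w = (\<Prod>\<rho>\<in>Z. b \<rho> w ^ m \<rho>)" for w
  have ZR: "norm (\<rho> - s0) \<le> r2" if "\<rho> \<in> Z" for \<rho>
    using that by (simp add: Z_def dist_norm norm_minus_commute)
  have bge: "norm (b \<rho> w) \<ge> R - r2 * t / R" if "\<rho> \<in> Z" "norm (w - s0) \<le> t" for \<rho> w t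
  proof -
    have "norm (cnj (\<rho> - s0) * (w - s0) / of_real R) \<le> r2 * t / R"
      unfolding norm_divide norm_mult complex_mod_cnj using ZR[OF that(1)] that(2) r
      by (simp add: divide_right_mono mult_mono)
    moreover have "norm (complex_of_real R) - norm (cnj (\<rho> - s0) * (w - s0) / of_real R) \<le> norm (b \<rho> w)"
      unfolding b_def by (rule norm_triangle_ineq2)
    ultimately show ?thesis using r by simp
  qed
  have b0: "b \<rho> w \<noteq> 0" if "\<rho> \<in> Z" "w \<in> cball s0 R" for \<rho> w
  proof -
    have "norm (w - s0) \<le> R" using that(2) by (simp add: dist_norm norm_minus_commute)
    from bge[OF that(1) this] have "norm (b \<rho> w) \<ge> R - r2" using r by simp
    then show ?thesis using r by auto
  qed
  have bsphere: "norm (b \<rho> w) = norm (w - \<rho>)" if "norm (w - s0) = R" for \<rho> w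
  proof -
    have "(w - s0) * cnj (w - s0) = of_real (R\<^sup>2)"
      using that complex_norm_square[of "w - s0"] by simp
    then have "b \<rho> w = (w - s0) / of_real R * cnj (w - \<rho>)"
      using r by (simp add: b_def field_simps power2_eq_square)
    then show ?thesis using that r by (simp add: norm_mult norm_divide flip: complex_cnj_diff)
  qed
  define G where "G w = g w * B w" for w
  have Bhol: "B holomorphic_on S" for S unfolding B_def b_def using r by (intro holomorphic_intros) auto
  have G: "G holomorphic_on ball s0 R'" unfolding G_def by (intro holomorphic_intros g Bhol)
  have GM: "norm (G w) \<le> M" if "w \<in> cball s0 R" for w
  proof (rule maximum_modulus_frontier[of G "cball s0 R"])
    show "G holomorphic_on interior (cball s0 R)" using sub(1) by (intro holomorphic_on_subset[OF G]) auto
    show "continuous_on (closure (cball s0 R)) G"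
      using sub(1) by (intro holomorphic_on_imp_continuous_on holomorphic_on_subset[OF G]) auto
    fix z assume "z \<in> frontier (cball s0 R)"
    then have z: "norm (z - s0) = R" "z \<in> cball s0 R" by (auto simp: dist_norm norm_minus_commute)
    have "norm (G z) = norm (g z) * norm (P z)"
      by (simp add: G_def B_def P_def norm_mult bsphere[OF z(1)] norm_power flip: prod_norm)
    also have "\<dots> = norm (f z)" using fg[of z] z(2) sub(1) by (auto simp: norm_mult)
    also have "\<dots> \<le> M" by (rule M[OF z(2)])
    finally show "norm (G z) \<le> M" .
  qed (use that in auto)
  have G0: "G w \<noteq> 0" if "w \<in> cball s0 r2" for w
    using g0[OF that] b0[of _ w] sub(2) that Zf by (auto simp: G_def B_def)
  \<comment> \<open>At the centre each new factor has modulus exactly R, whereas |s0 - \<rho>| \<le>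
    r2. Every zero thus gains a factor R / r2 > 1, which the bound M can afford only a limited
    number of times.\<close>
  have Bs0: "norm (B s0) = R ^ n"
    using r by (simp add: B_def b_def n_def norm_power power_sum flip: prod_norm)
  have Ps0: "norm (P s0) \<le> r2 ^ n"
  proof -
    have "norm (P s0) = (\<Prod>\<rho>\<in>Z. norm (s0 - \<rho>) ^ m \<rho>)" by (simp add: P_def norm_power flip: prod_norm)
    also have "\<dots> \<le> (\<Prod>\<rho>\<in>Z. r2 ^ m \<rho>)"
      using ZR by (intro prod_mono conjI power_mono) (auto simp: norm_minus_commute)
    finally show ?thesis by (simp add: n_def power_sum)
  qed
  have f1: "norm (f s0) \<le> norm (g s0) * r2 ^ n"
    using fg[OF s0] mult_left_mono[OF Ps0, of "norm (g s0)"] by (simp add: norm_mult)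
  have G1: "norm (G s0) = norm (g s0) * R ^ n" by (simp add: G_def norm_mult Bs0)
  have "s0 \<in> cball s0 R" using r by simp
  from GM[OF this] have G2: "norm (g s0) * R ^ n \<le> M" by (simp only: G1)
  have fp: "norm (f s0) > 0" using f0 by simp
  have fM: "norm (f s0) \<le> M" using M[of s0] r by simp
  have Mp: "M > 0" using fp fM by linarith
  have A0: "A \<ge> 0" unfolding A_def using fp fM by (intro ln_ge_zero) simp
  have lnp: "ln (R / r2) > 0" using r by simp
  have cnt: "real n \<le> A / ln (R / r2)"
  proof -
    have "norm (f s0) * (R / r2) ^ n \<le> norm (g s0) * r2 ^ n * (R / r2) ^ n"
      using r by (intro mult_right_mono f1) auto
    also have "\<dots> = norm (g s0) * R ^ n" using r by (simp add: power_divide)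
    also have "\<dots> \<le> M" by (rule G2)
    finally have "(R / r2) ^ n \<le> M / norm (f s0)" using fp by (simp add: field_simps)
    then have "ln ((R / r2) ^ n) \<le> A" unfolding A_def using r fp Mp
      by (subst ln_le_cancel_iff) auto
    also have "ln ((R / r2) ^ n) = real n * ln (R / r2)" using r by (subst ln_realpow) auto
    finally show ?thesis using lnp by (simp add: field_simps)
  qed
  then show "real (\<Sum>\<rho>\<in>Z. nat (zorder f \<rho>)) \<le> A / ln (R / r2)" by (simp add: n_def m_def)
  have dG: "(G has_field_derivative deriv G w) (at w)" if "w \<in> ball s0 r2" for w
    using that r by (intro holomorphic_derivI[OF G]) auto
  have Gq: "(\<lambda>w. deriv G w / G w) holomorphic_on ball s0 r2"
  proof (intro holomorphic_on_divide)
    have "ball s0 r2 \<subseteq> ball s0 R'" using r by auto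
    then show "G holomorphic_on ball s0 r2" "deriv G holomorphic_on ball s0 r2"
      using G holomorphic_deriv[OF G] by (auto intro: holomorphic_on_subset)
  qed (use G0 in auto)
  obtain H where H: "\<And>w. w \<in> ball s0 r2 \<Longrightarrow> (H has_field_derivative deriv G w / G w) (at w within ball s0 r2)"
    using holomorphic_convex_primitive'[OF convex_ball open_ball Gq] by blast
  have H': "(H has_field_derivative deriv G w / G w) (at w)" if "w \<in> ball s0 r2" for w
    using H[OF that] at_within_open[OF that open_ball] by simp
  have Hhol: "H holomorphic_on ball s0 r2"
    unfolding holomorphic_on_def field_differentiable_def using H by blast
  \<comment> \<open>H is a primitive of G' / G and hence, up to an additive constant, a logarithm of
    G.\<close>
  have "\<exists>c. \<forall>w\<in>ball s0 r2. G w * exp (- H w) = c"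
  proof (rule has_field_derivative_zero_constant)
    fix w assume w: "w \<in> ball s0 r2"
    have "((\<lambda>w. G w * exp (- H w)) has_field_derivative
        deriv G w * exp (- H w) + (exp (- H w) * - (deriv G w / G w)) * G w) (at w)"
      by (intro DERIV_mult dG[OF w] DERIV_chain2[OF DERIV_exp] DERIV_minus H'[OF w])
    then have "((\<lambda>w. G w * exp (- H w)) has_field_derivative 0) (at w)"
      using G0[of w] w by (simp add: field_simps)
    then show "((\<lambda>w. G w * exp (- H w)) has_field_derivative 0) (at w within ball s0 r2)"
      by (rule has_field_derivative_at_within)
  qed simp
  then obtain c where c: "\<forall>w\<in>ball s0 r2. G w * exp (- H w) = c" by (rule exE)
  have s0r: "s0 \<in> ball s0 r2" using r by simp
  \<comment> \<open>The bound A is not strict and may be 0, while Borel-Caratheodory asks for a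
    strict bound by a positive number; hence A + 1.\<close>
  have ReH: "Re (H w - H s0) < A + 1" if w: "w \<in> ball s0 r2" for w
  proof -
    have "G w * exp (- H w) = G s0 * exp (- H s0)" using c w s0r by simp
    then have "norm (G w) * exp (- Re (H w)) = norm (G s0) * exp (- Re (H s0))"
      by (metis norm_mult norm_exp_eq_Re uminus_complex.sel(1))
    then have e: "norm (G w) = norm (G s0) * exp (Re (H w) - Re (H s0))"
      by (simp add: exp_minus exp_diff field_simps)
    have "norm (f s0) \<le> norm (G s0)"
      unfolding G1 using f1 r by (intro order_trans[OF f1] mult_left_mono power_mono) auto
    then have "norm (f s0) * exp (Re (H w) - Re (H s0)) \<le> norm (G w)"
      unfolding e by (intro mult_right_mono) auto
    also have "\<dots> \<le> M" using w r by (intro GM) auto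
    finally have "exp (Re (H w) - Re (H s0)) \<le> M / norm (f s0)" using fp by (simp add: field_simps)
    then have "ln (exp (Re (H w) - Re (H s0))) \<le> A" unfolding A_def using fp Mp by (subst ln_le_cancel_iff) auto
    then show ?thesis by simp
  qed
  define E where "E w = deriv g w / g w" for w
  have dg: "(g has_field_derivative deriv g w) (at w)" if "w \<in> ball s0 r2" for w
    using that r by (intro holomorphic_derivI[OF g]) auto
  have Ehol: "E holomorphic_on ball s0 r2" unfolding E_def
  proof (intro holomorphic_on_divide)
    have "ball s0 r2 \<subseteq> ball s0 R'" using r by auto
    then show "g holomorphic_on ball s0 r2" "deriv g holomorphic_on ball s0 r2"
      using g holomorphic_deriv[OF g] by (auto intro: holomorphic_on_subset)
  qed (use g0 in auto)
  have Eb: "norm (E w) \<le> 8 * (A + 1) * r2 / (r2 - r3)\<^sup>2 + A / ln (R / r2) * (r2 / R / (R - r2 * r3 / R))"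
    if w: "w \<in> cball s0 r3" for w
  proof -
    have wr: "w \<in> ball s0 r2" "w \<in> cball s0 r2" "w \<in> cball s0 R" "norm (w - s0) \<le> r3"
      using w r by (auto simp: dist_norm norm_minus_commute)
    have db: "(b \<rho> has_field_derivative - cnj (\<rho> - s0) / of_real R) (at w)" for \<rho>
      unfolding b_def using r by (auto intro!: derivative_eq_intros simp: minus_divide_left)
    have "(B has_field_derivative B w * (\<Sum>\<rho>\<in>Z. of_nat (m \<rho>) * ((- cnj (\<rho> - s0) / of_real R) / b \<rho> w))) (at w)"
      unfolding B_def using wr(3) by (intro has_field_derivative_prod_power Zf db b0)
    from DERIV_mult[OF dg[OF wr(1)] this]
    have "(G has_field_derivative deriv g w * B w + B w * (\<Sum>\<rho>\<in>Z. of_nat (m \<rho>) * ((- cnj (\<rho> - s0) / of_real R) / b \<rho> w)) * g w) (at w)"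
      by (simp only: G_def[abs_def])
    then have d: "deriv G w = deriv g w * B w + B w * (\<Sum>\<rho>\<in>Z. of_nat (m \<rho>) * ((- cnj (\<rho> - s0) / of_real R) / b \<rho> w)) * g w"
      by (rule DERIV_imp_deriv)
    have Bw: "B w \<noteq> 0" using G0[OF wr(2)] by (auto simp: G_def)
    have "E w = deriv G w / G w - (\<Sum>\<rho>\<in>Z. of_nat (m \<rho>) * ((- cnj (\<rho> - s0) / of_real R) / b \<rho> w))"
      unfolding d using Bw g0[OF wr(2)] by (simp add: E_def G_def field_simps)
    also have "norm \<dots> \<le> norm (deriv G w / G w) + norm (\<Sum>\<rho>\<in>Z. of_nat (m \<rho>) * ((- cnj (\<rho> - s0) / of_real R) / b \<rho> w))"
      by (rule norm_triangle_ineq4)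
    also have "norm (deriv G w / G w) \<le> 8 * (A + 1) * r2 / (r2 - r3)\<^sup>2"
    proof -
      have "deriv H w = deriv G w / G w" by (rule DERIV_imp_deriv[OF H'[OF wr(1)]])
      then show ?thesis
        using Borel_Caratheodory_deriv[OF Hhol _ ReH r(1,2) w] A0 by simp
    qed
    also have "norm (\<Sum>\<rho>\<in>Z. of_nat (m \<rho>) * ((- cnj (\<rho> - s0) / of_real R) / b \<rho> w)) \<le> (\<Sum>\<rho>\<in>Z. real (m \<rho>) * (r2 / R / (R - r2 * r3 / R)))"
    proof (rule sum_norm_le)
      fix \<rho> assume \<rho>: "\<rho> \<in> Z"
      have "r2 * r3 < R * R" using r by (intro mult_strict_mono) auto
      then have pos: "R - r2 * r3 / R > 0" using r by (simp add: field_simps)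
      have "norm ((- cnj (\<rho> - s0) / of_real R) / b \<rho> w) = norm (\<rho> - s0) / R / norm (b \<rho> w)"
        unfolding norm_divide norm_minus_cancel complex_mod_cnj using r by simp
      also have "\<dots> \<le> r2 / R / (R - r2 * r3 / R)"
        using ZR[OF \<rho>] bge[OF \<rho> wr(4)] pos r by (intro frac_le divide_right_mono) auto
      finally show "norm (of_nat (m \<rho>) * ((- cnj (\<rho> - s0) / of_real R) / b \<rho> w)) \<le> real (m \<rho>) * (r2 / R / (R - r2 * r3 / R))"
        unfolding norm_mult norm_of_nat by (rule mult_left_mono) simp
    qed
    also have "\<dots> = real n * (r2 / R / (R - r2 * r3 / R))" by (simp only: n_def of_nat_sum sum_distrib_right)
    also have "\<dots> \<le> A / ln (R / r2) * (r2 / R / (R - r2 * r3 / R))"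
    proof (rule mult_right_mono[OF cnt])
      have "r2 * r3 \<le> R * R" using r by (intro mult_mono) auto
      then show "0 \<le> r2 / R / (R - r2 * r3 / R)" using r by (simp add: field_simps)
    qed
    finally show ?thesis by simp
  qed
  have fE: "deriv f w / f w = E w + (\<Sum>\<rho>\<in>Z. of_nat (m \<rho>) / (w - \<rho>))" if w: "w \<in> ball s0 r2 - Z" for w
  proof -
    have wr: "w \<in> ball s0 r2" "w \<in> cball s0 r2" "w \<in> ball s0 R'" using w r by auto
    have wZ: "w - \<rho> \<noteq> 0" if "\<rho> \<in> Z" for \<rho> using w that by auto
    have "(P has_field_derivative P w * (\<Sum>\<rho>\<in>Z. of_nat (m \<rho>) * (1 / (w - \<rho>)))) (at w)"
      unfolding P_def using wZ by (intro has_field_derivative_prod_power Zf) (auto intro!: derivative_eq_intros)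
    from DERIV_mult[OF dg[OF wr(1)] this]
    have "(f has_field_derivative deriv g w * P w + P w * (\<Sum>\<rho>\<in>Z. of_nat (m \<rho>) * (1 / (w - \<rho>))) * g w) (at w)"
      by (rule has_field_derivative_transform_within_open[OF _ open_ball wr(3)]) (simp add: fg)
    then have d: "deriv f w = deriv g w * P w + P w * (\<Sum>\<rho>\<in>Z. of_nat (m \<rho>) * (1 / (w - \<rho>))) * g w"
      by (rule DERIV_imp_deriv)
    have "P w \<noteq> 0" using wZ Zf by (auto simp: P_def)
    then have "deriv f w / f w = E w + (\<Sum>\<rho>\<in>Z. of_nat (m \<rho>) * (1 / (w - \<rho>)))"
      unfolding d fg[OF wr(3)] using g0[OF wr(2)] by (simp add: E_def field_simps)
    then show ?thesis by simp
  qed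
  show "\<exists>E. E holomorphic_on ball s0 r2
       \<and> (\<forall>w\<in>cball s0 r3. norm (E w) \<le> 8 * (A + 1) * r2 / (r2 - r3)\<^sup>2 + A / ln (R / r2) * (r2 / R / (R - r2 * r3 / R)))
       \<and> (\<forall>w\<in>ball s0 r2 - Z. deriv f w / f w = E w + (\<Sum>\<rho>\<in>Z. of_nat (nat (zorder f \<rho>)) / (w - \<rho>)))"
    using Ehol Eb fE unfolding m_def by (intro exI[of _ E] conjI ballI)
qed

end

section \<open>Zeros and logarithmic derivative of \<open>zeta\<close> near a given height\<close>

text \<open>The disc extends to the left as far as Re w = -1/2, the limit of
  \<open>norm_zeta_num_le\<close>. For T \<ge> 4 it stays at height 3/2 or more, so that dividing by
  w - 1 costs nothing. Any power of T would do, since only its logarithm is used.\<close>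

lemma norm_zeta_le:
  assumes T: "T \<ge> 4" and w: "w \<in> cball (Complex 2 T) (5/2)"
  shows "norm (zeta w) \<le> (2 + 9 * (\<Sum>n. real (Suc n) powr (-3/2))) * T\<^sup>2"
proof -
  let ?S = "\<Sum>n. real (Suc n) powr (-3/2)"
  have S0: "?S \<ge> 0" by (intro suminf_nonneg summable_Suc_powr) auto
  have d: "norm (w - Complex 2 T) \<le> 5/2" using w by (simp add: dist_norm norm_minus_commute)
  have re: "Re w \<ge> -1/2" using abs_Re_le_cmod[of "w - Complex 2 T"] d by (simp add: abs_le_iff)
  have im: "Im w \<ge> 3/2" using abs_Im_le_cmod[of "w - Complex 2 T"] d T by (simp add: abs_le_iff)
  have w1: "w \<noteq> 1" using im by auto
  have n1: "norm (w - 1) \<ge> 1" using abs_Im_le_cmod[of "w - 1"] im by simp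
  have "norm w \<le> norm (w - Complex 2 T) + norm (Complex 2 T)" using norm_triangle_ineq[of "w - Complex 2 T" "Complex 2 T"] by simp
  also have "norm (Complex 2 T) \<le> 2 + T" using cmod_le[of "Complex 2 T"] T by simp
  finally have nw: "norm w \<le> 9/2 + T" using d by simp
  have nw': "norm (w + 1) \<le> 11/2 + T" using nw norm_triangle_ineq[of w 1] by simp
  have T2: "T\<^sup>2 \<ge> 1" using T by (simp add: one_le_power)
  have "norm (zeta w) = norm (zeta_num w) / norm (w - 1)"
    using re w1 by (simp add: zeta_eq_zeta_num norm_divide)
  also have "\<dots> \<le> (1 + norm (w - 1) * (1 + ?S * norm w * norm (w + 1))) / norm (w - 1)"
    using re by (intro divide_right_mono norm_zeta_num_le) auto
  also have "\<dots> = 1 / norm (w - 1) + (1 + ?S * norm w * norm (w + 1))"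
    using n1 w1 by (simp add: add_divide_distrib)
  also have "\<dots> \<le> 1 + (1 + ?S * norm w * norm (w + 1))"
  proof -
    have "0 < norm (w - 1)" using n1 by linarith
    then have "1 / norm (w - 1) \<le> 1" using n1 by (subst divide_le_eq_1_pos)
    then show ?thesis by (rule add_right_mono)
  qed
  also have "?S * norm w * norm (w + 1) \<le> ?S * (3 * T) * (3 * T)"
    using nw nw' T S0 by (intro mult_mono) auto
  also have "1 + (1 + ?S * (3 * T) * (3 * T)) = 2 * 1 + 9 * ?S * T\<^sup>2" by (simp add: power2_eq_square)
  also have "\<dots> \<le> 2 * T\<^sup>2 + 9 * ?S * T\<^sup>2" using T2 by simp
  finally show ?thesis by (simp add: algebra_simps)
qed

lemma ln_4_ge_1: "T \<ge> 4 \<Longrightarrow> ln T \<ge> (1::real)"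
proof -
  assume T: "T \<ge> 4"
  have "ln (4::real) = 2 * ln 2" using ln_realpow[of 2 2] by simp
  moreover have "ln 4 \<le> ln T" using T by (subst ln_le_cancel_iff) auto
  ultimately show ?thesis using ln2_ge_two_thirds by linarith
qed

text \<open>The centre lies where |zeta| \<ge> 1/4. The radius is taken between 9/4, which reaches
  the left end -1/4 of the horizontal sides, and 5/2, up to which zeta has been bounded.\<close>

definition local_zeros :: "real \<Rightarrow> complex set" where
  "local_zeros T = {\<rho> \<in> cball (Complex 2 T) (19/8). zeta \<rho> = 0}"

text \<open>\<open>local_logderiv_expansion\<close> with the radii 9/4 < 19/8 < 5/2 < 21/8; the
  largest disc still misses the pole for T \<ge> 4. Zeta is at most S T^2 on the disc and at least
  1/4 at the centre, so the quantity A of that lemma is at most ln (4 S) + 2 ln T.\<close>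

lemma zeta_local_expansion:
  "\<exists>C>0. \<forall>T\<ge>4. finite (local_zeros T) \<and> real (\<Sum>\<rho>\<in>local_zeros T. nat (zorder zeta \<rho>)) \<le> C * ln T
     \<and> (\<exists>E. E holomorphic_on ball (Complex 2 T) (19/8)
       \<and> (\<forall>w\<in>cball (Complex 2 T) (9/4). norm (E w) \<le> C * ln T)
       \<and> (\<forall>w\<in>ball (Complex 2 T) (19/8) - local_zeros T.
            deriv zeta w / zeta w = E w + (\<Sum>\<rho>\<in>local_zeros T. of_nat (nat (zorder zeta \<rho>)) / (w - \<rho>))))"
proof -
  define S where "S = (2 + 9 * (\<Sum>n. real (Suc n) powr (-3/2)))"
  have "(\<Sum>n. real (Suc n) powr (-3/2)) \<ge> 0" by (intro suminf_nonneg summable_Suc_powr) auto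
  then have S2: "S \<ge> 2" unfolding S_def by simp
  define K where "K = ln (4 * S) + 2"
  have K: "K \<ge> 2" using S2 by (simp add: K_def)
  define L where "L = ln (5/2 / (19/8) :: real)"
  have L: "L > 0" by (simp add: L_def)
  define q where "q = (19/8 / (5/2) / (5/2 - 19/8 * (9/4) / (5/2)) :: real)"
  have q: "q > 0" by (simp add: q_def)
  define C where "C = K / L + (8 * (K + 1) * (19/8) / (19/8 - 9/4)\<^sup>2 + K / L * q)"
  have C: "C > 0" "C \<ge> K / L" "C \<ge> 8 * (K + 1) * (19/8) / (19/8 - 9/4)\<^sup>2 + K / L * q"
    using K L q by (auto simp: C_def intro!: add_pos_pos)
  have "finite (local_zeros T) \<and> real (\<Sum>\<rho>\<in>local_zeros T. nat (zorder zeta \<rho>)) \<le> C * ln T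
     \<and> (\<exists>E. E holomorphic_on ball (Complex 2 T) (19/8)
       \<and> (\<forall>w\<in>cball (Complex 2 T) (9/4). norm (E w) \<le> C * ln T)
       \<and> (\<forall>w\<in>ball (Complex 2 T) (19/8) - local_zeros T.
            deriv zeta w / zeta w = E w + (\<Sum>\<rho>\<in>local_zeros T. of_nat (nat (zorder zeta \<rho>)) / (w - \<rho>))))"
    if T: "T \<ge> 4" for T
  proof -
    define s0 where "s0 = Complex 2 T"
    have lnT: "ln T \<ge> 1" by (rule ln_4_ge_1[OF T])
    have z0: "norm (zeta s0) \<ge> 1/4" unfolding s0_def by (rule norm_zeta_ge_quarter) simp
    have r: "0 < (9/4::real)" "9/4 < (19/8::real)" "19/8 < (5/2::real)" "5/2 < (21/8::real)" by simp_all
    have hol: "zeta holomorphic_on ball s0 (21/8)"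
    proof (rule holomorphic_on_subset[OF zeta_holomorphic])
      have "1 \<notin> ball s0 (21/8)"
        using abs_Im_le_cmod[of "s0 - 1"] T by (auto simp: s0_def dist_norm)
      then show "ball s0 (21/8) \<subseteq> - {1}" by blast
    qed
    define M where "M = S * T\<^sup>2"
    have M: "norm (zeta w) \<le> M" if "w \<in> cball s0 (5/2)" for w
      using norm_zeta_le[OF T that[unfolded s0_def]] by (simp add: M_def S_def)
    have nz: "zeta s0 \<noteq> 0" using z0 by auto
    define A where "A = ln (M / norm (zeta s0))"
    have Mp: "M > 0" using S2 T by (simp add: M_def)
    have AK: "A \<le> K * ln T"
    proof -
      have "M / norm (zeta s0) \<le> M / (1/4)" using z0 Mp by (intro divide_left_mono) auto
      moreover have "M / norm (zeta s0) > 0" using nz Mp by simp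
      ultimately have "A \<le> ln (M / (1/4))" unfolding A_def using Mp by (subst ln_le_cancel_iff) auto
      also have "M / (1/4) = (4 * S) * T\<^sup>2" by (simp add: M_def)
      also have "ln ((4 * S) * T\<^sup>2) = ln (4 * S) + 2 * ln T" using S2 T by (simp add: ln_mult ln_realpow)
      also have "ln (4 * S) \<le> ln (4 * S) * ln T" using S2 lnT by (simp add: mult_le_cancel_left1)
      finally show ?thesis by (simp add: K_def algebra_simps)
    qed
    note loc = local_logderiv_expansion[OF r hol M nz, folded s0_def]
    have Zeq: "local_zeros T = {\<rho> \<in> cball s0 (19/8). zeta \<rho> = 0}" by (simp add: local_zeros_def s0_def)
    have fin: "finite (local_zeros T)" unfolding Zeq by (rule local_zeros_finite[OF r hol M nz])
    have "real (\<Sum>\<rho>\<in>local_zeros T. nat (zorder zeta \<rho>)) \<le> A / L"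
      unfolding Zeq L_def A_def by (rule loc(1))
    also have "\<dots> \<le> K * ln T / L" using AK L by (intro divide_right_mono) auto
    also have "\<dots> = K / L * ln T" by simp
    also have "\<dots> \<le> C * ln T" using C lnT by (intro mult_right_mono) auto
    finally have cnt: "real (\<Sum>\<rho>\<in>local_zeros T. nat (zorder zeta \<rho>)) \<le> C * ln T" .
    obtain E where E: "E holomorphic_on ball s0 (19/8)
       \<and> (\<forall>w\<in>cball s0 (9/4). norm (E w) \<le> 8 * (A + 1) * (19/8) / (19/8 - 9/4)\<^sup>2 + A / L * q)
       \<and> (\<forall>w\<in>ball s0 (19/8) - local_zeros T. deriv zeta w / zeta w = E w + (\<Sum>\<rho>\<in>local_zeros T. of_nat (nat (zorder zeta \<rho>)) / (w - \<rho>)))"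
      using loc(2) unfolding Zeq L_def A_def q_def by (rule exE)
    have le: "8 * (A + 1) * (19/8) / (19/8 - 9/4)\<^sup>2 + A / L * q \<le> C * ln T"
    proof -
      have a: "A + 1 \<le> (K + 1) * ln T" using AK lnT by (simp add: algebra_simps)
      have "8 * (A + 1) * (19/8) / (19/8 - 9/4)\<^sup>2 \<le> 8 * ((K + 1) * ln T) * (19/8) / (19/8 - 9/4)\<^sup>2"
        using a by (intro divide_right_mono mult_right_mono mult_left_mono) auto
      moreover have "A / L * q \<le> K * ln T / L * q"
        using AK L q by (intro mult_right_mono divide_right_mono) auto
      ultimately have "8 * (A + 1) * (19/8) / (19/8 - 9/4)\<^sup>2 + A / L * q
        \<le> (8 * (K + 1) * (19/8) / (19/8 - 9/4)\<^sup>2 + K / L * q) * ln T"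
        by (simp add: algebra_simps)
      also have "\<dots> \<le> C * ln T" using C(3) lnT by (intro mult_right_mono) auto
      finally show ?thesis .
    qed
    show ?thesis unfolding s0_def[symmetric]
    proof (intro conjI fin cnt exI[of _ E] ballI)
      show "E holomorphic_on ball s0 (19/8)" by (rule E[THEN conjunct1])
      fix w assume "w \<in> cball s0 (9/4)"
      from bspec[OF E[THEN conjunct2, THEN conjunct1] this] le show "norm (E w) \<le> C * ln T" by (rule order_trans)
    next
      fix w assume "w \<in> ball s0 (19/8) - local_zeros T"
      from bspec[OF E[THEN conjunct2, THEN conjunct2] this]
      show "deriv zeta w / zeta w = E w + (\<Sum>\<rho>\<in>local_zeros T. of_nat (nat (zorder zeta \<rho>)) / (w - \<rho>))" .
    qed
  qed
  then show ?thesis using C(1) by (intro exI[of _ C] conjI[of "C > 0"] allI impI)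
qed

text \<open>A point of the critical strip whose height differs from T by at most 1 has distance at
  most sqrt 5 < 19/8 from the centre 2 + \<i> T, so it belongs to
  \<open>local_zeros T\<close>.\<close>

lemma zero_order_count:
  "\<exists>C>0. \<forall>T\<ge>4. finite {\<rho> \<in> nontrivial_zeros. \<bar>Im \<rho> - T\<bar> \<le> 1}
     \<and> real (\<Sum>\<rho> | \<rho> \<in> nontrivial_zeros \<and> \<bar>Im \<rho> - T\<bar> \<le> 1. nat (zorder zeta \<rho>)) \<le> C * ln T"
proof -
  obtain C where C: "C > 0" "\<And>T. T \<ge> 4 \<Longrightarrow> finite (local_zeros T)"
    "\<And>T. T \<ge> 4 \<Longrightarrow> real (\<Sum>\<rho>\<in>local_zeros T. nat (zorder zeta \<rho>)) \<le> C * ln T"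
    using zeta_local_expansion by blast
  have sub: "{\<rho> \<in> nontrivial_zeros. \<bar>Im \<rho> - T\<bar> \<le> 1} \<subseteq> local_zeros T" for T
  proof
    fix \<rho> assume "\<rho> \<in> {\<rho> \<in> nontrivial_zeros. \<bar>Im \<rho> - T\<bar> \<le> 1}"
    then have r: "zeta \<rho> = 0" "0 < Re \<rho>" "Re \<rho> < 1" "\<bar>Im \<rho> - T\<bar> \<le> 1" by (auto simp: nontrivial_zeros_def)
    have "\<bar>2 - Re \<rho>\<bar> \<le> 2" using r by simp
    then have "(norm (Complex 2 T - \<rho>))\<^sup>2 \<le> 2\<^sup>2 + 1\<^sup>2"
      unfolding cmod_power2 using r(4) by (intro add_mono abs_le_square_iff[THEN iffD1]) (auto simp: abs_minus_commute)
    also have "\<dots> \<le> (19/8)\<^sup>2" by (simp add: power2_eq_square)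
    finally have "norm (Complex 2 T - \<rho>) \<le> 19/8" by (rule power2_le_imp_le) simp
    then show "\<rho> \<in> local_zeros T" using r by (simp add: local_zeros_def dist_norm)
  qed
  have "finite {\<rho> \<in> nontrivial_zeros. \<bar>Im \<rho> - T\<bar> \<le> 1} \<and>
     real (\<Sum>\<rho> | \<rho> \<in> nontrivial_zeros \<and> \<bar>Im \<rho> - T\<bar> \<le> 1. nat (zorder zeta \<rho>)) \<le> C * ln T" if T: "T \<ge> 4" for T
  proof
    show "finite {\<rho> \<in> nontrivial_zeros. \<bar>Im \<rho> - T\<bar> \<le> 1}" by (rule finite_subset[OF sub C(2)[OF T]])
    have "(\<Sum>\<rho> | \<rho> \<in> nontrivial_zeros \<and> \<bar>Im \<rho> - T\<bar> \<le> 1. nat (zorder zeta \<rho>)) \<le> (\<Sum>\<rho>\<in>local_zeros T. nat (zorder zeta \<rho>))"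
      by (rule sum_mono2[OF C(2)[OF T] sub]) simp
    then show "real (\<Sum>\<rho> | \<rho> \<in> nontrivial_zeros \<and> \<bar>Im \<rho> - T\<bar> \<le> 1. nat (zorder zeta \<rho>)) \<le> C * ln T"
      using C(3)[OF T] by linarith
  qed
  then show ?thesis using C(1) by (intro exI[of _ C] conjI[of "C > 0"] allI impI)
qed

section \<open>Integrals along the horizontal sides\<close>

lemma norm_Ln_le_12:
  assumes "1/4 \<le> norm z" "norm z \<le> 8"
  shows "norm (Ln z) \<le> 12"
proof -
  have z0: "z \<noteq> 0" using assms by auto
  have "norm (Ln z) \<le> \<bar>Re (Ln z)\<bar> + \<bar>Im (Ln z)\<bar>" by (rule cmod_le)
  also have "Re (Ln z) = ln (norm z)" using z0 by simp
  also have "\<bar>ln (norm z)\<bar> \<le> 8"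
  proof -
    have "ln (norm z) \<le> norm z - 1" using z0 by (intro ln_le_minus_one) simp
    moreover have "ln (inverse (norm z)) \<le> inverse (norm z) - 1" using z0 by (intro ln_le_minus_one) simp
    moreover have "inverse (norm z) \<le> inverse (1/4)" using assms(1) by (intro le_imp_inverse_le) auto
    moreover have "ln (inverse (norm z)) = - ln (norm z)" using z0 by (simp add: ln_inverse)
    ultimately show ?thesis using assms(2) by (simp add: abs_le_iff)
  qed
  also have "\<bar>Im (Ln z)\<bar> \<le> 4" using mpi_less_Im_Ln[OF z0] Im_Ln_le_pi[OF z0] pi_less_4 by (simp add: abs_le_iff)
  finally show ?thesis by simp
qed

lemma horizontal_segment:
  assumes "s \<in> closed_segment (Complex a T) (Complex b T)" "a \<le> b"
  shows "Im s = T" "a \<le> Re s" "Re s \<le> b"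
proof -
  obtain u where u: "0 \<le> u" "u \<le> 1" "s = (1 - u) *\<^sub>R Complex a T + u *\<^sub>R Complex b T"
    using assms(1) unfolding in_segment by (elim exE conjE)
  have "Im s = (1 - u) * T + u * T" using u(3) by simp
  then show "Im s = T" by (simp add: algebra_simps)
  have re: "Re s = (1 - u) * a + u * b" using u(3) by simp
  have "0 \<le> u * (b - a)" "0 \<le> (1 - u) * (b - a)" using u assms(2) by auto
  then show "a \<le> Re s" "Re s \<le> b" unfolding re by (simp_all add: algebra_simps)
qed

text \<open>Subtract and add the value of the exponential at \<rho>. The difference quotient is
  bounded by a Lipschitz constant however close \<rho> is to the segment. For the rest, Ln (s -
  \<rho>) is a primitive of 1 / (s - \<rho>), because Im \<rho> \<noteq> T keeps s - \<rho> off the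
  branch cut. Only the end points enter then, and these are at horizontal distance at least 1/4 from
  \<rho>, since 0 < Re \<rho> < 1; each logarithm is at most 12.\<close>

lemma norm_horizontal_Cauchy_integral_le:
  fixes \<kappa> T :: real
  assumes \<kappa>: "\<kappa> \<ge> 0" and \<rho>: "0 < Re \<rho>" "Re \<rho> < 1" "Im \<rho> \<noteq> T" "norm (\<rho> - Complex 2 T) \<le> 19/8"
  shows "norm (contour_integral (linepath (Complex (-1/4) T) (Complex (5/4) T)) (\<lambda>s. exp (of_real \<kappa> * s) / (s - \<rho>)))
     \<le> (2 * \<kappa> + 24) * exp (2 * \<kappa>)"
proof -
  define a b where "a = Complex (-1/4) T" and "b = Complex (5/4) T"
  let ?p = "linepath a b" and ?S = "closed_segment a b"
  define G where "G s = exp (of_real \<kappa> * s)" for s :: complex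
  have S: "Im s = T" "-1/4 \<le> Re s" "Re s \<le> 5/4" if "s \<in> ?S" for s
    using horizontal_segment[of s "-1/4" T "5/4"] that by (auto simp: a_def b_def)
  have nz: "s - \<rho> \<noteq> 0" "s - \<rho> \<notin> \<real>\<^sub>\<le>\<^sub>0" if "s \<in> ?S" for s
    using S[OF that] \<rho> by (auto simp: complex_nonpos_Reals_iff)
  have nG: "norm (G s) \<le> exp (2 * \<kappa>)" if "Re s \<le> 2" for s
    using mult_left_mono[OF that \<kappa>] by (simp add: G_def norm_exp_eq_Re mult.commute)
  let ?H = "{s. Re s \<le> 2}"
  have Lip: "norm (G s - G \<rho>) \<le> \<kappa> * exp (2 * \<kappa>) * norm (s - \<rho>)" if "s \<in> ?S" for s
  proof (rule field_differentiable_bound[where S = ?H and f = G and f' = "\<lambda>s. of_real \<kappa> * G s"])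
    show "convex ?H" by (rule convex_halfspace_Re_le)
    show "(G has_field_derivative of_real \<kappa> * G z) (at z within ?H)" for z
      unfolding G_def by (auto intro!: derivative_eq_intros)
    show "norm (of_real \<kappa> * G z) \<le> \<kappa> * exp (2 * \<kappa>)" if "z \<in> ?H" for z
      unfolding norm_mult using nG[of z] that \<kappa> by (simp add: mult_left_mono)
  qed (use S[OF that] \<rho> in auto)
  have c1: "continuous_on ?S (\<lambda>s. (G s - G \<rho>) / (s - \<rho>))" and c2: "continuous_on ?S (\<lambda>s. 1 / (s - \<rho>))"
    unfolding G_def by (intro continuous_intros; use nz in auto)+
  have "contour_integral ?p (\<lambda>s. G s / (s - \<rho>)) = contour_integral ?p (\<lambda>s. (G s - G \<rho>) / (s - \<rho>) + G \<rho> * (1 / (s - \<rho>)))"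
    by (simp add: diff_divide_distrib)
  also have "\<dots> = contour_integral ?p (\<lambda>s. (G s - G \<rho>) / (s - \<rho>)) + contour_integral ?p (\<lambda>s. G \<rho> * (1 / (s - \<rho>)))"
    by (intro contour_integral_add contour_integrable_continuous_linepath c1 continuous_on_mult continuous_on_const c2)
  also have "contour_integral ?p (\<lambda>s. G \<rho> * (1 / (s - \<rho>))) = G \<rho> * contour_integral ?p (\<lambda>s. 1 / (s - \<rho>))"
    by (intro contour_integral_lmul contour_integrable_continuous_linepath c2)
  also have "contour_integral ?p (\<lambda>s. 1 / (s - \<rho>)) = Ln (b - \<rho>) - Ln (a - \<rho>)"
  proof -
    have "((\<lambda>s. 1 / (s - \<rho>)) has_contour_integral (Ln (pathfinish ?p - \<rho>) - Ln (pathstart ?p - \<rho>))) ?p"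
    proof (rule contour_integral_primitive[where S = ?S])
      show "((\<lambda>s. Ln (s - \<rho>)) has_field_derivative 1 / (s - \<rho>)) (at s within ?S)" if "s \<in> ?S" for s
        using nz[OF that] by (auto intro!: derivative_eq_intros simp: divide_inverse)
    qed auto
    then show ?thesis by (simp add: contour_integral_unique)
  qed
  finally have e: "contour_integral ?p (\<lambda>s. G s / (s - \<rho>)) = contour_integral ?p (\<lambda>s. (G s - G \<rho>) / (s - \<rho>)) + G \<rho> * (Ln (b - \<rho>) - Ln (a - \<rho>))" .
  have ba: "norm (b - a) = 3/2" by (simp add: a_def b_def cmod_def)
  have "norm (contour_integral ?p (\<lambda>s. (G s - G \<rho>) / (s - \<rho>))) \<le> \<kappa> * exp (2 * \<kappa>) * norm (b - a)"
  proof (rule contour_integral_bound_linepath)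
    show "(\<lambda>s. (G s - G \<rho>) / (s - \<rho>)) contour_integrable_on ?p" by (intro contour_integrable_continuous_linepath c1)
    fix s assume s: "s \<in> ?S"
    show "norm ((G s - G \<rho>) / (s - \<rho>)) \<le> \<kappa> * exp (2 * \<kappa>)"
      unfolding norm_divide using Lip[OF s] nz(1)[OF s] by (simp add: divide_le_eq)
  qed (use \<kappa> in auto)
  also have "\<dots> \<le> \<kappa> * exp (2 * \<kappa>) * 2" unfolding ba using \<kappa> by (intro mult_left_mono) auto
  finally have 1: "norm (contour_integral ?p (\<lambda>s. (G s - G \<rho>) / (s - \<rho>))) \<le> 2 * \<kappa> * exp (2 * \<kappa>)" by simp
  have Lz: "norm (Ln (z - \<rho>)) \<le> 12" if z: "norm (z - Complex 2 T) \<le> 9/4" "\<bar>Re (z - \<rho>)\<bar> \<ge> 1/4" for z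
  proof (rule norm_Ln_le_12)
    show "1/4 \<le> norm (z - \<rho>)" using z(2) abs_Re_le_cmod[of "z - \<rho>"] by linarith
    have "norm (z - \<rho>) \<le> norm (z - Complex 2 T) + norm (\<rho> - Complex 2 T)"
      using norm_triangle_ineq4[of "z - Complex 2 T" "\<rho> - Complex 2 T"] by simp
    then show "norm (z - \<rho>) \<le> 8" using z(1) \<rho>(4) by simp
  qed
  have La: "norm (Ln (a - \<rho>)) \<le> 12" by (rule Lz) (use \<rho> in \<open>auto simp: a_def cmod_def abs_if\<close>)
  have Lb: "norm (Ln (b - \<rho>)) \<le> 12" by (rule Lz) (use \<rho> in \<open>auto simp: b_def cmod_def abs_if\<close>)
  have "norm (G \<rho> * (Ln (b - \<rho>) - Ln (a - \<rho>))) \<le> exp (2 * \<kappa>) * 24"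
    unfolding norm_mult using La Lb norm_triangle_ineq4[of "Ln (b - \<rho>)" "Ln (a - \<rho>)"] \<rho>
    by (intro mult_mono nG) auto
  then have "norm (contour_integral ?p (\<lambda>s. G s / (s - \<rho>))) \<le> 2 * \<kappa> * exp (2 * \<kappa>) + exp (2 * \<kappa>) * 24"
    unfolding e using 1 by (intro order_trans[OF norm_triangle_ineq] add_mono)
  then show ?thesis by (simp add: G_def a_def b_def algebra_simps)
qed

lemma horizontal_integral_exp_logderiv:
  assumes \<kappa>: "\<kappa> \<ge> 0"
  shows "\<exists>C. \<forall>T\<ge>4. (\<forall>\<rho>\<in>nontrivial_zeros. Im \<rho> \<noteq> T) \<longrightarrow>
     norm (contour_integral (linepath (Complex (-1/4) T) (Complex (5/4) T)) (\<lambda>s. exp (of_real \<kappa> * s) * (deriv zeta s / zeta s))) \<le> C * ln T"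
proof -
  obtain C where C: "C > 0" "\<forall>T\<ge>4. finite (local_zeros T) \<and> real (\<Sum>\<rho>\<in>local_zeros T. nat (zorder zeta \<rho>)) \<le> C * ln T
     \<and> (\<exists>E. E holomorphic_on ball (Complex 2 T) (19/8)
       \<and> (\<forall>w\<in>cball (Complex 2 T) (9/4). norm (E w) \<le> C * ln T)
       \<and> (\<forall>w\<in>ball (Complex 2 T) (19/8) - local_zeros T.
            deriv zeta w / zeta w = E w + (\<Sum>\<rho>\<in>local_zeros T. of_nat (nat (zorder zeta \<rho>)) / (w - \<rho>))))"
    using zeta_local_expansion by (elim exE conjE)
  define D where "D = 2 * exp (2 * \<kappa>) * C + (2 * \<kappa> + 24) * exp (2 * \<kappa>) * C"
  have "norm (contour_integral (linepath (Complex (-1/4) T) (Complex (5/4) T)) (\<lambda>s. exp (of_real \<kappa> * s) * (deriv zeta s / zeta s))) \<le> D * ln T"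
    if T: "T \<ge> 4" and noz: "\<forall>\<rho>\<in>nontrivial_zeros. Im \<rho> \<noteq> T" for T
  proof -
    let ?Z = "local_zeros T"
    note CT = C(2)[rule_format, OF T]
    note fin = CT[THEN conjunct1] and cnt = CT[THEN conjunct2, THEN conjunct1]
    obtain E where E: "E holomorphic_on ball (Complex 2 T) (19/8)
       \<and> (\<forall>w\<in>cball (Complex 2 T) (9/4). norm (E w) \<le> C * ln T)
       \<and> (\<forall>w\<in>ball (Complex 2 T) (19/8) - local_zeros T.
            deriv zeta w / zeta w = E w + (\<Sum>\<rho>\<in>local_zeros T. of_nat (nat (zorder zeta \<rho>)) / (w - \<rho>)))"
      using CT[THEN conjunct2, THEN conjunct2] by (rule exE)
    note Eh = E[THEN conjunct1] and Eb = E[THEN conjunct2, THEN conjunct1] and Ez = E[THEN conjunct2, THEN conjunct2]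
    have lnT: "ln T \<ge> 1" by (rule ln_4_ge_1[OF T])
    define a b where "a = Complex (-1/4) T" and "b = Complex (5/4) T"
    let ?p = "linepath a b" and ?S = "closed_segment a b"
    define G where "G s = exp (of_real \<kappa> * s)" for s :: complex
    have S: "Im s = T" "-1/4 \<le> Re s" "Re s \<le> 5/4" if "s \<in> ?S" for s
      using horizontal_segment[of s "-1/4" T "5/4"] that by (auto simp: a_def b_def)
    have Sball: "s \<in> cball (Complex 2 T) (9/4)" "s \<in> ball (Complex 2 T) (19/8)" if "s \<in> ?S" for s
    proof -
      have "norm (Complex 2 T - s) = \<bar>2 - Re s\<bar>" using S[OF that] by (simp add: cmod_def)
      then show "s \<in> cball (Complex 2 T) (9/4)" "s \<in> ball (Complex 2 T) (19/8)"
        using S[OF that] by (auto simp: dist_norm)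
    qed
    \<comment> \<open>The disc is wider than the critical strip, but its zeros are not: they satisfy
      Re \<rho> > -1 and Im \<rho> \<noteq> 0. So the assumption on \<open>nontrivial_zeros\<close>
      keeps all local zeros off the segment.\<close>
    have Zstrip: "\<rho> \<in> nontrivial_zeros" "norm (\<rho> - Complex 2 T) \<le> 19/8" if "\<rho> \<in> ?Z" for \<rho>
    proof -
      have z: "zeta \<rho> = 0" and d: "norm (\<rho> - Complex 2 T) \<le> 19/8"
        using that by (auto simp: local_zeros_def dist_norm norm_minus_commute)
      have re: "Re \<rho> > -1" using abs_Re_le_cmod[of "\<rho> - Complex 2 T"] d by (simp add: abs_le_iff)
      have im: "Im \<rho> \<noteq> 0" using abs_Im_le_cmod[of "\<rho> - Complex 2 T"] d T by auto
      show "\<rho> \<in> nontrivial_zeros" using zeta_eq_0_imp_critical_strip[OF z re im] z by (simp add: nontrivial_zeros_def)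
      show "norm (\<rho> - Complex 2 T) \<le> 19/8" by (rule d)
    qed
    have ImZ: "Im \<rho> \<noteq> T" if "\<rho> \<in> ?Z" for \<rho> using noz Zstrip(1)[OF that] by (rule bspec)
    have SZ: "s \<notin> ?Z" "s - \<rho> \<noteq> 0" if "s \<in> ?S" "\<rho> \<in> ?Z" for s \<rho>
      using S(1)[OF that(1)] ImZ ImZ[OF that(2)] by auto
    have SZ': "s \<notin> ?Z" if "s \<in> ?S" for s using S(1)[OF that] ImZ by auto
    have nG: "norm (G s) \<le> exp (2 * \<kappa>)" if "s \<in> ?S" for s
      using mult_left_mono[of "Re s" 2 \<kappa>] S(3)[OF that] \<kappa> by (simp add: G_def norm_exp_eq_Re mult.commute)
    have eq: "G s * (deriv zeta s / zeta s) = G s * E s + (\<Sum>\<rho>\<in>?Z. of_nat (nat (zorder zeta \<rho>)) * (G s / (s - \<rho>)))" if "s \<in> ?S" for s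
    proof -
      have "s \<in> ball (Complex 2 T) (19/8) - ?Z" using Sball(2)[OF that] SZ'[OF that] by blast
      from bspec[OF Ez this] show ?thesis by (simp add: distrib_left sum_distrib_left mult_ac)
    qed
    have cE: "continuous_on ?S (\<lambda>s. G s * E s)"
      unfolding G_def using Sball(2) by (intro continuous_intros continuous_on_subset[OF holomorphic_on_imp_continuous_on[OF Eh]]) auto
    have cZ: "continuous_on ?S (\<lambda>s. G s / (s - \<rho>))" if "\<rho> \<in> ?Z" for \<rho>
      unfolding G_def using SZ(2)[OF _ that] by (intro continuous_intros) auto
    have iZ: "(\<lambda>s. of_nat (nat (zorder zeta \<rho>)) * (G s / (s - \<rho>))) contour_integrable_on ?p" if "\<rho> \<in> ?Z" for \<rho>
      by (intro contour_integrable_continuous_linepath continuous_on_mult continuous_on_const cZ[OF that])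
    have "contour_integral ?p (\<lambda>s. G s * (deriv zeta s / zeta s)) = contour_integral ?p (\<lambda>s. G s * E s + (\<Sum>\<rho>\<in>?Z. of_nat (nat (zorder zeta \<rho>)) * (G s / (s - \<rho>))))"
      by (rule contour_integral_eq) (use eq in simp)
    also have "\<dots> = contour_integral ?p (\<lambda>s. G s * E s) + contour_integral ?p (\<lambda>s. \<Sum>\<rho>\<in>?Z. of_nat (nat (zorder zeta \<rho>)) * (G s / (s - \<rho>)))"
      by (intro contour_integral_add contour_integrable_continuous_linepath cE contour_integrable_sum fin iZ)
    also have "contour_integral ?p (\<lambda>s. \<Sum>\<rho>\<in>?Z. of_nat (nat (zorder zeta \<rho>)) * (G s / (s - \<rho>)))
       = (\<Sum>\<rho>\<in>?Z. contour_integral ?p (\<lambda>s. of_nat (nat (zorder zeta \<rho>)) * (G s / (s - \<rho>))))"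
      by (intro contour_integral_sum fin iZ)
    also have "\<dots> = (\<Sum>\<rho>\<in>?Z. of_nat (nat (zorder zeta \<rho>)) * contour_integral ?p (\<lambda>s. G s / (s - \<rho>)))"
      by (intro sum.cong refl contour_integral_lmul contour_integrable_continuous_linepath cZ)
    finally have e: "contour_integral ?p (\<lambda>s. G s * (deriv zeta s / zeta s))
       = contour_integral ?p (\<lambda>s. G s * E s) + (\<Sum>\<rho>\<in>?Z. of_nat (nat (zorder zeta \<rho>)) * contour_integral ?p (\<lambda>s. G s / (s - \<rho>)))" .
    have ba: "norm (b - a) \<le> 2" by (simp add: a_def b_def cmod_def)
    have "norm (contour_integral ?p (\<lambda>s. G s * E s)) \<le> exp (2 * \<kappa>) * (C * ln T) * norm (b - a)"
    proof (rule contour_integral_bound_linepath)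
      show "(\<lambda>s. G s * E s) contour_integrable_on ?p" by (intro contour_integrable_continuous_linepath cE)
      show "norm (G s * E s) \<le> exp (2 * \<kappa>) * (C * ln T)" if "s \<in> ?S" for s
        unfolding norm_mult using nG[OF that] bspec[OF Eb Sball(1)[OF that]] by (intro mult_mono) auto
    qed (use C lnT in auto)
    also have "\<dots> \<le> exp (2 * \<kappa>) * (C * ln T) * 2" using C lnT by (intro mult_left_mono ba) auto
    finally have 1: "norm (contour_integral ?p (\<lambda>s. G s * E s)) \<le> 2 * exp (2 * \<kappa>) * C * ln T" by simp
    have "norm (\<Sum>\<rho>\<in>?Z. of_nat (nat (zorder zeta \<rho>)) * contour_integral ?p (\<lambda>s. G s / (s - \<rho>)))
       \<le> (\<Sum>\<rho>\<in>?Z. real (nat (zorder zeta \<rho>)) * ((2 * \<kappa> + 24) * exp (2 * \<kappa>)))"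
    proof (rule sum_norm_le)
      fix \<rho> assume \<rho>: "\<rho> \<in> ?Z"
      have "norm (contour_integral ?p (\<lambda>s. G s / (s - \<rho>))) \<le> (2 * \<kappa> + 24) * exp (2 * \<kappa>)"
        unfolding G_def a_def b_def using Zstrip[OF \<rho>] ImZ[OF \<rho>] \<kappa>
        by (intro norm_horizontal_Cauchy_integral_le) (auto simp: nontrivial_zeros_def)
      then show "norm (of_nat (nat (zorder zeta \<rho>)) * contour_integral ?p (\<lambda>s. G s / (s - \<rho>)))
         \<le> real (nat (zorder zeta \<rho>)) * ((2 * \<kappa> + 24) * exp (2 * \<kappa>))"
        unfolding norm_mult norm_of_nat by (intro mult_left_mono) auto
    qed
    also have "\<dots> = real (\<Sum>\<rho>\<in>?Z. nat (zorder zeta \<rho>)) * ((2 * \<kappa> + 24) * exp (2 * \<kappa>))"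
      unfolding of_nat_sum by (rule sum_distrib_right[symmetric])
    also have "\<dots> \<le> (C * ln T) * ((2 * \<kappa> + 24) * exp (2 * \<kappa>))"
      using \<kappa> by (intro mult_right_mono cnt) auto
    finally have 2: "norm (\<Sum>\<rho>\<in>?Z. of_nat (nat (zorder zeta \<rho>)) * contour_integral ?p (\<lambda>s. G s / (s - \<rho>)))
       \<le> (C * ln T) * ((2 * \<kappa> + 24) * exp (2 * \<kappa>))" .
    have "norm (contour_integral ?p (\<lambda>s. G s * (deriv zeta s / zeta s))) \<le> 2 * exp (2 * \<kappa>) * C * ln T + (C * ln T) * ((2 * \<kappa> + 24) * exp (2 * \<kappa>))"
      unfolding e using 1 2 by (intro order_trans[OF norm_triangle_ineq] add_mono)
    also have "\<dots> = D * ln T" by (simp add: D_def algebra_simps)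
    finally show ?thesis by (simp only: G_def a_def b_def)
  qed
  then show ?thesis by (intro exI[of _ D] allI impI)
qed

section \<open>Sums over zeros\<close>

text \<open>The zeros of a nonconstant holomorphic function cannot accumulate in its connected
  domain. If zeta had the constant value c, then \<open>zeta_num\<close> would equal c (s - 1) near
  1 and tend to 0 there, while its value at 1 is 1.\<close>

lemma zeta_zeros_compact_finite:
  assumes "compact K" "1 \<notin> K"
  shows "finite {\<rho> \<in> K. zeta \<rho> = 0}"
proof (rule holomorphic_compact_finite_zeros[OF zeta_holomorphic])
  show "connected (- {1 :: complex})" by (rule connected_punctured_universe) simp
  show "\<not> zeta constant_on - {1}"
  proof
    assume "zeta constant_on - {1}"
    then obtain c where c: "\<And>s. s \<noteq> 1 \<Longrightarrow> zeta s = c" unfolding constant_on_def by auto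
    have cont: "isCont zeta_num 1"
      using holomorphic_on_imp_continuous_on[OF zeta_num_holomorphic]
      by (rule continuous_on_interior) (simp add: interior_open open_halfspace_Re_gt)
    have "((\<lambda>s. c * (s - 1)) \<longlongrightarrow> c * (1 - 1)) (at 1)" by (intro tendsto_intros)
    moreover have "\<forall>\<^sub>F s in at 1. c * (s - 1) = zeta_num s"
    proof -
      have "\<forall>\<^sub>F s in at 1. s \<in> {s. Re s > -1} - {1 :: complex}"
        by (rule eventually_at_in_open) (auto simp: open_halfspace_Re_gt)
      then show ?thesis
      proof eventually_elim
        case (elim s)
        then have "zeta s = zeta_num s / (s - 1)" "s \<noteq> 1" by (auto intro: zeta_eq_zeta_num)
        then show ?case using c[of s] by simp
      qed
    qed
    ultimately have "(zeta_num \<longlongrightarrow> c * (1 - 1)) (at 1)" by (rule Lim_transform_eventually)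
    moreover have "(zeta_num \<longlongrightarrow> 1) (at 1)" using cont by (simp add: isCont_def zeta_num_1)
    ultimately have "c * (1 - 1) = 1" by (rule tendsto_unique[OF at_neq_bot])
    then show False by simp
  qed
qed (use assms in auto)

text \<open>If the window contains height 0, the closed strip touches the pole at 1. As
  \<open>zeta_num\<close> is nonzero near 1, a small ball around 1 contains no zero and can be cut
  out, which leaves a compact set inside the domain of holomorphy.\<close>

lemma finite_nontrivial_zeros: "finite {\<rho> \<in> nontrivial_zeros. A \<le> Im \<rho> \<and> Im \<rho> \<le> B}"
proof -
  have nb: "\<exists>e>0. \<forall>\<rho>\<in>nontrivial_zeros. norm (\<rho> - 1) \<ge> e"
  proof -
    have "isCont zeta_num 1"
      using holomorphic_on_imp_continuous_on[OF zeta_num_holomorphic]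
      by (rule continuous_on_interior) (simp add: interior_open open_halfspace_Re_gt)
    then have "\<forall>\<^sub>F s in at 1. zeta_num s \<noteq> 0"
      by (intro tendsto_imp_eventually_ne[of _ "zeta_num 1"]) (auto simp: isCont_def zeta_num_1)
    then obtain e where e: "e > 0" "\<And>s. s \<noteq> 1 \<Longrightarrow> dist s 1 < e \<Longrightarrow> zeta_num s \<noteq> 0"
      unfolding eventually_at by auto
    have "norm (\<rho> - 1) \<ge> e" if "\<rho> \<in> nontrivial_zeros" for \<rho>
    proof (rule ccontr)
      assume "\<not> norm (\<rho> - 1) \<ge> e"
      moreover have r: "zeta \<rho> = 0" "Re \<rho> > -1" "\<rho> \<noteq> 1" using that by (auto simp: nontrivial_zeros_def)
      ultimately have "zeta_num \<rho> \<noteq> 0" by (intro e(2)) (auto simp: dist_norm)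
      then show False using r by (simp add: zeta_eq_zeta_num)
    qed
    then show ?thesis using e(1) by blast
  qed
  then obtain e where e: "e > 0" "\<And>\<rho>. \<rho> \<in> nontrivial_zeros \<Longrightarrow> norm (\<rho> - 1) \<ge> e" by blast
  let ?K = "cbox (Complex 0 A) (Complex 1 B) - ball 1 e"
  have "finite {\<rho> \<in> ?K. zeta \<rho> = 0}"
    by (rule zeta_zeros_compact_finite) (use e in \<open>auto intro: compact_diff\<close>)
  moreover have "{\<rho> \<in> nontrivial_zeros. A \<le> Im \<rho> \<and> Im \<rho> \<le> B} \<subseteq> {\<rho> \<in> ?K. zeta \<rho> = 0}"
    using e(2) by (auto simp: nontrivial_zeros_def in_cbox_complex_iff dist_norm norm_minus_commute not_less)
  ultimately show ?thesis by (rule finite_subset[rotated])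
qed

text \<open>Argument principle with weight h. The contour carries no zero, because its vertical
  sides lie outside the critical strip and its heights are zero-free. The top and left integrals are
  taken in the direction of increasing coordinate, against the orientation of the contour, hence the
  minus signs.\<close>

lemma zeros_sum_contour:
  fixes h :: "complex \<Rightarrow> complex"
  assumes h: "h holomorphic_on UNIV" and t: "4 \<le> t0" "t0 < T"
    and nz: "\<forall>\<rho>\<in>nontrivial_zeros. Im \<rho> \<noteq> t0" "\<forall>\<rho>\<in>nontrivial_zeros. Im \<rho> \<noteq> T"
  defines "F \<equiv> \<lambda>s. h s * (deriv zeta s / zeta s)"
  shows "2 * of_real pi * \<i> * (\<Sum>\<rho> | \<rho> \<in> nontrivial_zeros \<and> t0 < Im \<rho> \<and> Im \<rho> < T. of_nat (nat (zorder zeta \<rho>)) * h \<rho>)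
    = contour_integral (linepath (Complex (-1/4) t0) (Complex (5/4) t0)) F
    + contour_integral (linepath (Complex (5/4) t0) (Complex (5/4) T)) F
    - contour_integral (linepath (Complex (-1/4) T) (Complex (5/4) T)) F
    - contour_integral (linepath (Complex (-1/4) t0) (Complex (-1/4) T)) F"
proof -
  define a1 a2 a3 a4 where "a1 = Complex (-1/4) t0" and "a2 = Complex (5/4) t0" and "a3 = Complex (5/4) T" and "a4 = Complex (-1/4) T"
  define S where "S = box (Complex (-1/2) (t0 - 1)) (Complex (3/2) (T + 1))"
  \<comment> \<open>The open box S is larger than the rectangle, so it can contain zeros outside the
    contour; these get winding number 0. The empty set is the set of poles as
    \<open>argument_principle\<close> expects it, S being away from 1.\<close>
  define pz where "pz = {w \<in> S. zeta w = 0 \<or> w \<in> {}}"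
  let ?g = "rectpath a1 a3"
  have memS: "w \<in> S \<longleftrightarrow> -1/2 < Re w \<and> Re w < 3/2 \<and> t0 - 1 < Im w \<and> Im w < T + 1" for w
    by (simp add: S_def in_box_complex_iff)
  have S1: "S \<subseteq> - {1}" using t by (auto simp: memS)
  have zS: "w \<in> nontrivial_zeros" if "w \<in> S" "zeta w = 0" for w
  proof -
    have "-1 < Re w" "Im w \<noteq> 0" using that(1) t by (auto simp: memS)
    then show ?thesis using zeta_eq_0_imp_critical_strip[OF that(2)] that(2) by (simp add: nontrivial_zeros_def)
  qed
  have img: "path_image ?g \<subseteq> {w. (Re w \<in> {-1/4, 5/4} \<and> t0 \<le> Im w \<and> Im w \<le> T) \<or> (Im w \<in> {t0, T} \<and> -1/4 \<le> Re w \<and> Re w \<le> 5/4)}"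
    using t by (subst path_image_rectpath) (auto simp: a1_def a3_def)
  have pathz: "zeta w \<noteq> 0" "w \<in> S" if "w \<in> path_image ?g" for w
  proof -
    have w: "(Re w \<in> {-1/4, 5/4} \<and> t0 \<le> Im w \<and> Im w \<le> T) \<or> (Im w \<in> {t0, T} \<and> -1/4 \<le> Re w \<and> Re w \<le> 5/4)"
      using subsetD[OF img that] by simp
    then show "w \<in> S" using t by (auto simp: memS)
    show "zeta w \<noteq> 0"
    proof
      assume z: "zeta w = 0"
      have "w \<in> nontrivial_zeros" by (rule zS[OF \<open>w \<in> S\<close> z])
      then show False using w nz by (auto simp: nontrivial_zeros_def)
    qed
  qed
  have fin: "finite pz"
  proof (rule finite_subset)
    show "pz \<subseteq> {\<rho> \<in> nontrivial_zeros. t0 - 1 \<le> Im \<rho> \<and> Im \<rho> \<le> T + 1}" using zS by (auto simp: pz_def memS)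
    show "finite {\<rho> \<in> nontrivial_zeros. t0 - 1 \<le> Im \<rho> \<and> Im \<rho> \<le> T + 1}" by (rule finite_nontrivial_zeros)
  qed
  have arg: "contour_integral ?g (\<lambda>x. deriv zeta x * h x / zeta x) = 2 * pi * \<i> * (\<Sum>p\<in>pz. winding_number ?g p * h p * zorder zeta p)"
    unfolding pz_def
  proof (rule argument_principle)
    show "open S" "connected S" by (auto simp: S_def convex_connected convex_box)
    show "zeta holomorphic_on S - {}" using S1 by (intro holomorphic_on_subset[OF zeta_holomorphic]) auto
    show "h holomorphic_on S" using h by (rule holomorphic_on_subset) auto
    show "path_image ?g \<subseteq> S - {w \<in> S. zeta w = 0 \<or> w \<in> {}}" using pathz by auto
    show "\<forall>z. z \<notin> S \<longrightarrow> winding_number ?g z = 0"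
    proof (intro allI impI)
      fix z assume "z \<notin> S"
      then have "z \<notin> cbox a1 a3" by (auto simp: memS a1_def a3_def in_cbox_complex_iff)
      then show "winding_number ?g z = 0" using t by (intro winding_number_rectpath_outside) (auto simp: a1_def a3_def)
    qed
    show "finite {w \<in> S. zeta w = 0 \<or> w \<in> {}}" using fin by (simp add: pz_def)
  qed auto
  have wn: "winding_number ?g p = (if t0 < Im p \<and> Im p < T then 1 else 0)" if "p \<in> pz" for p
  proof -
    have p: "p \<in> S" "p \<in> nontrivial_zeros" using that zS by (auto simp: pz_def)
    then have re: "0 < Re p" "Re p < 1" and im: "Im p \<noteq> t0" "Im p \<noteq> T" using nz by (auto simp: nontrivial_zeros_def)
    show ?thesis
    proof (cases "t0 < Im p \<and> Im p < T")
      case True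
      then have "p \<in> box a1 a3" using re by (simp add: in_box_complex_iff a1_def a3_def)
      then show ?thesis using True by (simp add: winding_number_rectpath)
    next
      case False
      then have "p \<notin> cbox a1 a3" using im by (auto simp: in_cbox_complex_iff a1_def a3_def)
      then have "winding_number ?g p = 0" using t by (intro winding_number_rectpath_outside) (auto simp: a1_def a3_def)
      then show ?thesis using False by simp
    qed
  qed
  have zo: "of_int (zorder zeta p) = (of_nat (nat (zorder zeta p)) :: complex)" if "p \<in> pz" for p
  proof -
    have "p \<noteq> 1" using that S1 by (auto simp: pz_def)
    from zeta_logderiv_tendsto_zorder(2)[OF this] show ?thesis by simp
  qed
  have "(\<Sum>p\<in>pz. winding_number ?g p * h p * zorder zeta p)
      = (\<Sum>p\<in>pz. if t0 < Im p \<and> Im p < T then of_nat (nat (zorder zeta p)) * h p else 0)"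
    by (intro sum.cong refl) (simp add: wn zo del: of_nat_nat)
  also have "\<dots> = (\<Sum>p | p \<in> pz \<and> t0 < Im p \<and> Im p < T. of_nat (nat (zorder zeta p)) * h p)"
    using fin by (simp add: sum.If_cases Int_def)
  also have "{p. p \<in> pz \<and> t0 < Im p \<and> Im p < T} = {\<rho>. \<rho> \<in> nontrivial_zeros \<and> t0 < Im \<rho> \<and> Im \<rho> < T}"
    using zS by (auto simp: pz_def memS nontrivial_zeros_def)
  finally have sum: "(\<Sum>p\<in>pz. winding_number ?g p * h p * zorder zeta p)
     = (\<Sum>\<rho> | \<rho> \<in> nontrivial_zeros \<and> t0 < Im \<rho> \<and> Im \<rho> < T. of_nat (nat (zorder zeta \<rho>)) * h \<rho>)" .
  have Fe: "(\<lambda>x. deriv zeta x * h x / zeta x) = F" by (simp add: F_def fun_eq_iff)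
  have contF: "continuous_on (path_image ?g) F"
    unfolding F_def
  proof (intro continuous_on_mult continuous_on_divide)
    show "continuous_on (path_image ?g) h"
      by (rule continuous_on_subset[OF holomorphic_on_imp_continuous_on[OF h]]) auto
    have "path_image ?g \<subseteq> - {1}" using pathz(2) S1 by blast
    then show "continuous_on (path_image ?g) zeta" "continuous_on (path_image ?g) (deriv zeta)"
      using holomorphic_on_imp_continuous_on[OF zeta_holomorphic]
        holomorphic_on_imp_continuous_on[OF holomorphic_deriv[OF zeta_holomorphic]]
      by (auto intro: continuous_on_subset)
  qed (use pathz(1) in auto)
  have gdef: "?g = linepath a1 a2 +++ linepath a2 a3 +++ linepath a3 a4 +++ linepath a4 a1"
    by (simp add: rectpath_def Let_def a1_def a2_def a3_def a4_def)
  have pim: "path_image ?g = closed_segment a1 a2 \<union> closed_segment a2 a3 \<union> closed_segment a3 a4 \<union> closed_segment a4 a1"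
    unfolding gdef by (auto simp: path_image_join)
  have c: "continuous_on (closed_segment a1 a2) F" "continuous_on (closed_segment a2 a3) F"
     "continuous_on (closed_segment a3 a4) F" "continuous_on (closed_segment a4 a1) F"
    by (rule continuous_on_subset[OF contF[unfolded pim]]; blast)+
  have i: "F contour_integrable_on linepath a1 a2" "F contour_integrable_on linepath a2 a3"
     "F contour_integrable_on linepath a3 a4" "F contour_integrable_on linepath a4 a1"
    using c by (auto intro: contour_integrable_continuous_linepath)
  have "contour_integral ?g F = contour_integral (linepath a1 a2) F + (contour_integral (linepath a2 a3) F
     + (contour_integral (linepath a3 a4) F + contour_integral (linepath a4 a1) F))"
    unfolding gdef using i by simp
  also have "contour_integral (linepath a3 a4) F = - contour_integral (linepath a4 a3) F"
    by (rule contour_integral_reverse_linepath[OF c(3)])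
  also have "contour_integral (linepath a4 a1) F = - contour_integral (linepath a1 a4) F"
    by (rule contour_integral_reverse_linepath[OF c(4)])
  finally show ?thesis using arg unfolding sum Fe by (simp add: a1_def a2_def a3_def a4_def algebra_simps)
qed

text \<open>A form of Landau's formula. Only the right side grows linearly with T; the top and left
  sides are O(ln T), while the bottom side and the part of the main term that belongs to t0 are
  constants collected in \<open>D\<close>.\<close>

lemma zeros_exp_sum:
  assumes \<kappa>: "\<kappa> > 0" and t: "4 \<le> t0" and nz: "\<forall>\<rho>\<in>nontrivial_zeros. Im \<rho> \<noteq> t0"
  shows "\<exists>C. \<forall>T>t0. (\<forall>\<rho>\<in>nontrivial_zeros. Im \<rho> \<noteq> T) \<longrightarrow>
    norm (2 * of_real pi * \<i> * (\<Sum>\<rho> | \<rho> \<in> nontrivial_zeros \<and> t0 < Im \<rho> \<and> Im \<rho> < T. of_nat (nat (zorder zeta \<rho>)) * exp (of_real \<kappa> * \<rho>))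
       + \<i> * of_real (T * von_mangoldt (exp \<kappa>))) \<le> C * ln T"
proof -
  let ?F = "\<lambda>s. exp (of_real \<kappa> * s) * (deriv zeta s / zeta s)"
  obtain C1 where C1: "\<And>t1 t2. norm (contour_integral (linepath (Complex (5/4) t1) (Complex (5/4) t2)) ?F
      + \<i> * of_real ((t2 - t1) * von_mangoldt (exp \<kappa>))) \<le> C1"
    using contour_integral_exp_logderiv_right[of "5/4" \<kappa>] by auto
  obtain C2 where C2: "\<forall>T\<ge>4. (\<forall>\<rho>\<in>nontrivial_zeros. Im \<rho> \<noteq> T) \<longrightarrow>
     norm (contour_integral (linepath (Complex (-1/4) T) (Complex (5/4) T)) ?F) \<le> C2 * ln T"
    using horizontal_integral_exp_logderiv[OF less_imp_le[OF \<kappa>]] by (rule exE)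
  have "t0 \<ge> 2" using t by simp
  then obtain C3 where C3: "\<forall>T\<ge>t0. norm (contour_integral (linepath (Complex (-1/4) t0) (Complex (-1/4) T)) ?F) \<le> C3 * ln T"
    using left_integral_exp_logderiv[of t0 "-1/4" \<kappa>] \<kappa> by auto
  define D where "D = \<bar>C1\<bar> + \<bar>t0 * von_mangoldt (exp \<kappa>)\<bar> + \<bar>C2 * ln t0\<bar>"
  have "norm (2 * of_real pi * \<i> * (\<Sum>\<rho> | \<rho> \<in> nontrivial_zeros \<and> t0 < Im \<rho> \<and> Im \<rho> < T. of_nat (nat (zorder zeta \<rho>)) * exp (of_real \<kappa> * \<rho>))
       + \<i> * of_real (T * von_mangoldt (exp \<kappa>))) \<le> (D + C2 + C3) * ln T"
    if T: "T > t0" and nT: "\<forall>\<rho>\<in>nontrivial_zeros. Im \<rho> \<noteq> T" for T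
  proof -
    define b where "b = contour_integral (linepath (Complex (-1/4) t0) (Complex (5/4) t0)) ?F"
    define r where "r = contour_integral (linepath (Complex (5/4) t0) (Complex (5/4) T)) ?F"
    define u where "u = contour_integral (linepath (Complex (-1/4) T) (Complex (5/4) T)) ?F"
    define l where "l = contour_integral (linepath (Complex (-1/4) t0) (Complex (-1/4) T)) ?F"
    let ?V = "von_mangoldt (exp \<kappa>)"
    have lnT: "ln T \<ge> 1" using t T by (intro ln_4_ge_1) simp
    have e: "2 * of_real pi * \<i> * (\<Sum>\<rho> | \<rho> \<in> nontrivial_zeros \<and> t0 < Im \<rho> \<and> Im \<rho> < T. of_nat (nat (zorder zeta \<rho>)) * exp (of_real \<kappa> * \<rho>))
        = b + r - u - l"
      unfolding b_def r_def u_def l_def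
      by (rule zeros_sum_contour[OF _ t T nz nT]) (intro holomorphic_intros)
    have b: "norm b \<le> \<bar>C2 * ln t0\<bar>" unfolding b_def using C2[rule_format, OF t] nz by force
    have r: "norm (r + \<i> * of_real ((T - t0) * ?V)) \<le> C1" unfolding r_def by (rule C1)
    have u: "norm u \<le> C2 * ln T" unfolding u_def using C2[rule_format, of T] nT t T by force
    have l: "norm l \<le> C3 * ln T" unfolding l_def using C3 T by simp
    have "b + r - u - l + \<i> * of_real (T * ?V)
        = ((b + (r + \<i> * of_real ((T - t0) * ?V))) + \<i> * of_real (t0 * ?V)) - (u + l)"
      by (simp add: algebra_simps)
    also have "norm \<dots> \<le> ((norm b + norm (r + \<i> * of_real ((T - t0) * ?V))) + norm (\<i> * complex_of_real (t0 * ?V))) + (norm u + norm l)"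
      by (intro order_trans[OF norm_triangle_ineq4] add_mono order_trans[OF norm_triangle_ineq] order_refl)
    also have "norm (\<i> * complex_of_real (t0 * ?V)) = \<bar>t0 * ?V\<bar>" unfolding norm_mult norm_of_real by simp
    finally have "norm (b + r - u - l + \<i> * of_real (T * ?V)) \<le> D + (C2 * ln T + C3 * ln T)"
      using b r u l unfolding D_def by linarith
    also have "D \<le> D * ln T" using lnT by (simp add: D_def mult_le_cancel_left1)
    finally show ?thesis unfolding e by (simp add: algebra_simps)
  qed
  then show ?thesis by (intro exI[of _ "D + C2 + C3"] allI impI)
qed

text \<open>The Riemann-von Mangoldt formula. Now \<open>von_mangoldt 1\<close> = 0 leaves the right
  side bounded, and the left side, which enters with a minus sign, carries the main term.\<close>

lemma zeros_count:
  assumes t: "4 \<le> t0" and nz: "\<forall>\<rho>\<in>nontrivial_zeros. Im \<rho> \<noteq> t0"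
  shows "\<exists>C. \<forall>T>t0. (\<forall>\<rho>\<in>nontrivial_zeros. Im \<rho> \<noteq> T) \<longrightarrow>
    norm (2 * of_real pi * \<i> * (\<Sum>\<rho> | \<rho> \<in> nontrivial_zeros \<and> t0 < Im \<rho> \<and> Im \<rho> < T. of_nat (nat (zorder zeta \<rho>)))
       - \<i> * of_real (T * (ln (T / (2 * pi)) - 1))) \<le> C * ln T"
proof -
  let ?F = "\<lambda>s. 1 * (deriv zeta s / zeta s)"
  have "von_mangoldt 1 = 0" by (rule von_mangoldt_le_1) simp
  then obtain C1 where C1: "\<And>t1 t2. norm (contour_integral (linepath (Complex (5/4) t1) (Complex (5/4) t2)) ?F) \<le> C1"
    using contour_integral_exp_logderiv_right[of "5/4" 0] by auto
  obtain C2 where C2: "\<forall>T\<ge>4. (\<forall>\<rho>\<in>nontrivial_zeros. Im \<rho> \<noteq> T) \<longrightarrow>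
     norm (contour_integral (linepath (Complex (-1/4) T) (Complex (5/4) T)) ?F) \<le> C2 * ln T"
    using horizontal_integral_exp_logderiv[of 0] by auto
  have "t0 \<ge> 2" using t by simp
  then obtain C3 where C3: "\<forall>T\<ge>t0. norm (contour_integral (linepath (Complex (-1/4) t0) (Complex (-1/4) T)) ?F
      + \<i> * of_real (T * (ln (T / (2 * pi)) - 1))) \<le> C3 * ln T"
    using left_integral_logderiv[of t0 "-1/4"] by auto
  define D where "D = \<bar>C1\<bar> + \<bar>C2 * ln t0\<bar>"
  have "norm (2 * of_real pi * \<i> * (\<Sum>\<rho> | \<rho> \<in> nontrivial_zeros \<and> t0 < Im \<rho> \<and> Im \<rho> < T. of_nat (nat (zorder zeta \<rho>)))
       - \<i> * of_real (T * (ln (T / (2 * pi)) - 1))) \<le> (D + C2 + C3) * ln T"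
    if T: "T > t0" and nT: "\<forall>\<rho>\<in>nontrivial_zeros. Im \<rho> \<noteq> T" for T
  proof -
    define b where "b = contour_integral (linepath (Complex (-1/4) t0) (Complex (5/4) t0)) ?F"
    define r where "r = contour_integral (linepath (Complex (5/4) t0) (Complex (5/4) T)) ?F"
    define u where "u = contour_integral (linepath (Complex (-1/4) T) (Complex (5/4) T)) ?F"
    define l where "l = contour_integral (linepath (Complex (-1/4) t0) (Complex (-1/4) T)) ?F"
    define m where "m = \<i> * of_real (T * (ln (T / (2 * pi)) - 1))"
    have lnT: "ln T \<ge> 1" using t T by (intro ln_4_ge_1) simp
    have e: "2 * of_real pi * \<i> * (\<Sum>\<rho> | \<rho> \<in> nontrivial_zeros \<and> t0 < Im \<rho> \<and> Im \<rho> < T. of_nat (nat (zorder zeta \<rho>)))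
        = b + r - u - l"
      unfolding b_def r_def u_def l_def
      using zeros_sum_contour[of "\<lambda>_. 1", OF _ t T nz nT] by simp
    have b: "norm b \<le> \<bar>C2 * ln t0\<bar>" unfolding b_def using C2[rule_format, OF t] nz by force
    have r: "norm r \<le> C1" unfolding r_def by (rule C1)
    have u: "norm u \<le> C2 * ln T" unfolding u_def using C2[rule_format, of T] nT t T by force
    have l: "norm (l + m) \<le> C3 * ln T" unfolding l_def m_def using C3 T by simp
    have "b + r - u - l - m = (b + r) - (u + (l + m))" by simp
    also have "norm \<dots> \<le> (norm b + norm r) + (norm u + norm (l + m))"
      by (intro order_trans[OF norm_triangle_ineq4] add_mono norm_triangle_ineq)
    finally have "norm (b + r - u - l - m) \<le> D + (C2 * ln T + C3 * ln T)"
      using b r u l unfolding D_def by linarith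
    also have "D \<le> D * ln T" using lnT by (simp add: D_def mult_le_cancel_left1)
    finally show ?thesis unfolding e m_def by (simp add: algebra_simps)
  qed
  then show ?thesis by (intro exI[of _ "D + C2 + C3"] allI impI)
qed

section \<open>From contour heights to the windows of \<open>eta\<close>\<close>

lemma exists_zero_free_height:
  "\<exists>T'\<ge>T. T' \<le> T + 1 \<and> (\<forall>\<rho>\<in>nontrivial_zeros. Im \<rho> \<noteq> T')"
proof -
  have "finite (Im ` {\<rho> \<in> nontrivial_zeros. T \<le> Im \<rho> \<and> Im \<rho> \<le> T + 1})"
    by (intro finite_imageI finite_nontrivial_zeros)
  moreover have "infinite {T..T + 1}" by (rule infinite_Icc) simp
  ultimately have "{T..T + 1} - Im ` {\<rho> \<in> nontrivial_zeros. T \<le> Im \<rho> \<and> Im \<rho> \<le> T + 1} \<noteq> {}"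
    by (metis Diff_infinite_finite finite.emptyI)
  then obtain T' where T': "T' \<in> {T..T + 1}" "T' \<notin> Im ` {\<rho> \<in> nontrivial_zeros. T \<le> Im \<rho> \<and> Im \<rho> \<le> T + 1}"
    by blast
  then have "\<forall>\<rho>\<in>nontrivial_zeros. Im \<rho> \<noteq> T'" by auto
  then show ?thesis using T'(1) by auto
qed

text \<open>A crude Stirling formula. The difference is 1 at M = 1, and one step changes it by 1 -
  (M + 1) l with l = ln (1 + 1 / M). Because 1 / (M + 1) \<le> l \<le> 1 / M, the change lies
  between - l and 0, and the numbers l add up to ln M.\<close>

lemma sum_ln_bounds:
  assumes "M \<ge> 1"
  shows "(\<Sum>n\<in>{1..<M}. ln (real n)) - (real M * ln (real M) - real M) \<le> 1"
    and "- 2 * ln (real M) \<le> (\<Sum>n\<in>{1..<M}. ln (real n)) - (real M * ln (real M) - real M)"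
proof -
  define D where "D M = (\<Sum>n\<in>{1..<M}. ln (real n)) - (real M * ln (real M) - real M)" for M
  have step: "D (Suc M) \<le> D M" "D (Suc M) \<ge> D M - 2 * (ln (real (Suc M)) - ln (real M))" if M: "M \<ge> 1" for M
  proof -
    define l where "l = ln (real (Suc M)) - ln (real M)"
    have "D (Suc M) - D M = ln (real M) - (real (Suc M) * ln (real (Suc M)) - real M * ln (real M)) + 1"
      using M by (simp add: D_def)
    also have "\<dots> = 1 - (real M + 1) * l" by (simp add: l_def algebra_simps)
    finally have d: "D (Suc M) - D M = 1 - (real M + 1) * l" .
    have "1 + 1 / real M = real (Suc M) / real M" using M by (simp add: field_simps)
    then have l: "l = ln (1 + 1 / real M)" using M by (simp add: l_def ln_div del: of_nat_Suc)
    have u: "l \<le> 1 / real M" unfolding l using M by (intro ln_add_one_self_le_self) auto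
    have "- l = ln (real M / real (Suc M))" unfolding l_def using M by (simp add: ln_div)
    also have "\<dots> \<le> real M / real (Suc M) - 1" using M by (intro ln_le_minus_one) auto
    also have "\<dots> = - (1 / (real M + 1))" by (simp add: field_simps)
    finally have lo: "l \<ge> 1 / (real M + 1)" by simp
    then have "(real M + 1) * l \<ge> (real M + 1) * (1 / (real M + 1))" by (intro mult_left_mono) auto
    then have "(real M + 1) * l \<ge> 1" by simp
    then show "D (Suc M) \<le> D M" using d by linarith
    have "real M * l \<le> real M * (1 / real M)" using u by (intro mult_left_mono) auto
    then have "real M * l \<le> 1" using M by simp
    moreover have "(real M + 1) * l = real M * l + l" by (simp add: algebra_simps)
    ultimately have a: "D (Suc M) - D M \<ge> - l" using d by linarith
    have "l \<ge> 0" using lo order_trans[of 0 "1 / (real M + 1)" l] by simp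
    then show "D (Suc M) \<ge> D M - 2 * (ln (real (Suc M)) - ln (real M))"
      using a unfolding l_def[symmetric] by linarith
  qed
  have D1: "D 1 = 1" by (simp add: D_def)
  have "D M \<le> 1 \<and> - 2 * ln (real M) \<le> D M"
    using assms
  proof (induction M rule: dec_induct)
    case base
    then show ?case using D1 by simp
  next
    case (step n)
    have "D (Suc n) \<le> 1" using step.IH \<open>1 \<le> n\<close> \<open>\<And>M. 1 \<le> M \<Longrightarrow> D (Suc M) \<le> D M\<close>[of n] by linarith
    moreover have "- 2 * ln (real (Suc n)) \<le> D (Suc n)"
      using step.IH \<open>\<And>M. 1 \<le> M \<Longrightarrow> D M - 2 * (ln (real (Suc M)) - ln (real M)) \<le> D (Suc M)\<close>[of n] \<open>1 \<le> n\<close>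
      by (simp add: algebra_simps)
    ultimately show ?case by simp
  qed
  then show "(\<Sum>n\<in>{1..<M}. ln (real n)) - (real M * ln (real M) - real M) \<le> 1"
    "- 2 * ln (real M) \<le> (\<Sum>n\<in>{1..<M}. ln (real n)) - (real M * ln (real M) - real M)"
    by (simp_all add: D_def)
qed

text \<open>Half-open like the floor condition in \<open>eta\<close>, so that consecutive windows
  tile the line even if a zero lies exactly at a window end.\<close>

definition zeros_between :: "real \<Rightarrow> real \<Rightarrow> complex set" where
  "zeros_between A B = {\<rho> \<in> nontrivial_zeros. A \<le> Im \<rho> \<and> Im \<rho> < B}"

lemma finite_zeros_between: "finite (zeros_between A B)"
  by (rule finite_subset[OF _ finite_nontrivial_zeros[of A B]]) (auto simp: zeros_between_def)

lemma sum_zeros_between_split: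
  assumes "A \<le> B" "B \<le> C"
  shows "sum g (zeros_between A C) = sum g (zeros_between A B) + sum g (zeros_between B C)"
proof -
  have "zeros_between A C = zeros_between A B \<union> zeros_between B C" using assms by (auto simp: zeros_between_def)
  moreover have "zeros_between A B \<inter> zeros_between B C = {}" by (auto simp: zeros_between_def)
  ultimately show ?thesis by (simp add: sum.union_disjoint finite_zeros_between)
qed

text \<open>The change of variable \<rho> = 1/2 + \<i> (t + h). It sends Re t to Im \<rho> - h,
  which turns the floor condition into a window of ordinates, and exp (\<i> a t) into exp (a \<rho>)
  times a constant independent of \<rho>.\<close>

lemma eta_eq_sum_zeros:
  fixes a h :: real
  assumes a: "a > 0"
  shows "eta a h n = of_real (1 / a * ln (real n / a)) +
     (\<Sum>\<rho>\<in>zeros_between (h + 2 * pi * real n / a) (h + 2 * pi * real (Suc n) / a).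
        of_nat (nat (zorder zeta \<rho>)) * (exp (of_real a * \<rho>) * exp (- (of_real a * (1 / 2 + \<i> * of_real h))) - 1))"
proof -
  have mem: "t + of_real h \<in> S_set \<longleftrightarrow> 1 / 2 + \<i> * (t + of_real h) \<in> nontrivial_zeros" for t
  proof
    assume "t + of_real h \<in> S_set"
    then obtain \<rho> where \<rho>: "t + of_real h = - \<i> * (\<rho> - 1 / 2)" "\<rho> \<in> nontrivial_zeros"
      unfolding S_set_def by (rule imageE)
    have "1 / 2 + \<i> * (- \<i> * (\<rho> - 1 / 2)) = \<rho>" by (simp add: algebra_simps)
    with \<rho>(2) show "1 / 2 + \<i> * (t + of_real h) \<in> nontrivial_zeros" unfolding \<rho>(1) by simp
  next
    assume "1 / 2 + \<i> * (t + of_real h) \<in> nontrivial_zeros"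
    moreover have "t + of_real h = - \<i> * ((1 / 2 + \<i> * (t + of_real h)) - 1 / 2)" by (simp add: algebra_simps)
    ultimately show "t + of_real h \<in> S_set" unfolding S_set_def by (rule rev_image_eqI)
  qed
  have fl: "\<lfloor>a * y / (2 * pi)\<rfloor> = int n \<longleftrightarrow> h + 2 * pi * real n / a \<le> y + h \<and> y + h < h + 2 * pi * real (Suc n) / a" for y
  proof -
    have "\<lfloor>a * y / (2 * pi)\<rfloor> = int n \<longleftrightarrow> real n \<le> a * y / (2 * pi) \<and> a * y / (2 * pi) < real n + 1"
      by (simp add: floor_eq_iff)
    also have "real n \<le> a * y / (2 * pi) \<longleftrightarrow> 2 * pi * real n / a \<le> y" using a by (simp add: field_simps)
    also have "a * y / (2 * pi) < real n + 1 \<longleftrightarrow> y < 2 * pi * real (Suc n) / a" using a by (simp add: field_simps)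
    finally show ?thesis by simp
  qed
  have "(\<Sum>t | t + of_real h \<in> S_set \<and> \<lfloor>a * Re t / (2 * pi)\<rfloor> = int n.
        of_nat (S_mult (t + of_real h)) * (exp (\<i> * of_real a * t) - 1))
    = (\<Sum>\<rho>\<in>zeros_between (h + 2 * pi * real n / a) (h + 2 * pi * real (Suc n) / a).
        of_nat (nat (zorder zeta \<rho>)) * (exp (of_real a * \<rho>) * exp (- (of_real a * (1 / 2 + \<i> * of_real h))) - 1))"
  proof (rule sum.reindex_bij_witness[where j = "\<lambda>t. 1 / 2 + \<i> * (t + of_real h)" and i = "\<lambda>\<rho>. - \<i> * (\<rho> - 1 / 2) - of_real h"])
    fix t assume t: "t \<in> {t. t + of_real h \<in> S_set \<and> \<lfloor>a * Re t / (2 * pi)\<rfloor> = int n}"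
    show "- \<i> * (1 / 2 + \<i> * (t + of_real h) - 1 / 2) - of_real h = t" by (simp add: algebra_simps)
    have "Im (1 / 2 + \<i> * (t + of_real h)) = Re t + h" by simp
    then show "1 / 2 + \<i> * (t + of_real h) \<in> zeros_between (h + 2 * pi * real n / a) (h + 2 * pi * real (Suc n) / a)"
      using t mem[of t] fl[of "Re t"] by (simp only: zeros_between_def mem_Collect_eq)
    have "exp (of_real a * (1 / 2 + \<i> * (t + of_real h))) * exp (- (of_real a * (1 / 2 + \<i> * of_real h))) = exp (\<i> * of_real a * t)"
      unfolding exp_add[symmetric] by (rule arg_cong[of _ _ exp]) (simp add: algebra_simps)
    then show "of_nat (nat (zorder zeta (1 / 2 + \<i> * (t + of_real h)))) * (exp (of_real a * (1 / 2 + \<i> * (t + of_real h))) * exp (- (of_real a * (1 / 2 + \<i> * of_real h))) - 1)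
       = of_nat (S_mult (t + of_real h)) * (exp (\<i> * of_real a * t) - 1)"
      by (simp only: S_mult_def)
  next
    fix \<rho> assume \<rho>: "\<rho> \<in> zeros_between (h + 2 * pi * real n / a) (h + 2 * pi * real (Suc n) / a)"
    show e: "1 / 2 + \<i> * (- \<i> * (\<rho> - 1 / 2) - of_real h + of_real h) = \<rho>" by (simp add: algebra_simps)
    have "Re (- \<i> * (\<rho> - 1 / 2) - of_real h) + h = Im \<rho>" by simp
    then show "- \<i> * (\<rho> - 1 / 2) - of_real h \<in> {t. t + of_real h \<in> S_set \<and> \<lfloor>a * Re t / (2 * pi)\<rfloor> = int n}"
      using \<rho> e mem[of "- \<i> * (\<rho> - 1 / 2) - of_real h"] fl[of "Re (- \<i> * (\<rho> - 1 / 2) - of_real h)"]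
      by (simp only: zeros_between_def mem_Collect_eq)
  qed
  then show ?thesis by (simp only: eta_def)
qed

text \<open>Here T may itself be the ordinate of a zero. The contour results are applied at a
  zero-free T' just above it, and the zeros between the two heights are O(ln T) in number with
  bounded weights. The main terms are left at T'; moving them to the exact height is a question
  about real functions. The zeros between A0 and the fixed height t0 only contribute a
  constant.\<close>

lemma zeros_weighted_sum:
  fixes a :: real and X :: complex
  assumes a: "a > 0"
  shows "\<exists>t0\<ge>4. \<exists>C\<ge>0. A0 \<le> t0 \<and> (\<forall>T>t0. \<exists>T'\<ge>T. T' \<le> T + 1 \<and>
     norm ((\<Sum>\<rho>\<in>zeros_between A0 T. of_nat (nat (zorder zeta \<rho>)) * (exp (of_real a * \<rho>) * X - 1))
       + of_real (T' / (2 * pi) * von_mangoldt (exp a)) * X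
       + of_real (T' / (2 * pi) * (ln (T' / (2 * pi)) - 1))) \<le> C * ln (T + 1))"
proof -
  define m where "m \<rho> = (of_nat (nat (zorder zeta \<rho>)) :: complex)" for \<rho>
  define g where "g \<rho> = m \<rho> * (exp (of_real a * \<rho>) * X - 1)" for \<rho>
  obtain t0 where t0: "t0 \<ge> max 4 A0" "\<forall>\<rho>\<in>nontrivial_zeros. Im \<rho> \<noteq> t0"
    using exists_zero_free_height[of "max 4 A0"] by blast
  have t4: "t0 \<ge> 4" "A0 \<le> t0" using t0(1) by auto
  define V where "V = von_mangoldt (exp a)"
  obtain C1 where C1: "\<forall>T>t0. (\<forall>\<rho>\<in>nontrivial_zeros. Im \<rho> \<noteq> T) \<longrightarrow>
    norm (2 * of_real pi * \<i> * (\<Sum>\<rho> | \<rho> \<in> nontrivial_zeros \<and> t0 < Im \<rho> \<and> Im \<rho> < T. m \<rho> * exp (of_real a * \<rho>))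
       + \<i> * of_real (T * V)) \<le> C1 * ln T"
    unfolding m_def V_def using zeros_exp_sum[OF a t4(1) t0(2)] by (rule exE)
  obtain C2 where C2: "\<forall>T>t0. (\<forall>\<rho>\<in>nontrivial_zeros. Im \<rho> \<noteq> T) \<longrightarrow>
    norm (2 * of_real pi * \<i> * (\<Sum>\<rho> | \<rho> \<in> nontrivial_zeros \<and> t0 < Im \<rho> \<and> Im \<rho> < T. m \<rho>)
       - \<i> * of_real (T * (ln (T / (2 * pi)) - 1))) \<le> C2 * ln T"
    unfolding m_def using zeros_count[OF t4(1) t0(2)] by (rule exE)
  obtain C3 where C3: "C3 > 0" "\<forall>T\<ge>4. finite {\<rho> \<in> nontrivial_zeros. \<bar>Im \<rho> - T\<bar> \<le> 1}
     \<and> real (\<Sum>\<rho> | \<rho> \<in> nontrivial_zeros \<and> \<bar>Im \<rho> - T\<bar> \<le> 1. nat (zorder zeta \<rho>)) \<le> C3 * ln T"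
    using zero_order_count by (elim exE conjE)
  define W0 where "W0 = norm (sum g (zeros_between A0 t0))"
  \<comment> \<open>A bound for one weight exp (a \<rho>) X - 1, as Re \<rho> \<le> 1 and a >
    0.\<close>
  define D where "D = exp a * norm X + 1"
  define C where "C = W0 + \<bar>C1\<bar> * norm X + \<bar>C2\<bar> + C3 * D"
  have C0: "C \<ge> 0" using C3(1) by (simp add: C_def W0_def D_def)
  have "\<exists>T'\<ge>T. T' \<le> T + 1 \<and>
     norm (sum g (zeros_between A0 T) + of_real (T' / (2 * pi) * V) * X
       + of_real (T' / (2 * pi) * (ln (T' / (2 * pi)) - 1))) \<le> C * ln (T + 1)" if T: "T > t0" for T
  proof -
    obtain T' where T'': "T' \<ge> T" "T' \<le> T + 1" "\<forall>\<rho>\<in>nontrivial_zeros. Im \<rho> \<noteq> T'"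
      using exists_zero_free_height[of T] by blast
    have T': "T' > t0" using T'' T by simp
      have T4: "T \<ge> 4" using T t4 by simp
      have lnT: "ln T' \<ge> 1" using T' t4 by (intro ln_4_ge_1) simp
      have lnT1: "ln T' \<le> ln (T + 1)" "ln T \<le> ln (T + 1)" using T'' T' t4 T4 by (auto intro!: ln_mono)
      have eq: "zeros_between t0 T' = {\<rho>. \<rho> \<in> nontrivial_zeros \<and> t0 < Im \<rho> \<and> Im \<rho> < T'}"
        using t0(2) by (auto simp: zeros_between_def order.order_iff_strict)
      define P where "P = (\<Sum>\<rho>\<in>zeros_between t0 T'. m \<rho> * exp (of_real a * \<rho>))"
      define N where "N = (\<Sum>\<rho>\<in>zeros_between t0 T'. m \<rho>)"
      define q where "q = T' * (ln (T' / (2 * pi)) - 1)"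
      have sg: "sum g (zeros_between t0 T') = P * X - N"
        unfolding g_def P_def N_def by (simp add: algebra_simps sum_subtractf sum_distrib_left)
      have p1: "norm (2 * of_real pi * \<i> * P + \<i> * of_real (T' * V)) \<le> C1 * ln T'"
        unfolding P_def eq using C1 T' T''(3) by blast
      have n1: "norm (2 * of_real pi * \<i> * N - \<i> * of_real q) \<le> C2 * ln T'"
        unfolding N_def eq q_def using C2 T' T''(3) by blast
      have div: "norm z \<le> \<bar>c\<bar> * ln T'" if "norm (2 * of_real pi * \<i> * z) \<le> c * ln T'" for z :: complex and c
      proof -
        have "norm z * 1 \<le> norm z * (2 * pi)" using pi_gt3 by (intro mult_left_mono) auto
        also have "\<dots> = norm (2 * of_real pi * \<i> * z)" by (simp add: norm_mult)
        also have "\<dots> \<le> c * ln T'" by (rule that)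
        also have "\<dots> \<le> \<bar>c\<bar> * ln T'" using lnT by (intro mult_right_mono) auto
        finally show ?thesis by simp
      qed
      have "norm (P + of_real (T' / (2 * pi) * V)) \<le> \<bar>C1\<bar> * ln T'"
        by (rule div) (use p1 in \<open>simp add: algebra_simps\<close>)
      then have pX: "norm ((P + of_real (T' / (2 * pi) * V)) * X) \<le> \<bar>C1\<bar> * ln T' * norm X"
        unfolding norm_mult by (rule mult_right_mono) simp
      have nX: "norm (N - of_real (q / (2 * pi))) \<le> \<bar>C2\<bar> * ln T'"
        by (rule div) (use n1 in \<open>simp add: algebra_simps\<close>)
      have "norm (sum g (zeros_between T T')) \<le> (\<Sum>\<rho>\<in>zeros_between T T'. real (nat (zorder zeta \<rho>)) * D)"
      proof (rule sum_norm_le)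
        fix \<rho> assume "\<rho> \<in> zeros_between T T'"
        then have "Re \<rho> \<le> 1" by (simp add: zeros_between_def nontrivial_zeros_def)
        then have "norm (exp (of_real a * \<rho>)) \<le> exp a" using mult_left_mono[of "Re \<rho>" 1 a] a by (simp add: norm_exp_eq_Re)
        then have "norm (exp (of_real a * \<rho>) * X) \<le> exp a * norm X" unfolding norm_mult by (rule mult_right_mono) simp
        then have "norm (exp (of_real a * \<rho>) * X - 1) \<le> D"
          unfolding D_def using norm_triangle_ineq4[of "exp (of_real a * \<rho>) * X" 1] by simp
        then show "norm (g \<rho>) \<le> real (nat (zorder zeta \<rho>)) * D"
          unfolding g_def m_def norm_mult norm_of_nat by (rule mult_left_mono) simp
      qed
      also have "\<dots> = real (\<Sum>\<rho>\<in>zeros_between T T'. nat (zorder zeta \<rho>)) * D"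
        unfolding of_nat_sum by (rule sum_distrib_right[symmetric])
      also have "\<dots> \<le> C3 * ln T * D"
      proof (rule mult_right_mono)
        note c3 = C3(2)[rule_format, OF T4]
        have "(\<Sum>\<rho>\<in>zeros_between T T'. nat (zorder zeta \<rho>)) \<le> (\<Sum>\<rho> | \<rho> \<in> nontrivial_zeros \<and> \<bar>Im \<rho> - T\<bar> \<le> 1. nat (zorder zeta \<rho>))"
          by (rule sum_mono2[OF c3[THEN conjunct1]]) (use T'' in \<open>auto simp: zeros_between_def\<close>)
        then have "real (\<Sum>\<rho>\<in>zeros_between T T'. nat (zorder zeta \<rho>)) \<le> real (\<Sum>\<rho> | \<rho> \<in> nontrivial_zeros \<and> \<bar>Im \<rho> - T\<bar> \<le> 1. nat (zorder zeta \<rho>))"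
          by (rule of_nat_mono)
        then show "real (\<Sum>\<rho>\<in>zeros_between T T'. nat (zorder zeta \<rho>)) \<le> C3 * ln T"
          using c3[THEN conjunct2] by (rule order_trans)
        show "0 \<le> D" by (simp add: D_def)
      qed
      finally have w: "norm (sum g (zeros_between T T')) \<le> C3 * ln T * D" .
      have A_eq: "sum g (zeros_between A0 T) = sum g (zeros_between A0 t0) + (P * X - N) - sum g (zeros_between T T')"
        using sum_zeros_between_split[of A0 t0 T g] sum_zeros_between_split[of t0 T T' g] t4 T T'' by (simp add: sg)
      have qq: "T' / (2 * pi) * (ln (T' / (2 * pi)) - 1) = q / (2 * pi)" by (simp add: q_def)
      have "sum g (zeros_between A0 T) + of_real (T' / (2 * pi) * V) * X + of_real (T' / (2 * pi) * (ln (T' / (2 * pi)) - 1))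
         = (sum g (zeros_between A0 t0) + (P + of_real (T' / (2 * pi) * V)) * X) - ((N - of_real (q / (2 * pi))) + sum g (zeros_between T T'))"
        unfolding A_eq qq by (simp add: algebra_simps)
      also have "norm \<dots> \<le> (norm (sum g (zeros_between A0 t0)) + norm ((P + of_real (T' / (2 * pi) * V)) * X))
          + (norm (N - of_real (q / (2 * pi))) + norm (sum g (zeros_between T T')))"
        by (intro order_trans[OF norm_triangle_ineq4] add_mono norm_triangle_ineq)
      also have "\<dots> \<le> (W0 + \<bar>C1\<bar> * ln T' * norm X) + (\<bar>C2\<bar> * ln T' + C3 * ln T * D)"
        unfolding W0_def by (intro add_mono pX nX w order_refl)
      also have "\<dots> \<le> (W0 * ln (T + 1) + \<bar>C1\<bar> * ln (T + 1) * norm X) + (\<bar>C2\<bar> * ln (T + 1) + C3 * ln (T + 1) * D)"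
        using lnT lnT1 C3(1)
        by (intro add_mono mult_right_mono mult_left_mono) (auto simp: W0_def D_def mult_le_cancel_left1)
      also have "\<dots> = C * ln (T + 1)" by (simp add: C_def algebra_simps)
      finally show ?thesis using T'' by blast
  qed
  then have "\<forall>T>t0. \<exists>T'\<ge>T. T' \<le> T + 1 \<and>
     norm ((\<Sum>\<rho>\<in>zeros_between A0 T. of_nat (nat (zorder zeta \<rho>)) * (exp (of_real a * \<rho>) * X - 1))
       + of_real (T' / (2 * pi) * von_mangoldt (exp a)) * X
       + of_real (T' / (2 * pi) * (ln (T' / (2 * pi)) - 1))) \<le> C * ln (T + 1)"
    unfolding g_def m_def V_def by blast
  then show ?thesis using t4 C0 by blast
qed


lemma sum_zeros_between_telescope:
  assumes "M \<ge> 1" "mono \<tau>"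
  shows "(\<Sum>n\<in>{1..<M}. sum g (zeros_between (\<tau> n) (\<tau> (Suc n)))) = sum g (zeros_between (\<tau> 1) (\<tau> M))"
  using assms(1)
proof (induction M rule: dec_induct)
  case base
  have "zeros_between (\<tau> 1) (\<tau> 1) = {}" by (auto simp: zeros_between_def)
  then show ?case by simp
next
  case (step n)
  have "\<tau> 1 \<le> \<tau> n" "\<tau> n \<le> \<tau> (Suc n)" using step.hyps by (intro monoD[OF assms(2)]; simp)+
  from sum_zeros_between_split[OF this, of g] step show ?case by simp
qed

theorem theorem2:
  fixes x h :: real
  assumes "x > 1"
  shows "(\<lambda>M::nat.
            1 / of_nat M * (\<Sum>n\<in>{1..<M}. eta (ln x) h n)
            - (- of_real (von_mangoldt x / ln x) * of_real x powr (- (1 / 2 + \<i> * of_real h))))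
         \<in> O(\<lambda>M. of_real (ln (real M) / real M))"
proof -
  define a where "a = ln x"
  have a: "a > 0" using assms by (simp add: a_def)
  have ea: "exp a = x" using assms by (simp add: a_def)
  define X where "X = exp (- (complex_of_real a * (1 / 2 + \<i> * of_real h)))"
  have Xp: "of_real x powr (- (1 / 2 + \<i> * of_real h)) = X"
  proof -
    have "- (1 / 2 + \<i> * of_real h) * Ln (of_real x) = - (of_real a * (1 / 2 + \<i> * of_real h))"
      using assms by (simp add: a_def Ln_of_real algebra_simps)
    then show ?thesis using assms unfolding X_def powr_def by (simp only: if_False of_real_eq_0_iff) simp
  qed
  define V where "V = von_mangoldt x"
  define \<tau> where "\<tau> n = h + 2 * pi * real n / a" for n
  have mono: "mono \<tau>" unfolding \<tau>_def using a by (intro monoI add_left_mono divide_right_mono mult_left_mono) auto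
  define g where "g = (\<lambda>\<rho>. of_nat (nat (zorder zeta \<rho>)) * (exp (of_real a * \<rho>) * X - 1))"
  define L where "L M = (\<Sum>n\<in>{1..<M}. 1 / a * ln (real n / a))" for M
  have S: "(\<Sum>n\<in>{1..<M}. eta a h n) = of_real (L M) + sum g (zeros_between (\<tau> 1) (\<tau> M))" if "M \<ge> 1" for M
  proof -
    have "(\<Sum>n\<in>{1..<M}. eta a h n) = (\<Sum>n\<in>{1..<M}. of_real (1 / a * ln (real n / a)) + sum g (zeros_between (\<tau> n) (\<tau> (Suc n))))"
      by (intro sum.cong refl) (simp only: eta_eq_sum_zeros[OF a] \<tau>_def g_def X_def)
    also have "\<dots> = of_real (L M) + (\<Sum>n\<in>{1..<M}. sum g (zeros_between (\<tau> n) (\<tau> (Suc n))))"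
      by (simp only: sum.distrib L_def of_real_sum)
    finally show ?thesis unfolding sum_zeros_between_telescope[OF that mono] .
  qed
  obtain t0 C where C: "t0 \<ge> 4" "C \<ge> 0" "\<forall>T>t0. \<exists>T'\<ge>T. T' \<le> T + 1 \<and>
     norm (sum g (zeros_between (\<tau> 1) T) + of_real (T' / (2 * pi) * V) * X
       + of_real (T' / (2 * pi) * (ln (T' / (2 * pi)) - 1))) \<le> C * ln (T + 1)"
    using zeros_weighted_sum[OF a, of "\<tau> 1" X] unfolding ea V_def g_def by blast
  \<comment> \<open>Up to O(ln M) this function gives both competing main terms: the count of zeros
    at u = T' / (2 pi) and the sum \<open>L M\<close> at u = M / a.\<close>
  define \<phi> where "\<phi> u = u * (ln u - 1)" for u :: real
  \<comment> \<open>A bound for the distance between these two arguments: T' differs from 2 pi M / a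
    by at most |h| + 1.\<close>
  define K where "K = (\<bar>h\<bar> + 1) / (2 * pi)"
  have K: "K \<ge> 0" by (simp add: K_def)
  define B where "B = 2 * C + (3 + \<bar>ln a\<bar>) / a + 2 * K + K * \<bar>V\<bar> * norm X"
  \<comment> \<open>The side conditions hold for all large M. They put u and u' into the interval
    from 1 to M^2, where 0 \<le> ln \<le> 2 ln M, so replacing u' by u costs O(ln M) in \<phi> and
    O(1) in the von Mangoldt term.\<close>
  have main: "norm ((\<Sum>n\<in>{1..<M}. eta a h n) + of_real (real M / a * V) * X) \<le> B * ln (real M)"
    if M: "M \<ge> 4" and M1: "\<tau> M > t0" and M2: "1 \<le> real M / a - K" and M3: "real M / a + K \<le> (real M)\<^sup>2"
      and M4: "\<tau> M + 1 \<le> (real M)\<^sup>2" for M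
  proof -
    have lnM: "ln (real M) \<ge> 1" using M by (intro ln_4_ge_1) simp
    have lnM2: "ln ((real M)\<^sup>2) = 2 * ln (real M)" using M by (simp add: ln_realpow)
    obtain T' where T': "T' \<ge> \<tau> M" "T' \<le> \<tau> M + 1"
      "norm (sum g (zeros_between (\<tau> 1) (\<tau> M)) + of_real (T' / (2 * pi) * V) * X
       + of_real (T' / (2 * pi) * (ln (T' / (2 * pi)) - 1))) \<le> C * ln (\<tau> M + 1)"
      using C(3) M1 by blast
    define u u' where "u = real M / a" and "u' = T' / (2 * pi)"
    have du: "\<bar>u' - u\<bar> \<le> K"
    proof -
      have "u' - u = (T' - 2 * pi * real M / a) / (2 * pi)" using a by (simp add: u_def u'_def field_simps)
      moreover have "\<bar>T' - 2 * pi * real M / a\<bar> \<le> \<bar>h\<bar> + 1" using T'(1,2) unfolding \<tau>_def by linarith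
      ultimately show ?thesis by (simp add: K_def divide_right_mono)
    qed
    have uin: "u \<in> {1..(real M)\<^sup>2}" "u' \<in> {1..(real M)\<^sup>2}"
      using du K M2 M3 by (auto simp: u_def[symmetric] abs_le_iff)
    have phi: "norm (\<phi> u - \<phi> u') \<le> 2 * ln (real M) * norm (u - u')"
    proof (rule field_differentiable_bound[where S = "{1..(real M)\<^sup>2}" and f = \<phi> and f' = ln])
      show "(\<phi> has_field_derivative ln z) (at z within {1..(real M)\<^sup>2})" if "z \<in> {1..(real M)\<^sup>2}" for z
        unfolding \<phi>_def using that by (auto intro!: derivative_eq_intros)
      show "norm (ln z) \<le> 2 * ln (real M)" if "z \<in> {1..(real M)\<^sup>2}" for z
      proof -
        have "ln z \<le> ln ((real M)\<^sup>2)" using that M by (subst ln_le_cancel_iff) auto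
        then show ?thesis using that by (simp add: lnM2)
      qed
    qed (use uin in auto)
    also have "\<dots> \<le> 2 * ln (real M) * K" using du lnM by (intro mult_left_mono) (auto simp: abs_minus_commute)
    finally have phi: "norm (\<phi> u - \<phi> u') \<le> 2 * ln (real M) * K" .
    define D where "D = (\<Sum>n\<in>{1..<M}. ln (real n)) - (real M * ln (real M) - real M)"
    have D: "D \<le> 1" "- 2 * ln (real M) \<le> D" using sum_ln_bounds[of M] M by (auto simp: D_def)
    have "L M = (\<Sum>n\<in>{1..<M}. 1 / a * (ln (real n) - ln a))"
      unfolding L_def using a by (intro sum.cong refl) (simp add: ln_div)
    also have "\<dots> = 1 / a * ((\<Sum>n\<in>{1..<M}. ln (real n)) - (real M - 1) * ln a)"
      using M by (simp add: sum_subtractf of_nat_diff flip: sum_distrib_left sum_divide_distrib)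
    also have "(\<Sum>n\<in>{1..<M}. ln (real n)) = real M * ln (real M) - real M + D" by (simp add: D_def)
    \<comment> \<open>An exact identity: the terms of order M cancel, and one ln a survives because
      the sum has M - 1 terms rather than M.\<close>
    finally have "L M - \<phi> u = (D + ln a) / a"
      using a M by (simp add: \<phi>_def u_def ln_div field_simps)
    then have "\<bar>L M - \<phi> u\<bar> = \<bar>D + ln a\<bar> / a" using a by simp
    also have "\<dots> \<le> (3 * ln (real M) + \<bar>ln a\<bar> * ln (real M)) / a"
    proof (rule divide_right_mono)
      have "\<bar>ln a\<bar> * 1 \<le> \<bar>ln a\<bar> * ln (real M)" using lnM by (intro mult_left_mono) auto
      then show "\<bar>D + ln a\<bar> \<le> 3 * ln (real M) + \<bar>ln a\<bar> * ln (real M)" using D lnM by linarith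
    qed (use a in simp)
    finally have Lphi: "\<bar>L M - \<phi> u\<bar> \<le> (3 + \<bar>ln a\<bar>) / a * ln (real M)" by (simp add: algebra_simps)
    have lnT: "ln (\<tau> M + 1) \<le> 2 * ln (real M)"
    proof -
      have "ln (\<tau> M + 1) \<le> ln ((real M)\<^sup>2)" using M M1 M4 C(1) by (subst ln_le_cancel_iff) auto
      then show ?thesis by (simp only: lnM2)
    qed
    have "C * ln (\<tau> M + 1) \<le> C * (2 * ln (real M))" by (rule mult_left_mono[OF lnT C(2)])
    then have w: "norm (sum g (zeros_between (\<tau> 1) (\<tau> M)) + of_real (u' * V) * X + of_real (\<phi> u')) \<le> 2 * C * ln (real M)"
      using T'(3) unfolding \<phi>_def u'_def by simp
    have v: "norm (of_real ((u - u') * V) * X) \<le> K * \<bar>V\<bar> * norm X * ln (real M)"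
    proof -
      have "norm (of_real ((u - u') * V) * X) = \<bar>u' - u\<bar> * \<bar>V\<bar> * norm X"
        unfolding norm_mult norm_of_real abs_mult by (simp add: abs_minus_commute)
      also have "\<dots> \<le> K * \<bar>V\<bar> * norm X" using du by (intro mult_right_mono) auto
      also have "\<dots> \<le> K * \<bar>V\<bar> * norm X * ln (real M)"
        using mult_left_mono[OF lnM, of "K * \<bar>V\<bar> * norm X"] K by simp
      finally show ?thesis .
    qed
    \<comment> \<open>The - 1 in \<open>eta\<close> counts the zeros with a negative sign, so the
      sum over zeros contains - \<phi> u', and this meets \<open>L M\<close>, which is close to
      \<phi> u.\<close>
    have "(\<Sum>n\<in>{1..<M}. eta a h n) + of_real (u * V) * X
        = ((sum g (zeros_between (\<tau> 1) (\<tau> M)) + of_real (u' * V) * X + of_real (\<phi> u')) + of_real (L M - \<phi> u))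
          + (of_real (\<phi> u - \<phi> u') + of_real ((u - u') * V) * X)"
      using S[of M] M by (simp add: algebra_simps)
    also have "norm \<dots> \<le> (norm (sum g (zeros_between (\<tau> 1) (\<tau> M)) + of_real (u' * V) * X + of_real (\<phi> u')) + norm (complex_of_real (L M - \<phi> u)))
          + (norm (complex_of_real (\<phi> u - \<phi> u')) + norm (of_real ((u - u') * V) * X))"
      by (intro order_trans[OF norm_triangle_ineq] add_mono norm_triangle_ineq)
    also have "\<dots> \<le> (2 * C * ln (real M) + (3 + \<bar>ln a\<bar>) / a * ln (real M)) + (2 * ln (real M) * K + K * \<bar>V\<bar> * norm X * ln (real M))"
      unfolding norm_of_real using phi by (intro add_mono w Lphi v) simp
    also have "\<dots> = B * ln (real M)" by (simp add: B_def algebra_simps)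
    finally show ?thesis by (simp only: u_def)
  qed
  have ev: "\<forall>\<^sub>F M::nat in sequentially. \<tau> M > t0" "\<forall>\<^sub>F M::nat in sequentially. 1 \<le> real M / a - K"
    "\<forall>\<^sub>F M::nat in sequentially. real M / a + K \<le> (real M)\<^sup>2" "\<forall>\<^sub>F M::nat in sequentially. \<tau> M + 1 \<le> (real M)\<^sup>2"
    unfolding \<tau>_def using a by real_asymp+
  show ?thesis
  proof (rule bigoI[where c = B])
    show "\<forall>\<^sub>F M in sequentially. norm (1 / of_nat M * (\<Sum>n\<in>{1..<M}. eta (ln x) h n)
            - (- of_real (von_mangoldt x / ln x) * of_real x powr (- (1 / 2 + \<i> * of_real h))))
          \<le> B * norm (complex_of_real (ln (real M) / real M))"
      using ev(1,2,3,4) eventually_ge_at_top[of "4::nat"]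
    proof eventually_elim
      case (elim M)
      have Mp: "real M > 0" using elim by simp
      have "1 / of_nat M * (\<Sum>n\<in>{1..<M}. eta (ln x) h n)
            - (- of_real (von_mangoldt x / ln x) * of_real x powr (- (1 / 2 + \<i> * of_real h)))
         = ((\<Sum>n\<in>{1..<M}. eta a h n) + of_real (real M / a * V) * X) / of_nat M"
        unfolding Xp a_def[symmetric] V_def[symmetric] using Mp a by (simp add: field_simps)
      also have "norm \<dots> = norm ((\<Sum>n\<in>{1..<M}. eta a h n) + of_real (real M / a * V) * X) / real M"
        by (simp add: norm_divide)
      also have "\<dots> \<le> B * ln (real M) / real M"
        using elim by (intro divide_right_mono main) auto
      also have "\<dots> = B * norm (complex_of_real (ln (real M) / real M))"
        unfolding norm_of_real using elim by simp
      finally show ?case .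
    qed
  qed
qed

end
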